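(* Suppose that $(h,B,D,P)$, $h>0$, is a classical (at least $C^1$) solution of (DMHD) with initial value $(h,B)|_{t=0}=(h_0,B_0)$. Then it is the unique dissipative solution of (DMHD) with the same initial value.
   Context: $T>0$, $\mathbb{T}=\mathbb{R}/\mathbb{Z}$; solutions are considered on $[0,T]\times\mathbb{T}^3$. Conventions: $(a\otimes b)_{ij}=a_ib_j$, $(\nabla\cdot M)_i=\sum_j\partial_jM_{ij}$, $(\nabla v)_{ij}=\partial_jv_i$. For $E$ a compact space, $C(E,\mathbb{R}^m)'$ is the dual of $C(E,\mathbb{R}^m)$, i.e. the space of $\mathbb{R}^m$-valued Borel measures on $E$; a subscript $w^*$ means it carries the weak-$*$ topology. $\mathcal L$ is Lebesgue measure on $\mathbb{T}^3$. Functions are identified with the measures of which they are the Lebesgue densities. The Darcy MHD system (DMHD), with $D=hd$, $P=hv$, is $$\partial_t h+\nabla\cdot(hv)=0,\quad \partial_tB+\nabla\times(B\times v+d)=0,\quad \nabla\cdot B=0,$$ $$D=hd=\nabla\times\Big(\frac Bh\Big),\quad P=hv=\nabla\cdot\Big(\frac{B\otimes B}{h}\Big)+\nabla(h^{-1}).$$ For $\rho\in C(\mathbb{T}^3,\mathbb{R})'$, $U\in C(\mathbb{T}^3,\mathbb{R}^4)'$, $$\Lambda(\rho,U)=\sup\Big\{\int_{\mathbb{T}^3}a\rho+A\cdot U:\ (a,A)\in C(\mathbb{T}^3,\mathbb{R}\times\mathbb{R}^4),\ a+\tfrac12|A|^2\le0\Big\}\in[0,+\infty].$$ For $\rho\in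 C([0,T]\times\mathbb{T}^3,\mathbb{R})'$, $W\in C([0,T]\times\mathbb{T}^3,\mathbb{R}^{10})'$, $Q\in C([0,T]\times\mathbb{T}^3,\mathbb{R}^{10\times10})$ everywhere (symmetric) positive definite, $0\le s<t\le T$, $$\widetilde\Lambda(\rho,W,Q;s,t)=\sup\Big\{\int_s^t\!\!\int_{\mathbb{T}^3}a\rho+A\cdot W:\ (a,A)\in C([s,t]\times\mathbb{T}^3,\mathbb{R}\times\mathbb{R}^{10}),\ a+\tfrac12|\sqrt{Q^{-1}}A|^2\le0\Big\}\in[0,+\infty].$$ For test functions $b^*,d^*,v^*\in C^1([0,T]\times\mathbb{T}^3,\mathbb{R}^3)$, $0<h^*\in C^1([0,T]\times\mathbb{T}^3,\mathbb{R})$ and $w^*=({h^*}^{-1},b^*,d^*,v^* )$, set (blocks of sizes $1,3,3,3$) $$Q(w^* )=\begin{pmatrix} -2\nabla\cdot v^* & (\nabla\times d^* )^{\mathrm T} & -(\nabla\times b^* )^{\mathrm T} & 0\\ \nabla\times d^* & -\nabla v^*-(\nabla v^* )^{\mathrm T} & 0 & \nabla b^*-(\nabla b^* )^{\mathrm T}\\ -\nabla\times b^* & 0 & 2I_3 & 0\\ 0 & (\nabla b^* )^{\mathrm T}-\nabla b^* & 0 & 2I_3\end{pmatrix},$$ $Q_r(w^* )=Q(w^* )+r\,\mathrm{diag}(1,1,1,1,0,0,0,0,0,0)$, and $\mathrm L(w^* )=(\mathrm L_h,\mathrm L_B,\mathrm L_D,\mathrm L_P)$ with $\mathrm L_h=\partial_t({h^*}^{-1})-{h^*}^{-1}\nabla\cdot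 v^*+v^*\cdot\nabla({h^*}^{-1})$, $\mathrm L_B=\partial_tb^*+(v^*\cdot\nabla)b^*-(b^*\cdot\nabla)v^*+{h^*}^{-1}\nabla\times d^*$, $\mathrm L_D=d^*-{h^*}^{-1}\nabla\times b^*$, $\mathrm L_P=v^*-(b^*\cdot\nabla)b^*-{h^*}^{-1}\nabla({h^*}^{-1})$. Definition. $(h,B,D,P)$ with $h\in C([0,T],C(\mathbb{T}^3,\mathbb{R})'_{w^*})$, $B\in C([0,T],C(\mathbb{T}^3,\mathbb{R}^3)'_{w^*})$, $D,P\in C([0,T]\times\mathbb{T}^3,\mathbb{R}^3)'$ is a dissipative solution of (DMHD) with initial data $h_0\in C(\mathbb{T}^3,\mathbb{R})'$, $B_0\in C(\mathbb{T}^3,\mathbb{R}^3)'$ if and only if: (i) $h(0)=h_0$, $B(0)=B_0$, $\Lambda(h_0,U_0)<\infty$, where $U_0=(\mathcal L,B_0)$; (ii) $(h,B)$ is bounded in $C^{0,\frac12}([0,T],C(\mathbb{T}^3,\mathbb{R}^4)'_{w^*})$ by some constant that depends only on $T$ and $(h_0,B_0)$. (Here the dual space with the weak-$*$ topology is treated as metrized by a metric consistent with that topology; for example, in the scalar case, one can take $\sum_{n\ge0}2^{-n}\frac{|\langle\rho-\rho',f_n\rangle|}{1+|\langle\rho-\rho',f_n\rangle|}$ with $\{f_n\}_{n\ge0}$ a smooth dense subset of $C(\mathbb{T}^3,\mathbb{R})$.); (iii) for all $u\in C^1([0,T]\times\mathbb{T}^3,\mathbb{R})$ and $t\in[0,T]$: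 $\int_0^t\int_{\mathbb{T}^3}\partial_tu\,h+\nabla u\cdot P=\int_{\mathbb{T}^3}u(t)h(t)-\int_{\mathbb{T}^3}u(0)h(0)$ and $\int_{\mathbb{T}^3}\nabla u(t)\cdot B(t)=0$; (iv) for all $t\in[0,T]$, all $v^*,b^*,d^*\in C^1([0,T]\times\mathbb{T}^3,\mathbb{R}^3)$, $0<h^*\in C^1([0,T]\times\mathbb{T}^3,\mathbb{R})$ and all real $r\ge r_0$, where $r_0$ is a constant chosen such that $Q_{r_0}(w^* )\ge I_{10}$ for all $(t,x)\in[0,T]\times\mathbb{T}^3$, $$e^{-rt}\Lambda(h(t),\widetilde U(t))+\widetilde\Lambda(h,\widetilde W,e^{-rs}Q_r(w^* );0,t)+\int_0^t\!\!\int_{\mathbb{T}^3}e^{-rs}\,\widetilde W\cdot\mathrm L(w^* )\le\Lambda(h(0),\widetilde U(0)),$$ where $\widetilde U=(\mathcal L-{h^*}^{-1}h,\,B-hb^* )$, $\widetilde W=(\widetilde U,\,D-hd^*,\,P-hv^* )$. ($h$ and $\widetilde U$ are viewed as space-time measures where needed; in $e^{-rs}Q_r$ the variable $s$ is time.) *)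

theory Defs
  imports "HOL-Analysis.Analysis"
begin

section \<open>Continuous functions and their duals\<close>

text \<open>
  Functions on the torus are functions on real^3 that have period 1 in every coordinate.
  A point of the space-time slab \<open>I \<times> T^3\<close> is a pair \<open>(t, x)\<close>; space-time functions are
  total, but only their values at times in \<open>I\<close> matter.
\<close>

definition C_torus :: "(real^3 \<Rightarrow> 'b::real_normed_vector) set" where
  "C_torus = {f. continuous_on UNIV f \<and> (\<forall>x i. f (x + axis i 1) = f x)}"

definition C_slab :: "real set \<Rightarrow> (real \<times> (real^3) \<Rightarrow> 'b::real_normed_vector) set" where
  "C_slab I = {f. continuous_on (I \<times> UNIV) f \<and>
                  (\<forall>t\<in>I. \<forall>x i. f (t, x + axis i 1) = f (t, x))}"

text \<open>
  An element of the dual of \<open>F\<close> (functions on \<open>S\<close> with the supremum norm), i.e. a vector valued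
  Borel measure, is represented by its action on test functions. Values outside \<open>F\<close> are junk,
  so two representatives denote the same measure iff they agree on \<open>F\<close>.
\<close>

type_synonym ('p, 'b) functional = "('p \<Rightarrow> 'b) \<Rightarrow> real"

definition in_dual :: "'p set \<Rightarrow> ('p \<Rightarrow> 'b::real_normed_vector) set \<Rightarrow> ('p, 'b) functional \<Rightarrow> bool" where
  "in_dual S F \<mu> \<longleftrightarrow>
     (\<forall>f\<in>F. \<forall>g\<in>F. \<mu> (\<lambda>p. f p + g p) = \<mu> f + \<mu> g) \<and>
     (\<forall>c. \<forall>f\<in>F. \<mu> (\<lambda>p. c *\<^sub>R f p) = c * \<mu> f) \<and>
     (\<exists>C. \<forall>f\<in>F. \<forall>M. (\<forall>p\<in>S. norm (f p) \<le> M) \<longrightarrow> \<bar>\<mu> f\<bar> \<le> C * M)"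

abbreviation torus_measure :: "(real^3, 'b::real_normed_vector) functional \<Rightarrow> bool" where
  "torus_measure \<equiv> in_dual UNIV C_torus"

abbreviation slab_measure :: "real \<Rightarrow> (real \<times> (real^3), 'b::real_normed_vector) functional \<Rightarrow> bool" where
  "slab_measure T \<equiv> in_dual ({0..T} \<times> UNIV) (C_slab {0..T})"

definition same_measure :: "('p \<Rightarrow> 'b) set \<Rightarrow> ('p, 'b) functional \<Rightarrow> ('p, 'b) functional \<Rightarrow> bool" where
  "same_measure F \<mu> \<nu> \<longleftrightarrow> (\<forall>f\<in>F. \<mu> f = \<nu> f)"

definition weak_star_continuous ::
  "real \<Rightarrow> (real \<Rightarrow> (real^3, 'b::real_normed_vector) functional) \<Rightarrow> bool" where
  "weak_star_continuous T \<mu> \<longleftrightarrow>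
     (\<forall>t\<in>{0..T}. torus_measure (\<mu> t)) \<and> (\<forall>f\<in>C_torus. continuous_on {0..T} (\<lambda>t. \<mu> t f))"

definition lebesgue_torus :: "(real^3, real) functional" where
  "lebesgue_torus f = integral (cbox 0 1) f"

text \<open>The product of a scalar measure and a (scalar or vector valued) function.\<close>

definition times_fun :: "('p, real) functional \<Rightarrow> ('p \<Rightarrow> 'b::real_inner) \<Rightarrow> ('p, 'b) functional" where
  "times_fun \<mu> g = (\<lambda>f. \<mu> (\<lambda>p. g p \<bullet> f p))"

definition minus_fn :: "('p, 'b) functional \<Rightarrow> ('p, 'b) functional \<Rightarrow> ('p, 'b) functional" where
  "minus_fn \<mu> \<nu> = (\<lambda>f. \<mu> f - \<nu> f)"

text \<open>The space-time measure \<open>dt \<mu>(t)\<close> on \<open>[0,T] \<times> T^3\<close>.\<close>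

definition time_measure ::
  "real \<Rightarrow> (real \<Rightarrow> (real^3, 'b) functional) \<Rightarrow> (real \<times> (real^3), 'b) functional" where
  "time_measure T \<mu> = (\<lambda>f. integral {0..T} (\<lambda>t. \<mu> t (\<lambda>x. f (t, x))))"

definition torus_density :: "(real^3 \<Rightarrow> 'b::real_inner) \<Rightarrow> (real^3, 'b) functional" where
  "torus_density g = times_fun lebesgue_torus g"

definition slab_density :: "real \<Rightarrow> (real \<times> (real^3) \<Rightarrow> 'b::real_inner) \<Rightarrow> (real \<times> (real^3), 'b) functional" where
  "slab_density T g = times_fun (time_measure T (\<lambda>t. lebesgue_torus)) g"

text \<open>
  The integral over the closed slab \<open>[s,t] \<times> T^3\<close> of a function given there: the test function is
  extended to all times by freezing it outside \<open>[s,t]\<close>, and multiplied by continuous cut-offs that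
  decrease pointwise to the indicator function of \<open>[s,t]\<close>. By dominated convergence the limit is
  the integral over \<open>[s,t] \<times> T^3\<close> with respect to the measure \<open>W\<close>.
\<close>

definition slab_integral ::
  "real \<Rightarrow> real \<Rightarrow> (real \<times> (real^3), 'b::real_normed_vector) functional \<Rightarrow> (real \<times> (real^3) \<Rightarrow> 'b) \<Rightarrow> real" where
  "slab_integral s t W f =
     lim (\<lambda>n. W (\<lambda>(\<tau>, x). max 0 (1 - real n * \<bar>\<tau> - max s (min t \<tau>)\<bar>) *\<^sub>R f (max s (min t \<tau>), x)))"


section \<open>Block vectors of sizes 1+3 and 1+3+3+3\<close>

type_synonym i4 = "1 + 3"
type_synonym i10 = "1 + 3 + 3 + 3"

definition meas4 ::
  "('p, real) functional \<Rightarrow> ('p, real^3) functional \<Rightarrow> ('p, real^i4) functional" where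
  "meas4 \<mu> \<nu> = (\<lambda>A. \<mu> (\<lambda>p. A p $ Inl 1) + \<nu> (\<lambda>p. \<chi> j. A p $ Inr j))"

definition meas10 ::
  "('p, real^i4) functional \<Rightarrow> ('p, real^3) functional \<Rightarrow> ('p, real^3) functional \<Rightarrow>
   ('p, real^i10) functional" where
  "meas10 \<mu> \<nu> \<pi> = (\<lambda>A.
     \<mu> (\<lambda>p. \<chi> i. case i of Inl u \<Rightarrow> A p $ Inl u | Inr j \<Rightarrow> A p $ Inr (Inl j)) +
     \<nu> (\<lambda>p. \<chi> j. A p $ Inr (Inr (Inl j))) +
     \<pi> (\<lambda>p. \<chi> j. A p $ Inr (Inr (Inr j))))"

definition vec10 :: "real \<Rightarrow> real^3 \<Rightarrow> real^3 \<Rightarrow> real^3 \<Rightarrow> real^i10" where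
  "vec10 a b c d = (\<chi> i. case i of Inl _ \<Rightarrow> a | Inr (Inl j) \<Rightarrow> b $ j
     | Inr (Inr (Inl j)) \<Rightarrow> c $ j | Inr (Inr (Inr j)) \<Rightarrow> d $ j)"


section \<open>Differential operators\<close>

definition pderiv_x :: "3 \<Rightarrow> (real^3 \<Rightarrow> 'b::real_normed_vector) \<Rightarrow> real^3 \<Rightarrow> 'b" where
  "pderiv_x i f x = vector_derivative (\<lambda>s. f (x + s *\<^sub>R axis i 1)) (at 0)"

definition dx :: "3 \<Rightarrow> (real \<times> (real^3) \<Rightarrow> 'b::real_normed_vector) \<Rightarrow> real \<times> (real^3) \<Rightarrow> 'b" where
  "dx i f p = pderiv_x i (\<lambda>y. f (fst p, y)) (snd p)"

text \<open>One-sided at the times 0 and T.\<close>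

definition dt :: "real \<Rightarrow> (real \<times> (real^3) \<Rightarrow> 'b::real_normed_vector) \<Rightarrow> real \<times> (real^3) \<Rightarrow> 'b" where
  "dt T f p = vector_derivative (\<lambda>s. f (s, snd p)) (at (fst p) within {0..T})"

definition grad :: "(real \<times> (real^3) \<Rightarrow> real) \<Rightarrow> real \<times> (real^3) \<Rightarrow> real^3" where
  "grad u p = (\<chi> i. dx i u p)"

definition jac :: "(real \<times> (real^3) \<Rightarrow> real^3) \<Rightarrow> real \<times> (real^3) \<Rightarrow> real^3^3" where
  "jac v p = (\<chi> i j. dx j v p $ i)"

definition div_vec :: "(real \<times> (real^3) \<Rightarrow> real^3) \<Rightarrow> real \<times> (real^3) \<Rightarrow> real" where
  "div_vec v p = (\<Sum>i\<in>UNIV. dx i v p $ i)"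

definition div_mat :: "(real \<times> (real^3) \<Rightarrow> real^3^3) \<Rightarrow> real \<times> (real^3) \<Rightarrow> real^3" where
  "div_mat M p = (\<chi> i. \<Sum>j\<in>UNIV. dx j M p $ i $ j)"

definition curl :: "(real \<times> (real^3) \<Rightarrow> real^3) \<Rightarrow> real \<times> (real^3) \<Rightarrow> real^3" where
  "curl v p = vector [dx 2 v p $ 3 - dx 3 v p $ 2,
                      dx 3 v p $ 1 - dx 1 v p $ 3,
                      dx 1 v p $ 2 - dx 2 v p $ 1]"

definition dir_deriv :: "real^3 \<Rightarrow> (real \<times> (real^3) \<Rightarrow> real^3) \<Rightarrow> real \<times> (real^3) \<Rightarrow> real^3" where
  "dir_deriv a w p = (\<Sum>j\<in>UNIV. (a $ j) *\<^sub>R dx j w p)"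

definition outer :: "real^3 \<Rightarrow> real^3 \<Rightarrow> real^3^3" where
  "outer a b = (\<chi> i j. a $ i * b $ j)"

definition C1_slab :: "real \<Rightarrow> (real \<times> (real^3) \<Rightarrow> 'b::real_normed_vector) set" where
  "C1_slab T = {f \<in> C_slab {0..T}.
     \<exists>f' :: real \<times> (real^3) \<Rightarrow> (real \<times> (real^3)) \<Rightarrow>\<^sub>L 'b.
       continuous_on ({0..T} \<times> UNIV) f' \<and>
       (\<forall>p\<in>{0..T} \<times> UNIV. (f has_derivative blinfun_apply (f' p)) (at p within {0..T} \<times> UNIV))}"

primrec Ck_torus :: "nat \<Rightarrow> (real^3 \<Rightarrow> 'b::real_normed_vector) \<Rightarrow> bool" where
  "Ck_torus 0 f \<longleftrightarrow> f \<in> C_torus"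
| "Ck_torus (Suc k) f \<longleftrightarrow>
     f \<in> C_torus \<and> f differentiable_on UNIV \<and> (\<forall>i. Ck_torus k (pderiv_x i f))"


section \<open>The system\<close>

definition classical_DMHD ::
  "real \<Rightarrow> (real \<times> (real^3) \<Rightarrow> real) \<Rightarrow> (real \<times> (real^3) \<Rightarrow> real^3) \<Rightarrow>
   (real \<times> (real^3) \<Rightarrow> real^3) \<Rightarrow> (real \<times> (real^3) \<Rightarrow> real^3) \<Rightarrow> bool" where
  "classical_DMHD T h B D P \<longleftrightarrow>
     h \<in> C1_slab T \<and> B \<in> C1_slab T \<and> D \<in> C1_slab T \<and> P \<in> C1_slab T \<and>
     (\<forall>p\<in>{0..T} \<times> UNIV. h p > 0) \<and>
     (let d = (\<lambda>q. D q /\<^sub>R h q); v = (\<lambda>q. P q /\<^sub>R h q) in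
      \<forall>p\<in>{0..T} \<times> UNIV.
        dt T h p + div_vec (\<lambda>q. h q *\<^sub>R v q) p = 0 \<and>
        dt T B p + curl (\<lambda>q. cross3 (B q) (v q) + d q) p = 0 \<and>
        div_vec B p = 0 \<and>
        D p = curl (\<lambda>q. B q /\<^sub>R h q) p \<and>
        P p = div_mat (\<lambda>q. outer (B q) (B q) /\<^sub>R h q) p + grad (\<lambda>q. inverse (h q)) p)"


section \<open>The functionals\<close>

definition Lambda :: "(real^3, real) functional \<Rightarrow> (real^3, real^i4) functional \<Rightarrow> ereal" where
  "Lambda \<rho> U =
     (SUP (a, A) \<in> {(a, A). a \<in> C_torus \<and> A \<in> C_torus \<and> (\<forall>x. a x + (norm (A x))\<^sup>2 / 2 \<le> 0)}.
        ereal (\<rho> a + U A))"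

text \<open>For positive semidefinite \<open>M\<close> such a root exists and is unique.\<close>

definition mat_sqrt :: "real^'n^'n \<Rightarrow> real^'n^'n" where
  "mat_sqrt M = (SOME R. transpose R = R \<and> (\<forall>x. 0 \<le> x \<bullet> (R *v x)) \<and> R ** R = M)"

definition loewner_le :: "real^'n^'n \<Rightarrow> real^'n^'n \<Rightarrow> bool" where
  "loewner_le M N \<longleftrightarrow> (\<forall>x. x \<bullet> (M *v x) \<le> x \<bullet> (N *v x))"

definition Lambda_tilde ::
  "(real \<times> (real^3), real) functional \<Rightarrow> (real \<times> (real^3), real^i10) functional \<Rightarrow>
   (real \<times> (real^3) \<Rightarrow> real^i10^i10) \<Rightarrow> real \<Rightarrow> real \<Rightarrow> ereal" where
  "Lambda_tilde \<rho> W Q s t =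
     (SUP (a, A) \<in> {(a, A). a \<in> C_slab {s..t} \<and> A \<in> C_slab {s..t} \<and>
          (\<forall>p\<in>{s..t} \<times> UNIV. a p + (norm (mat_sqrt (matrix_inv (Q p)) *v A p))\<^sup>2 / 2 \<le> 0)}.
        ereal (slab_integral s t \<rho> a + slab_integral s t W A))"

text \<open>The matrix does not depend on the first component of the test field.\<close>

definition Q_mat ::
  "(real \<times> (real^3) \<Rightarrow> real^3) \<Rightarrow> (real \<times> (real^3) \<Rightarrow> real^3) \<Rightarrow> (real \<times> (real^3) \<Rightarrow> real^3) \<Rightarrow>
   real \<times> (real^3) \<Rightarrow> real^i10^i10" where
  "Q_mat b d v p = (\<chi> i j.
     (case i of
        Inl _ \<Rightarrow> (case j of
            Inl _ \<Rightarrow> - 2 * div_vec v p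
          | Inr (Inl l) \<Rightarrow> curl d p $ l
          | Inr (Inr (Inl l)) \<Rightarrow> - (curl b p $ l)
          | Inr (Inr (Inr l)) \<Rightarrow> 0)
      | Inr (Inl k) \<Rightarrow> (case j of
            Inl _ \<Rightarrow> curl d p $ k
          | Inr (Inl l) \<Rightarrow> (- jac v p - transpose (jac v p)) $ k $ l
          | Inr (Inr (Inl l)) \<Rightarrow> 0
          | Inr (Inr (Inr l)) \<Rightarrow> (jac b p - transpose (jac b p)) $ k $ l)
      | Inr (Inr (Inl k)) \<Rightarrow> (case j of
            Inl _ \<Rightarrow> - (curl b p $ k)
          | Inr (Inl l) \<Rightarrow> 0
          | Inr (Inr (Inl l)) \<Rightarrow> 2 * mat 1 $ k $ l
          | Inr (Inr (Inr l)) \<Rightarrow> 0)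
      | Inr (Inr (Inr k)) \<Rightarrow> (case j of
            Inl _ \<Rightarrow> 0
          | Inr (Inl l) \<Rightarrow> (transpose (jac b p) - jac b p) $ k $ l
          | Inr (Inr (Inl l)) \<Rightarrow> 0
          | Inr (Inr (Inr l)) \<Rightarrow> 2 * mat 1 $ k $ l)))"

definition diag_1111000000 :: "real^i10^i10" where
  "diag_1111000000 = (\<chi> i j. if i = j then
     (case i of Inl _ \<Rightarrow> 1 | Inr (Inl _) \<Rightarrow> 1 | Inr (Inr _) \<Rightarrow> 0) else 0)"

definition Qr_mat ::
  "real \<Rightarrow> (real \<times> (real^3) \<Rightarrow> real^3) \<Rightarrow> (real \<times> (real^3) \<Rightarrow> real^3) \<Rightarrow> (real \<times> (real^3) \<Rightarrow> real^3) \<Rightarrow>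
   real \<times> (real^3) \<Rightarrow> real^i10^i10" where
  "Qr_mat r b d v p = Q_mat b d v p + r *\<^sub>R diag_1111000000"

definition L_op ::
  "real \<Rightarrow> (real \<times> (real^3) \<Rightarrow> real) \<Rightarrow> (real \<times> (real^3) \<Rightarrow> real^3) \<Rightarrow> (real \<times> (real^3) \<Rightarrow> real^3) \<Rightarrow>
   (real \<times> (real^3) \<Rightarrow> real^3) \<Rightarrow> real \<times> (real^3) \<Rightarrow> real^i10" where
  "L_op T h b d v p = (let \<tau> = (\<lambda>q. inverse (h q)) in vec10
     (dt T \<tau> p - \<tau> p * div_vec v p + v p \<bullet> grad \<tau> p)
     (dt T b p + dir_deriv (v p) b p - dir_deriv (b p) v p + \<tau> p *\<^sub>R curl d p)
     (d p - \<tau> p *\<^sub>R curl b p)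
     (v p - dir_deriv (b p) b p - \<tau> p *\<^sub>R grad \<tau> p))"


section \<open>Dissipative solutions\<close>

text \<open>
  A weak-star metric on measures is built from a dense sequence of smooth test functions. The
  enumeration must be such that the norms of the test functions do not outgrow the weights
  \<open>2^-n\<close> (always achievable by delaying and repeating members of a given dense set): otherwise
  the Hoelder condition for this metric can fail even for smooth curves of smooth densities.
\<close>

definition test_family :: "(nat \<Rightarrow> real^3 \<Rightarrow> 'b::real_normed_vector) \<Rightarrow> bool" where
  "test_family \<phi> \<longleftrightarrow>
     (\<forall>n k. Ck_torus k (\<phi> n)) \<and>
     (\<forall>g\<in>C_torus. \<forall>\<epsilon>>0. \<exists>n. \<forall>x. norm (\<phi> n x - g x) < \<epsilon>) \<and>
     summable (\<lambda>n. (1/2)^n * (SUP x. norm (\<phi> n x)))"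

definition weak_star_dist ::
  "(nat \<Rightarrow> real^3 \<Rightarrow> 'b) \<Rightarrow> (real^3, 'b) functional \<Rightarrow> (real^3, 'b) functional \<Rightarrow> real" where
  "weak_star_dist \<phi> \<mu> \<nu> =
     (\<Sum>n. (1/2)^n * (\<bar>\<mu> (\<phi> n) - \<nu> (\<phi> n)\<bar> / (1 + \<bar>\<mu> (\<phi> n) - \<nu> (\<phi> n)\<bar>)))"

definition holder_half_bounded ::
  "(nat \<Rightarrow> real^3 \<Rightarrow> 'b) \<Rightarrow> real \<Rightarrow> real \<Rightarrow> (real \<Rightarrow> (real^3, 'b) functional) \<Rightarrow> bool" where
  "holder_half_bounded \<phi> C T \<mu> \<longleftrightarrow>
     (\<forall>t\<in>{0..T}. weak_star_dist \<phi> (\<mu> t) (\<lambda>_. 0) \<le> C) \<and>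
     (\<forall>s\<in>{0..T}. \<forall>t\<in>{0..T}. weak_star_dist \<phi> (\<mu> s) (\<mu> t) \<le> C * sqrt \<bar>s - t\<bar>)"

definition U_tilde ::
  "(real \<Rightarrow> (real^3, real) functional) \<Rightarrow> (real \<Rightarrow> (real^3, real^3) functional) \<Rightarrow>
   (real \<times> (real^3) \<Rightarrow> real) \<Rightarrow> (real \<times> (real^3) \<Rightarrow> real^3) \<Rightarrow> real \<Rightarrow> (real^3, real^i4) functional" where
  "U_tilde h B hs bs t = meas4
     (minus_fn lebesgue_torus (times_fun (h t) (\<lambda>x. inverse (hs (t, x)))))
     (minus_fn (B t) (times_fun (h t) (\<lambda>x. bs (t, x))))"

definition W_tilde ::
  "real \<Rightarrow> (real \<Rightarrow> (real^3, real) functional) \<Rightarrow> (real \<Rightarrow> (real^3, real^3) functional) \<Rightarrow>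
   (real \<times> (real^3), real^3) functional \<Rightarrow> (real \<times> (real^3), real^3) functional \<Rightarrow>
   (real \<times> (real^3) \<Rightarrow> real) \<Rightarrow> (real \<times> (real^3) \<Rightarrow> real^3) \<Rightarrow>
   (real \<times> (real^3) \<Rightarrow> real^3) \<Rightarrow> (real \<times> (real^3) \<Rightarrow> real^3) \<Rightarrow>
   (real \<times> (real^3), real^i10) functional" where
  "W_tilde T h B D P hs bs ds vs = meas10
     (time_measure T (U_tilde h B hs bs))
     (minus_fn D (times_fun (time_measure T h) ds))
     (minus_fn P (times_fun (time_measure T h) vs))"

text \<open>
  The bound in the Hoelder condition is \<open>K T h0 B0\<close>, where \<open>K\<close> is a function fixed beforehand:
  the bound may depend on \<open>T\<close> and the initial data only, not on the solution.
\<close>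

definition dissipative_solution ::
  "(nat \<Rightarrow> real^3 \<Rightarrow> real^i4) \<Rightarrow>
   (real \<Rightarrow> (real^3, real) functional \<Rightarrow> (real^3, real^3) functional \<Rightarrow> real) \<Rightarrow> real \<Rightarrow>
   (real^3, real) functional \<Rightarrow> (real^3, real^3) functional \<Rightarrow>
   (real \<Rightarrow> (real^3, real) functional) \<Rightarrow> (real \<Rightarrow> (real^3, real^3) functional) \<Rightarrow>
   (real \<times> (real^3), real^3) functional \<Rightarrow> (real \<times> (real^3), real^3) functional \<Rightarrow> bool" where
  "dissipative_solution \<phi> K T h0 B0 h B D P \<longleftrightarrow>
     torus_measure h0 \<and> torus_measure B0 \<and>
     weak_star_continuous T h \<and> weak_star_continuous T B \<and>
     slab_measure T D \<and> slab_measure T P \<and>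
     same_measure C_torus (h 0) h0 \<and> same_measure C_torus (B 0) B0 \<and>
     Lambda h0 (meas4 lebesgue_torus B0) < \<infinity> \<and>
     holder_half_bounded \<phi> (K T h0 B0) T (\<lambda>t. meas4 (h t) (B t)) \<and>
     (\<forall>u\<in>C1_slab T. \<forall>t\<in>{0..T}.
        slab_integral 0 t (time_measure T h) (dt T u) + slab_integral 0 t P (grad u) =
          h t (\<lambda>x. u (t, x)) - h 0 (\<lambda>x. u (0, x)) \<and>
        B t (\<lambda>x. grad u (t, x)) = 0) \<and>
     (\<forall>t\<in>{0..T}. \<forall>vs\<in>C1_slab T. \<forall>bs\<in>C1_slab T. \<forall>ds\<in>C1_slab T. \<forall>hs\<in>C1_slab T.
        (\<forall>p\<in>{0..T} \<times> UNIV. hs p > 0) \<longrightarrow>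
        (\<forall>r0. (\<forall>p\<in>{0..T} \<times> UNIV. loewner_le (mat 1) (Qr_mat r0 bs ds vs p)) \<longrightarrow>
          (\<forall>r\<ge>r0.
             ereal (exp (- r * t)) * Lambda (h t) (U_tilde h B hs bs t) +
             Lambda_tilde (time_measure T h) (W_tilde T h B D P hs bs ds vs)
               (\<lambda>p. exp (- r * fst p) *\<^sub>R Qr_mat r bs ds vs p) 0 t +
             ereal (slab_integral 0 t (W_tilde T h B D P hs bs ds vs)
               (\<lambda>p. exp (- r * fst p) *\<^sub>R L_op T hs bs ds vs p))
             \<le> Lambda (h 0) (U_tilde h B hs bs 0))))"

end

theory Submission
  imports Defs
begin

text \<open>
  Write a state as \<open>(\<tau>, b, d, v) = (1/h, B/h, D/h, P/h)\<close>. In these variables the system (DMHD)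
  is the equation \<open>L(h, b, d, v) = 0\<close>, together with the conservation of mass and \<open>div B = 0\<close>
  (\<open>classical_solves_L_op\<close>). For a test state \<open>(\<tau>*, b*, d*, v*)\<close> let \<open>\<alpha>, \<beta>, \<delta>, \<pi>\<close> be the
  differences of the two states and \<open>w = (\<alpha>, \<beta>, \<delta>, \<pi>)\<close>. The measures in the dissipative
  inequality have the densities \<open>h (\<alpha>, \<beta>)\<close> and \<open>h w\<close>, and \<open>Lambda\<close> is the relative energy
  \<open>\<integral> h (\<alpha>\<^sup>2 + |\<beta>|\<^sup>2) / 2\<close>.

  A classical solution is dissipative because the relative energy density e satisfies, pointwise,
  \<open>e_t + h w \<bullet> L* + h (w \<bullet> Q* w) / 2 = div G\<close> for a flux G of class C1
  (\<open>relative_energy_identity\<close>): the matrix Q is the one that makes everything else a divergence.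
  The flux integrates to 0 over the torus, the weight \<open>exp (- r t)\<close> turns Q into \<open>Q_r\<close>, and
  Young's inequality bounds \<open>Lambda_tilde\<close> by the integral of the quadratic form, so the required
  inequality follows (\<open>classical_energy_inequality\<close>).

  For uniqueness the classical solution itself is used as the test state
  (\<open>dissipative_unique\<close>). Then L vanishes and so does the initial relative energy, whence
  \<open>Lambda \<le> 0\<close> at all times and \<open>Lambda_tilde \<le> 0\<close>. Both are suprema over A of a linear minus a
  quadratic functional; replacing A by \<open>\<epsilon> A\<close> with small \<open>\<epsilon>\<close> of either sign shows that the linear
  functionals are zero. These are \<open>(1 - h'/h, B' - h' b)\<close> and the corresponding expressions for
  D' and P', so the two solutions agree.

  The Hoelder bound has to be a function of T and the initial data. A classical solution is
  Lipschitz in time, so some bound exists for it (\<open>classical_holder\<close>); by uniqueness a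
  bound valid for one classical solution is valid for every other one with the same data, so it can be
  selected by choice.
\<close>

section \<open>Calculus of C1 functions on the space-time slab\<close>

abbreviation slab :: "real \<Rightarrow> (real \<times> (real^3)) set" where "slab T \<equiv> {0..T} \<times> UNIV"

text \<open>
  The total derivative of a C1 function at p, expressed by its partial derivatives.
\<close>
definition slab_diff :: "real \<Rightarrow> (real \<times> (real^3) \<Rightarrow> 'b::real_normed_vector) \<Rightarrow>
    real \<times> (real^3) \<Rightarrow> real \<times> (real^3) \<Rightarrow> 'b" where
  "slab_diff T f p v = fst v *\<^sub>R dt T f p + (\<Sum>i\<in>UNIV. (snd v $ i) *\<^sub>R dx i f p)"

lemma dx_eqI:
  assumes "(f has_derivative F) (at p within slab T)" "p \<in> slab T"
  shows "((\<lambda>s. f (fst p, snd p + s *\<^sub>R axis i 1)) has_vector_derivative F (0, axis i 1)) (at 0)"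
    and "dx i f p = F (0, axis i 1)"
proof -
  let ?g = "\<lambda>s::real. (fst p, snd p + s *\<^sub>R axis i 1)"
  have g: "(?g has_derivative (\<lambda>s. (0, s *\<^sub>R axis i 1))) (at 0 within UNIV)"
    by (auto intro!: derivative_eq_intros)
  have "(f has_derivative F) (at (?g 0) within range ?g)"
    using assms by (auto intro: has_derivative_subset)
  from has_derivative_in_compose[OF g this]
  have "((\<lambda>s. f (?g s)) has_derivative (\<lambda>s. F (0, s *\<^sub>R axis i 1))) (at 0)" by simp
  moreover have "F (0, s *\<^sub>R axis i 1) = s *\<^sub>R F (0, axis i 1)" for s
    using linear_cmul[OF has_derivative_linear[OF assms(1)], of s "(0, axis i 1)"] by simp
  ultimately show *: "((\<lambda>s. f (?g s)) has_vector_derivative F (0, axis i 1)) (at 0)"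
    by (simp add: has_vector_derivative_def)
  show "dx i f p = F (0, axis i 1)"
    unfolding dx_def pderiv_x_def using vector_derivative_at[OF *] by simp
qed

lemma dt_eqI:
  assumes "(f has_derivative F) (at p within slab T)" "p \<in> slab T" "0 < T"
  shows "((\<lambda>s. f (s, snd p)) has_vector_derivative F (1, 0)) (at (fst p) within {0..T})"
    and "dt T f p = F (1, 0)"
proof -
  let ?g = "\<lambda>s::real. (s, snd p)"
  have g: "(?g has_derivative (\<lambda>s. (s, 0))) (at (fst p) within {0..T})"
    by (auto intro!: derivative_eq_intros)
  have "(f has_derivative F) (at (?g (fst p)) within ?g ` {0..T})"
    using assms by (auto intro: has_derivative_subset)
  from has_derivative_in_compose[OF g this]
  have D: "((\<lambda>s. f (?g s)) has_derivative (\<lambda>s. F (s, 0))) (at (fst p) within {0..T})" by simp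
  have eq: "F (s, 0) = s *\<^sub>R F (1, 0)" for s
    using linear_cmul[OF has_derivative_linear[OF assms(1)], of s "(1, 0)"] by simp
  have "(\<lambda>s. F (s, 0)) = (\<lambda>s. s *\<^sub>R F (1, 0))"
    by (rule ext) (rule eq)
  from D[unfolded this] show *: "((\<lambda>s. f (?g s)) has_vector_derivative F (1, 0)) (at (fst p) within {0..T})"
    unfolding has_vector_derivative_def .
  show "dt T f p = F (1, 0)"
    unfolding dt_def using assms(2,3)
    by (intro vector_derivative_within[OF _ *]) (auto simp: trivial_limit_within islimpt_Icc mem_Times_iff)
qed

lemma slab_diff_eq:
  assumes "(f has_derivative F) (at p within slab T)" "p \<in> slab T" "0 < T"
  shows "slab_diff T f p = F"
proof
  fix v :: "real \<times> (real^3)"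
  have l: "linear F" using has_derivative_linear[OF assms(1)] .
  have "v = fst v *\<^sub>R (1, 0) + (\<Sum>i\<in>UNIV. (snd v $ i) *\<^sub>R (0, axis i 1))"
    by (auto simp: prod_eq_iff fst_sum snd_sum vec_eq_iff axis_def if_distrib cong: if_cong)
  then have "F v = F (fst v *\<^sub>R (1, 0) + (\<Sum>i\<in>UNIV. (snd v $ i) *\<^sub>R (0, axis i 1)))" by simp
  also have "\<dots> = fst v *\<^sub>R F (1, 0) + (\<Sum>i\<in>UNIV. (snd v $ i) *\<^sub>R F (0, axis i 1))"
    unfolding linear_add[OF l] linear_sum[OF l] linear_cmul[OF l] by simp
  finally show "slab_diff T f p v = F v"
    unfolding slab_diff_def dx_eqI(2)[OF assms(1,2)] dt_eqI(2)[OF assms] by simp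
qed

text \<open>
  Linear maps on a finite-dimensional space depend continuously on a parameter as soon as their
  values on each single vector do; so no operator norms have to be estimated.
\<close>
lemma C1_slabI:
  assumes "f \<in> C_slab {0..T}"
    and "\<And>p. p \<in> slab T \<Longrightarrow> (f has_derivative f' p) (at p within slab T)"
    and "\<And>v. continuous_on (slab T) (\<lambda>p. f' p v)"
  shows "f \<in> C1_slab T"
proof -
  let ?B = "\<lambda>p. Blinfun (f' p)"
  have B: "blinfun_apply (?B p) = f' p" if "p \<in> slab T" for p
    by (rule bounded_linear_Blinfun_apply[OF has_derivative_bounded_linear[OF assms(2)[OF that]]])
  have "continuous_on (slab T) ?B"
    by (intro continuous_on_blinfun_componentwise continuous_on_eq[OF assms(3)]) (simp only: B)
  moreover have "\<forall>p\<in>slab T. (f has_derivative blinfun_apply (?B p)) (at p within slab T)"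
  proof
    fix p assume p: "p \<in> slab T"
    show "(f has_derivative blinfun_apply (?B p)) (at p within slab T)"
      unfolding B[OF p] by (rule assms(2)[OF p])
  qed
  ultimately show ?thesis
    unfolding C1_slab_def mem_Collect_eq using assms(1) by (intro conjI exI[of _ ?B])
qed

lemma C1_C_slab: "f \<in> C1_slab T \<Longrightarrow> f \<in> C_slab {0..T}"
  by (simp add: C1_slab_def)

lemma C1_continuous: "f \<in> C1_slab T \<Longrightarrow> continuous_on (slab T) f"
  by (simp add: C1_slab_def C_slab_def)

lemma C1_has_derivative:
  assumes "f \<in> C1_slab T" "0 < T" "p \<in> slab T"
  shows "(f has_derivative slab_diff T f p) (at p within slab T)"
proof -
  obtain f' where d: "\<forall>p\<in>slab T. (f has_derivative blinfun_apply (f' p)) (at p within slab T)"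
    using assms(1) unfolding C1_slab_def mem_Collect_eq by (elim conjE exE) (rule that)
  note F = d[rule_format, OF assms(3)]
  then show ?thesis using slab_diff_eq[OF F assms(3,2)] by simp
qed

lemma C1_slab_diff_continuous:
  assumes "f \<in> C1_slab T" "0 < T"
  shows "continuous_on (slab T) (\<lambda>p. slab_diff T f p v)"
proof -
  obtain f' where c: "continuous_on (slab T) f'" and
    d: "\<forall>p\<in>slab T. (f has_derivative blinfun_apply (f' p)) (at p within slab T)"
    using assms(1) unfolding C1_slab_def mem_Collect_eq by (elim conjE exE) (rule that)
  note d' = d[rule_format]
  have "continuous_on (slab T) (\<lambda>p. blinfun_apply (f' p) v)"
    using c by (intro continuous_intros)
  then show ?thesis
    by (rule continuous_on_eq) (simp only: slab_diff_eq[OF d' _ assms(2)])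
qed

lemma slab_diff_axis: "slab_diff T f p (0, axis i 1) = dx i f p" "slab_diff T f p (1, 0) = dt T f p"
proof -
  have "(\<Sum>k\<in>UNIV. (axis i 1 $ k) *\<^sub>R dx k f p) = (\<Sum>k\<in>UNIV. if k = i then dx i f p else 0)"
    by (rule sum.cong) (simp_all add: axis_def)
  also have "\<dots> = dx i f p"
    by (subst sum.delta) simp_all
  finally show "slab_diff T f p (0, axis i 1) = dx i f p" by (simp only: slab_diff_def fst_conv snd_conv scaleR_zero_left add_0)
qed (simp add: slab_diff_def)

lemma C1_dx_continuous: "f \<in> C1_slab T \<Longrightarrow> 0 < T \<Longrightarrow> continuous_on (slab T) (dx i f)"
  using C1_slab_diff_continuous[of f T "(0, axis i 1)"] by (simp add: slab_diff_axis)

lemma C1_dt_continuous: "f \<in> C1_slab T \<Longrightarrow> 0 < T \<Longrightarrow> continuous_on (slab T) (dt T f)"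
  using C1_slab_diff_continuous[of f T "(1, 0)"] by (simp add: slab_diff_axis)

lemma dx_periodic:
  assumes "\<forall>x j. f (fst p, x + axis j 1) = f (fst p, x)"
  shows "dx i f (fst p, snd p + axis j 1) = dx i f p"
proof -
  have "f (fst p, snd p + axis j 1 + s *\<^sub>R axis i 1) = f (fst p, snd p + s *\<^sub>R axis i 1)" for s
    using assms[rule_format, of "snd p + s *\<^sub>R axis i 1" j] by (simp add: algebra_simps)
  then show ?thesis by (simp add: dx_def pderiv_x_def)
qed

lemma C1_dx_C_slab: 
  assumes "f \<in> C1_slab T" "0 < T" shows "dx i f \<in> C_slab {0..T}"
  using assms C1_dx_continuous[OF assms] dx_periodic[of f "(t, x)" for t x]
  by (auto simp: C_slab_def C1_slab_def)

text \<open>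
  The one-sided time derivative is unique, so it inherits the periodicity of f.
\<close>
lemma C1_dt_C_slab: 
  assumes "f \<in> C1_slab T" "0 < T" shows "dt T f \<in> C_slab {0..T}"
proof -
  have "dt T f (t, x + axis i 1) = dt T f (t, x)" if t: "t \<in> {0..T}" for t x i
  proof -
    have p: "(t, x) \<in> slab T" "(t, x + axis i 1) \<in> slab T" using t by auto
    have "((\<lambda>s. f (s, x + axis i 1)) has_vector_derivative dt T f (t, x + axis i 1)) (at t within {0..T})"
      using dt_eqI(1)[OF C1_has_derivative[OF assms p(2)] p(2) assms(2)] by (simp add: slab_diff_axis)
    then have "((\<lambda>s. f (s, x)) has_vector_derivative dt T f (t, x + axis i 1)) (at t within {0..T})"
      by (rule has_vector_derivative_transform[OF t, rotated]) 
        (use assms(1) in \<open>auto simp: C1_slab_def C_slab_def\<close>)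
    moreover have "at t within {0..T} \<noteq> bot"
      using assms(2) t by (simp add: trivial_limit_within islimpt_Icc)
    ultimately have "vector_derivative (\<lambda>s. f (s, x)) (at t within {0..T}) = dt T f (t, x + axis i 1)"
      by (intro vector_derivative_within)
    then show ?thesis by (simp add: dt_def)
  qed
  then show ?thesis using C1_dt_continuous[OF assms] by (auto simp: C_slab_def)
qed

text \<open>
  One product rule serves the scalar, inner, cross and outer products.
\<close>
lemma C1_bilinear:
  assumes "bounded_bilinear pr" "f \<in> C1_slab T" "g \<in> C1_slab T" "0 < T"
  shows "(\<lambda>q. pr (f q) (g q)) \<in> C1_slab T"
    and "p \<in> slab T \<Longrightarrow> dx i (\<lambda>q. pr (f q) (g q)) p = pr (f p) (dx i g p) + pr (dx i f p) (g p)"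
    and "p \<in> slab T \<Longrightarrow> dt T (\<lambda>q. pr (f q) (g q)) p = pr (f p) (dt T g p) + pr (dt T f p) (g p)"
proof -
  interpret bounded_bilinear pr by fact
  have D: "((\<lambda>q. pr (f q) (g q)) has_derivative
      (\<lambda>v. pr (f p) (slab_diff T g p v) + pr (slab_diff T f p v) (g p))) (at p within slab T)"
    if "p \<in> slab T" for p
    using FDERIV[OF C1_has_derivative[OF assms(2,4) that] C1_has_derivative[OF assms(3,4) that]] .
  show "(\<lambda>q. pr (f q) (g q)) \<in> C1_slab T"
  proof (rule C1_slabI[OF _ D])
    show "(\<lambda>q. pr (f q) (g q)) \<in> C_slab {0..T}"
      using C1_C_slab[OF assms(2)] C1_C_slab[OF assms(3)] by (auto simp: C_slab_def intro!: continuous_on)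
    show "continuous_on (slab T) (\<lambda>p. pr (f p) (slab_diff T g p v) + pr (slab_diff T f p v) (g p))" for v
      by (intro continuous_on_add continuous_on C1_continuous C1_slab_diff_continuous assms)
  qed
  show "p \<in> slab T \<Longrightarrow> dx i (\<lambda>q. pr (f q) (g q)) p = pr (f p) (dx i g p) + pr (dx i f p) (g p)"
    by (simp add: dx_eqI(2)[OF D] slab_diff_axis)
  show "p \<in> slab T \<Longrightarrow> dt T (\<lambda>q. pr (f q) (g q)) p = pr (f p) (dt T g p) + pr (dt T f p) (g p)"
    by (simp add: dt_eqI(2)[OF D _ assms(4)] slab_diff_axis)
qed

lemma C1_linear:
  assumes "bounded_linear L" "f \<in> C1_slab T" "0 < T"
  shows "(\<lambda>q. L (f q)) \<in> C1_slab T"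
    and "p \<in> slab T \<Longrightarrow> dx i (\<lambda>q. L (f q)) p = L (dx i f p)"
    and "p \<in> slab T \<Longrightarrow> dt T (\<lambda>q. L (f q)) p = L (dt T f p)"
proof -
  have D: "((\<lambda>q. L (f q)) has_derivative (\<lambda>v. L (slab_diff T f p v))) (at p within slab T)"
    if "p \<in> slab T" for p
    using bounded_linear.has_derivative[OF assms(1) C1_has_derivative[OF assms(2,3) that]] .
  show "(\<lambda>q. L (f q)) \<in> C1_slab T"
  proof (rule C1_slabI[OF _ D])
    show "(\<lambda>q. L (f q)) \<in> C_slab {0..T}"
      using C1_C_slab[OF assms(2)] by (auto simp: C_slab_def intro!: bounded_linear.continuous_on[OF assms(1)])
    show "continuous_on (slab T) (\<lambda>p. L (slab_diff T f p v))" for v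
      by (intro bounded_linear.continuous_on[OF assms(1)] C1_slab_diff_continuous assms)
  qed
  show "p \<in> slab T \<Longrightarrow> dx i (\<lambda>q. L (f q)) p = L (dx i f p)"
    by (simp add: dx_eqI(2)[OF D] slab_diff_axis)
  show "p \<in> slab T \<Longrightarrow> dt T (\<lambda>q. L (f q)) p = L (dt T f p)"
    by (simp add: dt_eqI(2)[OF D _ assms(3)] slab_diff_axis)
qed

lemma C1_add:
  assumes "f \<in> C1_slab T" "g \<in> C1_slab T" "0 < T"
  shows "(\<lambda>q. f q + g q) \<in> C1_slab T"
    and "p \<in> slab T \<Longrightarrow> dx i (\<lambda>q. f q + g q) p = dx i f p + dx i g p"
    and "p \<in> slab T \<Longrightarrow> dt T (\<lambda>q. f q + g q) p = dt T f p + dt T g p"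
proof -
  have D: "((\<lambda>q. f q + g q) has_derivative (\<lambda>v. slab_diff T f p v + slab_diff T g p v)) (at p within slab T)"
    if "p \<in> slab T" for p
    by (intro has_derivative_add C1_has_derivative assms that)
  show "(\<lambda>q. f q + g q) \<in> C1_slab T"
  proof (rule C1_slabI[OF _ D])
    show "(\<lambda>q. f q + g q) \<in> C_slab {0..T}"
      using C1_C_slab[OF assms(1)] C1_C_slab[OF assms(2)] by (auto simp: C_slab_def intro!: continuous_on_add)
    show "continuous_on (slab T) (\<lambda>p. slab_diff T f p v + slab_diff T g p v)" for v
      by (intro continuous_on_add C1_slab_diff_continuous assms)
  qed
  show "p \<in> slab T \<Longrightarrow> dx i (\<lambda>q. f q + g q) p = dx i f p + dx i g p"
    by (simp add: dx_eqI(2)[OF D] slab_diff_axis)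
  show "p \<in> slab T \<Longrightarrow> dt T (\<lambda>q. f q + g q) p = dt T f p + dt T g p"
    by (simp add: dt_eqI(2)[OF D _ assms(3)] slab_diff_axis)
qed

lemma C1_diff:
  assumes "f \<in> C1_slab T" "g \<in> C1_slab T" "0 < T"
  shows "(\<lambda>q. f q - g q) \<in> C1_slab T"
    and "p \<in> slab T \<Longrightarrow> dx i (\<lambda>q. f q - g q) p = dx i f p - dx i g p"
    and "p \<in> slab T \<Longrightarrow> dt T (\<lambda>q. f q - g q) p = dt T f p - dt T g p"
proof -
  note m = C1_linear[OF bounded_linear_minus[OF bounded_linear_ident] assms(2,3)]
  show "(\<lambda>q. f q - g q) \<in> C1_slab T"
    using C1_add(1)[OF assms(1) m(1) assms(3)] by simp
  show "p \<in> slab T \<Longrightarrow> dx i (\<lambda>q. f q - g q) p = dx i f p - dx i g p"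
    using C1_add(2)[OF assms(1) m(1) assms(3)] m(2) by simp
  show "p \<in> slab T \<Longrightarrow> dt T (\<lambda>q. f q - g q) p = dt T f p - dt T g p"
    using C1_add(3)[OF assms(1) m(1) assms(3)] m(3) by simp
qed

lemma C1_inverse:
  fixes f :: "real \<times> (real^3) \<Rightarrow> real"
  assumes "f \<in> C1_slab T" "\<And>p. p \<in> slab T \<Longrightarrow> f p \<noteq> 0" "0 < T"
  shows "(\<lambda>q. inverse (f q)) \<in> C1_slab T"
    and "p \<in> slab T \<Longrightarrow> dx i (\<lambda>q. inverse (f q)) p = - (dx i f p * (inverse (f p))\<^sup>2)"
    and "p \<in> slab T \<Longrightarrow> dt T (\<lambda>q. inverse (f q)) p = - (dt T f p * (inverse (f p))\<^sup>2)"
proof -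
  have D: "((\<lambda>q. inverse (f q)) has_derivative (\<lambda>v. - (slab_diff T f p v * (inverse (f p))\<^sup>2))) (at p within slab T)"
    if "p \<in> slab T" for p
    using Deriv.has_derivative_inverse[OF assms(2)[OF that] C1_has_derivative[OF assms(1,3) that]]
    by (simp add: power2_eq_square algebra_simps)
  show "(\<lambda>q. inverse (f q)) \<in> C1_slab T"
  proof (rule C1_slabI[OF _ D])
    show "(\<lambda>q. inverse (f q)) \<in> C_slab {0..T}"
      using C1_C_slab[OF assms(1)] assms(2) by (auto simp: C_slab_def intro!: continuous_on_inverse)
    show "continuous_on (slab T) (\<lambda>p. - (slab_diff T f p v * (inverse (f p))\<^sup>2))" for v
      using assms(2)
      by (intro continuous_intros C1_slab_diff_continuous C1_continuous assms) auto
  qed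
  show "p \<in> slab T \<Longrightarrow> dx i (\<lambda>q. inverse (f q)) p = - (dx i f p * (inverse (f p))\<^sup>2)"
    by (simp add: dx_eqI(2)[OF D] slab_diff_axis)
  show "p \<in> slab T \<Longrightarrow> dt T (\<lambda>q. inverse (f q)) p = - (dt T f p * (inverse (f p))\<^sup>2)"
    by (simp add: dt_eqI(2)[OF D _ assms(3)] slab_diff_axis)
qed

lemma C1_exp_time:
  assumes "0 < T"
  shows "(\<lambda>q. exp (c * fst q)) \<in> C1_slab T"
    and "p \<in> slab T \<Longrightarrow> dt T (\<lambda>q. exp (c * fst q)) p = c * exp (c * fst p)"
proof -
  have D: "((\<lambda>q::real \<times> (real^3). exp (c * fst q)) has_derivative (\<lambda>v. fst v * (c * exp (c * fst p)))) (at p within slab T)"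
    for p by (auto intro!: derivative_eq_intros)
  show "(\<lambda>q. exp (c * fst q)) \<in> C1_slab T"
    by (rule C1_slabI[OF _ D]) (auto simp: C_slab_def intro!: continuous_intros)
  show "p \<in> slab T \<Longrightarrow> dt T (\<lambda>q. exp (c * fst q)) p = c * exp (c * fst p)"
    by (simp add: dt_eqI(2)[OF D _ assms])
qed

section \<open>Periodic functions and integrals over the torus\<close>

abbreviation cell :: "(real^3) set" where "cell \<equiv> cbox 0 1"

abbreviation cell_integral :: "(real^3 \<Rightarrow> real) \<Rightarrow> real" where
  "cell_integral g \<equiv> integral cell g"

lemma zero_in_cell: "0 \<in> cell"
  by (simp add: mem_box_cart)

lemma periodic_int_shift:
  assumes "\<And>x i. g (x + axis i 1) = g (x::real^3)"
  shows "g (x + of_int n *\<^sub>R axis i 1) = g x"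
proof (induction n arbitrary: x rule: int_induct[where k = 0])
  case base
  show ?case by simp
next
  case (step1 n)
  have "g (x + of_int (n + 1) *\<^sub>R axis i 1) = g ((x + of_int n *\<^sub>R axis i 1) + axis i 1)"
    by (simp add: algebra_simps)
  then show ?case using assms step1 by simp
next
  case (step2 n)
  have "g (x + of_int (n - 1) *\<^sub>R axis i 1) = g (x + of_int (n - 1) *\<^sub>R axis i 1 + axis i 1)"
    using assms by simp
  also have "\<dots> = g (x + of_int n *\<^sub>R axis i 1)"
    by (simp add: algebra_simps)
  finally show ?case using step2 by simp
qed

text \<open>
  The representative is obtained by taking fractional parts of the coordinates.
\<close>
lemma periodic_value_in_cell:
  assumes "\<And>x i. g (x + axis i 1) = g (x::real^3)"
  obtains y where "y \<in> cell" "g y = g x"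
proof -
  let ?y = "\<chi> i. frac (x $ i)"
  have "g (z + (\<Sum>i\<in>A. of_int (n i) *\<^sub>R axis i 1)) = g z" if "finite A" for A z and n :: "3 \<Rightarrow> int"
    using that
  proof (induction A)
    case (insert a A)
    have "g (z + (\<Sum>i\<in>insert a A. of_int (n i) *\<^sub>R axis i 1)) =
        g ((z + (\<Sum>i\<in>A. of_int (n i) *\<^sub>R axis i 1)) + of_int (n a) *\<^sub>R axis a 1)"
      using insert by (simp add: algebra_simps)
    then show ?case using insert periodic_int_shift[of g, OF assms] by simp
  qed simp
  from this[of UNIV ?y "\<lambda>i. \<lfloor>x $ i\<rfloor>"]
  have "g (?y + (\<Sum>i\<in>UNIV. of_int \<lfloor>x $ i\<rfloor> *\<^sub>R axis i 1)) = g ?y" by simp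
  moreover have "?y + (\<Sum>i\<in>UNIV. of_int \<lfloor>x $ i\<rfloor> *\<^sub>R axis i 1) = x"
    by (simp add: vec_eq_iff axis_def frac_def if_distrib cong: if_cong)
  moreover have "?y \<in> cell"
    by (simp add: mem_box_cart frac_lt_1 less_imp_le)
  ultimately show ?thesis using that by metis
qed

lemma C_slab_bounded:
  assumes "f \<in> C_slab {a..b}"
  obtains M where "0 \<le> M" "\<And>p. p \<in> {a..b} \<times> UNIV \<Longrightarrow> norm (f p) \<le> M"
proof -
  have "compact (f ` ({a..b} \<times> cell))"
    using assms by (intro compact_continuous_image compact_Times)
      (auto simp: C_slab_def intro: continuous_on_subset)
  then obtain M where M: "\<And>p. p \<in> {a..b} \<times> cell \<Longrightarrow> norm (f p) \<le> M"
    using compact_imp_bounded[of "f ` ({a..b} \<times> cell)"] by (auto simp: bounded_iff)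
  show ?thesis
  proof (rule that[of "max 0 M"])
    fix p assume p: "p \<in> {a..b} \<times> (UNIV :: (real^3) set)"
    have per: "f (fst p, z + axis i 1) = f (fst p, z)" for z i
      using assms p by (simp add: C_slab_def mem_Times_iff)
    obtain y where y: "y \<in> cell" "f (fst p, y) = f (fst p, snd p)"
      by (rule periodic_value_in_cell[of "\<lambda>y. f (fst p, y)" "snd p", OF per])
    have "norm (f (fst p, y)) \<le> M" using M[of "(fst p, y)"] y(1) p by (simp add: mem_Times_iff)
    then show "norm (f p) \<le> max 0 M" using y(2) by simp
  qed simp
qed

lemma C_torus_bounded:
  assumes "f \<in> C_torus"
  obtains M where "0 \<le> M" "\<And>x. norm (f x) \<le> M"
proof -
  have "(\<lambda>p. f (snd p)) \<in> C_slab {0..0}"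
    using assms by (auto simp: C_slab_def C_torus_def intro!: continuous_on_compose2[of UNIV f] continuous_intros)
  then show ?thesis
  proof (rule C_slab_bounded)
    fix M :: real
    assume M: "0 \<le> M" "\<And>p. p \<in> {0..0::real} \<times> UNIV \<Longrightarrow> norm (f (snd p)) \<le> M"
    show thesis
    proof (rule that[OF M(1)])
      show "norm (f x) \<le> M" for x using M(2)[of "(0, x)"] by simp
    qed
  qed
qed

text \<open>
  The part of the translated cell that sticks out on one side is a translate, by a full period,
  of the part of the cell that it no longer covers.
\<close>
lemma cell_integral_shift:
  fixes g :: "real^3 \<Rightarrow> real"
  assumes c: "continuous_on UNIV g" and per: "\<And>x i. g (x + axis i 1) = g x" and s: "0 \<le> s" "s \<le> 1"
  shows "cell_integral (\<lambda>x. g (x + s *\<^sub>R axis i 1)) = cell_integral g"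
proof -
  let ?e = "axis i 1 :: real^3"
  have e: "?e \<in> Basis" by (simp add: axis_in_Basis_iff)
  have int: "g integrable_on cbox a b" for a b
    using c by (intro integrable_continuous continuous_on_subset[OF c]) auto
  have k: "x \<bullet> ?e = x $ i" for x by (simp add: inner_axis)
  let ?a = "s *\<^sub>R ?e"
  have b1: "cbox ?a (1 + ?a) \<inter> {x. x \<bullet> ?e \<le> 1} = cbox ?a 1"
    using s exhaust_3[of i] unfolding k by (auto simp: mem_box_cart axis_def forall_3)
  have b2: "cbox ?a (1 + ?a) \<inter> {x. x \<bullet> ?e \<ge> 1} = cbox ?e (1 + ?a)"
    using s exhaust_3[of i] unfolding k by (auto simp: mem_box_cart axis_def forall_3)
  have b3: "cell \<inter> {x. x \<bullet> ?e \<le> s} = cbox 0 (1 - ?e + ?a)"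
    using s exhaust_3[of i] unfolding k by (auto simp: mem_box_cart axis_def forall_3)
  have b4: "cell \<inter> {x. x \<bullet> ?e \<ge> s} = cbox ?a 1"
    using s exhaust_3[of i] unfolding k by (auto simp: mem_box_cart axis_def forall_3)
  have "cell_integral (\<lambda>x. g (x + ?a)) = integral (cbox (0 + ?a) (1 + ?a)) g"
    unfolding integral_shift_cbox_plus[symmetric] by (simp add: o_def add.commute)
  also have "\<dots> = integral (cbox ?a 1) g + integral (cbox ?e (1 + ?a)) g"
    using integral_split[OF int e, of ?a "1 + ?a" 1] by (simp add: b1 b2)
  also have "integral (cbox ?e (1 + ?a)) g = integral (cbox (0 + ?e) ((1 - ?e + ?a) + ?e)) g"
    by (simp add: algebra_simps)
  also have "\<dots> = integral (cbox 0 (1 - ?e + ?a)) (\<lambda>x. g (x + ?e))"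
    unfolding integral_shift_cbox_plus[symmetric] by (simp add: o_def add.commute)
  also have "\<dots> = integral (cbox 0 (1 - ?e + ?a)) g" by (simp add: per)
  also have "integral (cbox ?a 1) g + integral (cbox 0 (1 - ?e + ?a)) g = cell_integral g"
    using integral_split[OF int e, of 0 1 s] by (simp add: b3 b4)
  finally show ?thesis .
qed

text \<open>
  The derivative of the integral with respect to a translation of the integrand is the integral
  of the partial derivative; by periodicity the integral does not change under translations.
  This is the divergence theorem on the torus.
\<close>
lemma cell_integral_dx_zero:
  fixes f :: "real \<times> (real^3) \<Rightarrow> real"
  assumes f: "f \<in> C1_slab T" and T: "0 < T" and t: "t \<in> {0..T}"
  shows "cell_integral (\<lambda>x. dx i f (t, x)) = 0"
proof -
  let ?e = "axis i 1 :: real^3"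
  let ?H = "\<lambda>s. cell_integral (\<lambda>x. f (t, x + s *\<^sub>R ?e))"
  have ct: "continuous_on UNIV (\<lambda>x. f (t, x))"
    using t by (intro continuous_on_compose2[OF C1_continuous[OF f]] continuous_intros) auto
  have "(?H has_vector_derivative cell_integral (\<lambda>x. dx i f (t, x + 0 *\<^sub>R ?e))) (at 0 within {0..1})"
  proof (rule leibniz_rule_vector_derivative)
    fix s :: real and x :: "real^3"
    have p: "(t, x + s *\<^sub>R ?e) \<in> slab T" using t by simp
    have "((\<lambda>r. f (t, x + s *\<^sub>R ?e + r *\<^sub>R ?e)) has_vector_derivative dx i f (t, x + s *\<^sub>R ?e)) (at (s - s))"
      using dx_eqI(1)[OF C1_has_derivative[OF f T p] p] by (simp add: slab_diff_axis)
    moreover have "((\<lambda>r. r - s) has_vector_derivative 1) (at s)"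
      by (auto intro!: derivative_eq_intros)
    ultimately have "((\<lambda>r. f (t, x + s *\<^sub>R ?e + (r - s) *\<^sub>R ?e)) has_vector_derivative dx i f (t, x + s *\<^sub>R ?e)) (at s)"
      using vector_diff_chain_at[of "\<lambda>r. r - s" 1 s] by (fastforce simp: o_def)
    then show "((\<lambda>s. f (t, x + s *\<^sub>R ?e)) has_vector_derivative dx i f (t, x + s *\<^sub>R ?e)) (at s within {0..1})"
      by (simp add: algebra_simps has_vector_derivative_at_within)
  next
    fix s :: real
    show "(\<lambda>x. f (t, x + s *\<^sub>R ?e)) integrable_on cell"
      by (intro integrable_continuous continuous_on_compose2[OF ct] continuous_intros) auto
  next
    show "continuous_on ({0..1} \<times> cell) (\<lambda>(s, x). dx i f (t, x + s *\<^sub>R ?e))"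
      unfolding split_beta using t
      by (intro continuous_on_compose2[OF C1_dx_continuous[OF f T]] continuous_intros) auto
  qed auto
  moreover have "(?H has_vector_derivative 0) (at 0 within {0..1})"
  proof (rule has_vector_derivative_transform[where f = "\<lambda>s. cell_integral (\<lambda>x. f (t, x))"])
    fix s :: real assume "s \<in> {0..1}"
    then show "?H s = cell_integral (\<lambda>x. f (t, x))"
      using cell_integral_shift[OF ct, of s i] C1_C_slab[OF f] t by (auto simp: C_slab_def)
  qed auto
  moreover have "at (0::real) within {0..1} \<noteq> bot"
    by (simp add: trivial_limit_within)
  ultimately have "cell_integral (\<lambda>x. dx i f (t, x + 0 *\<^sub>R ?e)) = 0"
    by (intro vector_derivative_unique_within)
  then show ?thesis by simp
qed

lemma slice_continuous:
  assumes "continuous_on ({a..b} \<times> UNIV) f" "t \<in> {a..b}"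
  shows "continuous_on S (\<lambda>x. f (t, x))"
  using assms(2) by (intro continuous_on_compose2[OF assms(1)] continuous_intros) auto

lemma slice_integrable:
  fixes f :: "real \<times> (real^3) \<Rightarrow> real"
  assumes "continuous_on ({a..b} \<times> UNIV) f" "t \<in> {a..b}"
  shows "(\<lambda>x. f (t, x)) integrable_on cell"
  using assms by (intro integrable_continuous slice_continuous)

lemma cell_integral_continuous:
  fixes f :: "real \<times> (real^3) \<Rightarrow> real"
  assumes "continuous_on ({a..b} \<times> UNIV) f"
  shows "continuous_on {a..b} (\<lambda>t. cell_integral (\<lambda>x. f (t, x)))"
  by (intro integral_continuous_on_param) (auto intro: continuous_on_subset[OF assms])

lemma slab_integrable:
  fixes f :: "real \<times> (real^3) \<Rightarrow> real"
  assumes "continuous_on ({a..b} \<times> UNIV) f"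
  shows "(\<lambda>t. cell_integral (\<lambda>x. f (t, x))) integrable_on {a..b}"
  using cell_integral_continuous[OF assms] by (rule integrable_continuous_real)

lemma time_integral_dt:
  fixes f :: "real \<times> (real^3) \<Rightarrow> real"
  assumes f: "f \<in> C1_slab T" and T: "0 < T" and t: "t \<in> {0..T}"
  shows "integral {0..t} (\<lambda>s. cell_integral (\<lambda>x. dt T f (s, x))) =
    cell_integral (\<lambda>x. f (t, x)) - cell_integral (\<lambda>x. f (0, x))"
proof (rule integral_unique, rule fundamental_theorem_of_calculus)
  fix s assume "s \<in> {0..t}"
  then have s: "s \<in> {0..T}" using t by auto
  have "((\<lambda>s. cell_integral (\<lambda>x. f (s, x))) has_vector_derivative
      cell_integral (\<lambda>x. dt T f (s, x))) (at s within {0..T})"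
  proof (rule leibniz_rule_vector_derivative)
    fix r x assume "r \<in> {0..T}"
    then have p: "(r, x) \<in> slab T" by simp
    show "((\<lambda>s. f (s, x)) has_vector_derivative dt T f (r, x)) (at r within {0..T})"
      using dt_eqI(1)[OF C1_has_derivative[OF f T p] p T] by (simp add: slab_diff_axis)
  next
    show "continuous_on ({0..T} \<times> cell) (\<lambda>(s, x). dt T f (s, x))"
      using C1_dt_continuous[OF f T] by (auto intro: continuous_on_subset)
  qed (use s in \<open>auto intro: slice_integrable[OF C1_continuous[OF f]]\<close>)
  then show "((\<lambda>s. cell_integral (\<lambda>x. f (s, x))) has_vector_derivative
      cell_integral (\<lambda>x. dt T f (s, x))) (at s within {0..t})"
    using t by (auto intro: has_vector_derivative_within_subset)
qed (use t in auto)

text \<open>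
  The cut-offs equal 1 on \<open>[0, t]\<close> and vanish from \<open>t + 1/n\<close> on.
\<close>
lemma cutoff_integral_limit:
  fixes g :: "real \<Rightarrow> real"
  assumes g: "continuous_on {0..T} g" and t: "t \<in> {0..T}"
  shows "(\<lambda>n. integral {0..T} (\<lambda>\<tau>. max 0 (1 - real n * \<bar>\<tau> - max 0 (min t \<tau>)\<bar>) * g \<tau>))
    \<longlonglongrightarrow> integral {0..t} g"
proof -
  let ?X = "\<lambda>n \<tau>. max 0 (1 - real n * \<bar>\<tau> - max 0 (min t \<tau>)\<bar>)"
  have Xc: "continuous_on {0..T} (\<lambda>\<tau>. ?X n \<tau> * g \<tau>)" for n
    by (intro continuous_intros g)
  obtain M where M: "\<And>\<tau>. \<tau> \<in> {0..T} \<Longrightarrow> \<bar>g \<tau>\<bar> \<le> M"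
    using compact_imp_bounded[OF compact_continuous_image[OF g compact_Icc]]
    unfolding bounded_iff real_norm_def by blast
  have "(\<lambda>n. integral {0..T} (\<lambda>\<tau>. ?X n \<tau> * g \<tau>)) \<longlonglongrightarrow> integral {0..T} (\<lambda>\<tau>. if \<tau> \<in> {0..t} then g \<tau> else 0)"
  proof (rule dominated_convergence(2)[where h = "\<lambda>_. M"])
    show "(\<lambda>\<tau>. ?X n \<tau> * g \<tau>) integrable_on {0..T}" for n
      by (rule integrable_continuous_real[OF Xc])
    show "norm (?X n \<tau> * g \<tau>) \<le> M" if "\<tau> \<in> {0..T}" for n \<tau>
    proof -
      have "\<bar>?X n \<tau>\<bar> * \<bar>g \<tau>\<bar> \<le> 1 * \<bar>g \<tau>\<bar>" by (intro mult_right_mono) auto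
      then show ?thesis using M[OF that] by (simp add: abs_mult)
    qed
    fix \<tau> assume \<tau>: "\<tau> \<in> {0..T}"
    show "(\<lambda>n. ?X n \<tau> * g \<tau>) \<longlonglongrightarrow> (if \<tau> \<in> {0..t} then g \<tau> else 0)"
    proof (cases "\<tau> \<le> t")
      case True
      then show ?thesis using \<tau> by simp
    next
      case False
      obtain N :: nat where N: "1 / (\<tau> - t) < real N" using reals_Archimedean2 by blast
      have "?X n \<tau> = 0" if "n \<ge> N" for n
      proof -
        have "1 \<le> real N * (\<tau> - t)" using N False by (simp add: field_simps)
        also have "\<dots> \<le> real n * (\<tau> - t)" using that False by (intro mult_right_mono) auto
        finally show ?thesis using False t \<tau> by simp
      qed
      then have "eventually (\<lambda>n. ?X n \<tau> * g \<tau> = 0) sequentially"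
        by (auto simp: eventually_sequentially)
      then show ?thesis using False \<tau> by (auto intro: tendsto_eventually)
    qed
  qed auto
  also have "integral {0..T} (\<lambda>\<tau>. if \<tau> \<in> {0..t} then g \<tau> else 0) = integral {0..t} g"
    using t by (subst integral_restrict_Int) (simp add: Int_absorb2)
  finally show ?thesis .
qed

lemma slab_integral_density:
  fixes w f :: "real \<times> (real^3) \<Rightarrow> 'b::euclidean_space"
  assumes W: "\<And>F. continuous_on (slab T) F \<Longrightarrow>
      W F = integral {0..T} (\<lambda>\<tau>. cell_integral (\<lambda>x. w (\<tau>, x) \<bullet> F (\<tau>, x)))"
    and w: "continuous_on (slab T) w" and f: "continuous_on (slab t) f" and t: "t \<in> {0..T}"
  shows "slab_integral 0 t W f = integral {0..t} (\<lambda>\<tau>. cell_integral (\<lambda>x. w (\<tau>, x) \<bullet> f (\<tau>, x)))"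
proof -
  let ?c = "\<lambda>\<tau>. max 0 (min t \<tau>)"
  let ?X = "\<lambda>n \<tau>. max 0 (1 - real n * \<bar>\<tau> - ?c \<tau>\<bar>)"
  let ?g = "\<lambda>\<tau>. cell_integral (\<lambda>x. w (\<tau>, x) \<bullet> f (?c \<tau>, x))"
  have fc: "continuous_on (slab T) (\<lambda>p. f (?c (fst p), snd p))"
    using t by (intro continuous_on_compose2[OF f] continuous_intros) auto
  have gc: "continuous_on {0..T} ?g"
    using cell_integral_continuous[of 0 T "\<lambda>p. w p \<bullet> f (?c (fst p), snd p)"]
    by (simp add: continuous_on_inner[OF w fc])
  have eq: "W (\<lambda>(\<tau>, x). ?X n \<tau> *\<^sub>R f (?c \<tau>, x)) = integral {0..T} (\<lambda>\<tau>. ?X n \<tau> * ?g \<tau>)" for n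
  proof -
    have "continuous_on (slab T) (\<lambda>(\<tau>, x). ?X n \<tau> *\<^sub>R f (?c \<tau>, x))"
      unfolding split_beta by (intro continuous_intros fc)
    then show ?thesis by (subst W) (simp_all add: split_beta)
  qed
  have "slab_integral 0 t W f = integral {0..t} ?g"
    unfolding slab_integral_def eq by (rule limI[OF cutoff_integral_limit[OF gc t]])
  also have "\<dots> = integral {0..t} (\<lambda>\<tau>. cell_integral (\<lambda>x. w (\<tau>, x) \<bullet> f (\<tau>, x)))"
    by (intro integral_cong) auto
  finally show ?thesis .
qed

section \<open>Matrix square roots, block vectors and the matrix Q\<close>

text \<open>
  The eigenvector is a maximum point e of the Rayleigh quotient on the unit sphere of S. A
  displacement of e along the residual \<open>y = f e - l e\<close> would increase the quotient
  with rate \<open>2 |y|\<^sup>2\<close>, so y vanishes.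
\<close>
lemma self_adjoint_eigenvector:
  fixes f :: "'a::euclidean_space \<Rightarrow> 'a"
  assumes f: "linear f" and adj: "\<And>x y. f x \<bullet> y = x \<bullet> f y"
    and S: "subspace S" "f ` S \<subseteq> S" "S \<noteq> {0}"
  obtains e where "e \<in> S" "norm e = 1" "f e = (e \<bullet> f e) *\<^sub>R e"
proof -
  let ?K = "S \<inter> sphere 0 1"
  have K: "compact ?K"
    using closed_Int_compact[OF closed_subspace[OF S(1)] compact_sphere] by simp
  obtain z where z: "z \<in> S" "z \<noteq> 0" using S(1,3) subspace_0 by blast
  have "z /\<^sub>R norm z \<in> ?K" using z S(1) by (auto simp: subspace_scale)
  then have ne: "?K \<noteq> {}" by blast
  have "continuous_on ?K (\<lambda>x. x \<bullet> f x)"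
    using f by (intro continuous_intros linear_continuous_on) (simp add: linear_conv_bounded_linear)
  from continuous_attains_sup[OF K ne this] obtain e where
    e: "e \<in> S" "norm e = 1" and max: "\<And>x. x \<in> ?K \<Longrightarrow> x \<bullet> f x \<le> e \<bullet> f e" by auto
  define l where "l = e \<bullet> f e"
  have max': "x \<bullet> f x \<le> l * (norm x)\<^sup>2" if "x \<in> S" for x
  proof (cases "x = 0")
    case False
    have "x /\<^sub>R norm x \<in> ?K" using that S(1) False by (auto simp: subspace_scale)
    from max[OF this, folded l_def] have "(x \<bullet> f x) / (norm x)\<^sup>2 \<le> l"
      by (simp add: linear_cmul[OF f] power2_eq_square divide_simps)
    then show ?thesis using False by (simp add: field_simps)
  qed (simp add: linear_0[OF f])
  \<comment> \<open>the residual, which is orthogonal to e\<close>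
  define y where "y = f e - l *\<^sub>R e"
  have yS: "y \<in> S" using e(1) S by (auto simp: y_def intro!: subspace_diff subspace_scale)
  have ee: "e \<bullet> e = 1" using e(2) by (simp add: dot_square_norm)
  have ye: "y \<bullet> e = 0" 
    unfolding y_def l_def inner_diff_left inner_scaleR_left ee inner_commute[of "f e" e] by simp
  have yfe: "y \<bullet> f e = y \<bullet> y" using ye by (subst (3) y_def) (simp add: inner_diff_right)
  have key: "2 * t * (y \<bullet> y) + t\<^sup>2 * (y \<bullet> f y - l * (y \<bullet> y)) \<le> 0" for t
  proof -
    have "e + t *\<^sub>R y \<in> S" using e(1) yS S(1) by (intro subspace_add subspace_scale)
    from max'[OF this] have "(e + t *\<^sub>R y) \<bullet> f (e + t *\<^sub>R y) \<le> l * ((e + t *\<^sub>R y) \<bullet> (e + t *\<^sub>R y))"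
      by (simp add: power2_norm_eq_inner)
    moreover have "(e + t *\<^sub>R y) \<bullet> f (e + t *\<^sub>R y) = l + 2 * t * (y \<bullet> y) + t\<^sup>2 * (y \<bullet> f y)"
    proof -
      have gen: "(e + t *\<^sub>R y) \<bullet> f (e + t *\<^sub>R y) = l + t * (e \<bullet> f y) + t * (y \<bullet> f e) + t\<^sup>2 * (y \<bullet> f y)" for y
        unfolding linear_add[OF f] linear_cmul[OF f]
        by (simp add: inner_add_left inner_add_right power2_eq_square algebra_simps l_def)
      have efy: "e \<bullet> f y = y \<bullet> y" using adj[of e y] yfe inner_commute[of "f e" y] by argo
      show ?thesis unfolding gen yfe efy by (simp only: mult_2 distrib_right add.assoc)
    qed
    moreover have "(e + t *\<^sub>R y) \<bullet> (e + t *\<^sub>R y) = 1 + t\<^sup>2 * (y \<bullet> y)"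
      using ye inner_commute[of e y]
      unfolding inner_add_left inner_add_right inner_scaleR_left inner_scaleR_right
      by (simp add: power2_eq_square ee)
    ultimately have "l + 2 * t * (y \<bullet> y) + t\<^sup>2 * (y \<bullet> f y) \<le> l * (1 + t\<^sup>2 * (y \<bullet> y))"
      by (simp only:)
    then show ?thesis by (simp add: algebra_simps)
  qed
  have "y \<bullet> y = 0"
  proof (rule ccontr)
    assume "y \<bullet> y \<noteq> 0"
    then have p: "y \<bullet> y > 0" using inner_ge_zero[of y] by linarith
    \<comment> \<open>for this small displacement t the linear term of \<open>key\<close> beats the quadratic one\<close>
    define c where "c = \<bar>y \<bullet> f y - l * (y \<bullet> y)\<bar> + 1"
    define t where "t = (y \<bullet> y) / c"
    have c: "c > 0" "- (y \<bullet> f y - l * (y \<bullet> y)) \<le> c" by (auto simp: c_def)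
    have t: "t > 0" "t * c = y \<bullet> y" using p c by (auto simp: t_def)
    have "t\<^sup>2 * (- (y \<bullet> f y - l * (y \<bullet> y))) \<le> t\<^sup>2 * c"
      using c(2) by (intro mult_left_mono) auto
    also have "\<dots> = t * (y \<bullet> y)" using t(2) by (simp add: power2_eq_square)
    finally have "2 * t * (y \<bullet> y) \<le> t * (y \<bullet> y)" using key[of t] unfolding mult_minus_right by linarith
    then show False using t(1) p by simp
  qed
  then have "f e = (e \<bullet> f e) *\<^sub>R e" by (simp add: y_def l_def)
  with e show ?thesis using that by blast
qed

text \<open>
  Induction on the dimension: f maps the orthogonal complement of an eigenvector into itself.
\<close>
lemma self_adjoint_eigenbasis:
  fixes f :: "'a::euclidean_space \<Rightarrow> 'a"
  assumes f: "linear f" and adj: "\<And>x y. f x \<bullet> y = x \<bullet> f y"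
    and S: "subspace S" "f ` S \<subseteq> S"
  shows "\<exists>B. B \<subseteq> S \<and> finite B \<and> S \<subseteq> span B \<and> (\<forall>b\<in>B. f b = (b \<bullet> f b) *\<^sub>R b) \<and>
    (\<forall>b\<in>B. \<forall>c\<in>B. b \<bullet> c = (if b = c then 1 else 0))"
  using S
proof (induction "dim S" arbitrary: S rule: less_induct)
  case less
  show ?case
  proof (cases "S = {0}")
    case True
    then show ?thesis by (intro exI[of _ "{}"]) auto
  next
    case False
    obtain e where e: "e \<in> S" "norm e = 1" "f e = (e \<bullet> f e) *\<^sub>R e"
      using self_adjoint_eigenvector[OF f adj less.prems False] by blast
    have ee: "e \<bullet> e = 1" using e(2) by (simp add: dot_square_norm)
    let ?S = "{x \<in> S. x \<bullet> e = 0}"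
    have sub: "subspace ?S"
      using less.prems(1) by (auto simp: subspace_def inner_add_left)
    have inv: "f ` ?S \<subseteq> ?S"
    proof
      fix y assume "y \<in> f ` ?S"
      then obtain x where x: "x \<in> S" "x \<bullet> e = 0" "y = f x" by auto
      have "y \<bullet> e = x \<bullet> f e" using adj x(3) by simp
      also have "\<dots> = 0" by (subst e(3)) (simp add: x(2))
      finally show "y \<in> ?S" using x less.prems(2) by auto
    qed
    have "?S \<subset> S" using e(1) ee by force
    then have "dim ?S < dim S"
      using dim_psubset[of ?S S] span_eq_iff[THEN iffD2, OF sub] span_eq_iff[THEN iffD2, OF less.prems(1)] by simp
    from less.hyps[OF this sub inv] obtain B where B: "B \<subseteq> ?S" "finite B" "?S \<subseteq> span B"
      "\<And>b. b \<in> B \<Longrightarrow> f b = (b \<bullet> f b) *\<^sub>R b"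
      "\<And>b c. b \<in> B \<Longrightarrow> c \<in> B \<Longrightarrow> b \<bullet> c = (if b = c then 1 else 0)" by blast
    have "S \<subseteq> span (insert e B)"
    proof
      fix x assume x: "x \<in> S"
      have "x - (x \<bullet> e) *\<^sub>R e \<in> ?S"
        using x e(1) less.prems(1) by (auto simp: inner_diff_left ee intro!: subspace_diff subspace_scale)
      then show "x \<in> span (insert e B)" using B(3) by (auto simp: span_breakdown_eq)
    qed
    moreover have "b \<bullet> c = (if b = c then 1 else 0)" if "b \<in> insert e B" "c \<in> insert e B" for b c
    proof -
      have 1: "x \<bullet> e = 0" "e \<bullet> x = 0" "x \<noteq> e" if "x \<in> B" for x
        using B(1) that ee by (auto simp: inner_commute)
      show ?thesis using that ee 1 1(3)[THEN not_sym] B(5) by (elim insertE) (simp_all split: if_split)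
    qed
    ultimately show ?thesis using B(1,2,4) e(1,3)
      by (intro exI[of _ "insert e B"]) blast
  qed
qed

lemma psd_matrix_has_root:
  fixes M :: "real^'n^'n"
  assumes sym: "transpose M = M" and psd: "\<And>x. 0 \<le> x \<bullet> (M *v x)"
  shows "\<exists>R. transpose R = R \<and> (\<forall>x. 0 \<le> x \<bullet> (R *v x)) \<and> R ** R = M"
proof -
  have "(M *v x) \<bullet> y = x \<bullet> (M *v y)" for x y
    using dot_lmul_matrix[of x M y] transpose_matrix_vector[of M x] sym by simp
  from self_adjoint_eigenbasis[OF matrix_vector_mul_linear this subspace_UNIV]
  obtain B where B0: "finite B" "UNIV \<subseteq> span B" "\<forall>b\<in>B. M *v b = (b \<bullet> (M *v b)) *\<^sub>R b"
    "\<forall>b\<in>B. \<forall>c\<in>B. b \<bullet> c = (if b = c then 1 else 0)"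
    by auto
  have "span B = UNIV" using B0(2) by auto
  note B = B0(1) this B0(3)[rule_format] B0(4)[rule_format]
  define l where "l b = b \<bullet> (M *v b)" for b
  define g where "g x = (\<Sum>b\<in>B. (sqrt (l b) * (x \<bullet> b)) *\<^sub>R b)" for x
  have lin: "linear g"
    by (rule linearI) (simp_all add: g_def inner_add_left algebra_simps sum.distrib scaleR_sum_right)
  have g: "matrix g *v x = g x" for x using fun_cong[OF matrix_vector_mul(2)[OF lin]] by simp
  have gxy: "g x \<bullet> y = (\<Sum>b\<in>B. sqrt (l b) * (x \<bullet> b) * (y \<bullet> b))" for x y
    unfolding g_def inner_sum_left by (simp add: mult.assoc inner_commute)
  have gb: "g b = sqrt (l b) *\<^sub>R b" if "b \<in> B" for b
  proof -
    have "g b = (\<Sum>c\<in>B. if c = b then sqrt (l b) *\<^sub>R b else 0)"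
      unfolding g_def using that by (intro sum.cong) (auto simp: B(4))
    then show ?thesis using B(1) that by simp
  qed
  have "(g \<circ> g) x = M *v x" for x
  proof (rule linear_eq_on[where B = B and f = "g \<circ> g" and g = "(*v) M"])
    show "linear (g \<circ> g)" by (rule linear_compose[OF lin lin])
    show "(g \<circ> g) b = M *v b" if "b \<in> B" for b
    proof -
      have "0 \<le> l b" unfolding l_def by (rule psd)
      then show ?thesis using that B(3)[OF that] by (simp add: gb linear_cmul[OF lin] l_def[symmetric])
    qed
  qed (auto simp: B(2))
  then have "matrix g ** matrix g = M"
    by (subst matrix_eq) (simp add: g flip: matrix_vector_mul_assoc)
  moreover have "transpose (matrix g) = matrix g"
  proof (subst matrix_eq, rule allI)
    fix x
    have "(transpose (matrix g) *v x) \<bullet> y = (matrix g *v x) \<bullet> y" for y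
      using dot_lmul_matrix[of x "matrix g" y] transpose_matrix_vector[of "matrix g" x]
      by (simp add: g gxy inner_commute[of x] mult_ac)
    then show "transpose (matrix g) *v x = matrix g *v x" by (metis vector_eq_rdot)
  qed
  moreover have "0 \<le> x \<bullet> (matrix g *v x)" for x
    unfolding g inner_commute[of x] gxy l_def
    by (intro sum_nonneg) (simp add: psd mult.assoc)
  ultimately show ?thesis by blast
qed

text \<open>
  The root enters the definition of \<open>Lambda_tilde\<close> only through this norm, which is
  a quadratic form in M itself.
\<close>
lemma norm_mat_sqrt:
  fixes M :: "real^'n^'n"
  assumes sym: "transpose M = M" and psd: "\<And>x. 0 \<le> x \<bullet> (M *v x)"
  shows "(norm (mat_sqrt M *v x))\<^sup>2 = x \<bullet> (M *v x)"
proof -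
  let ?R = "mat_sqrt M"
  have R: "transpose ?R = ?R" "?R ** ?R = M"
    using someI_ex[OF psd_matrix_has_root[OF sym psd]] unfolding mat_sqrt_def by auto
  have "(?R *v x) \<bullet> (?R *v x) = x \<bullet> (?R *v (?R *v x))"
    using dot_lmul_matrix[of x ?R "?R *v x"] transpose_matrix_vector[of ?R x] R(1) by simp
  then show ?thesis by (simp add: power2_norm_eq_inner matrix_vector_mul_assoc R(2))
qed

text \<open>
  With \<open>y = inv Q x\<close> both bounds express that a form is nonnegative: \<open>|x - c
  y|\<^sup>2\<close>, combined with the lower bound of Q at y, for the first one, \<open>(y - w)
  \<bullet> Q (y - w)\<close> for the second one, which is Young's inequality for the pair Q and
  its inverse.
\<close>
lemma mat_sqrt_matrix_inv_bounds:
  fixes Q :: "real^'n^'n"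
  assumes sym: "transpose Q = Q" and c: "0 < c" and pd: "\<And>x. c * (x \<bullet> x) \<le> x \<bullet> (Q *v x)"
  shows "(norm (mat_sqrt (matrix_inv Q) *v x))\<^sup>2 \<le> (x \<bullet> x) / c"
    and "x \<bullet> w - (norm (mat_sqrt (matrix_inv Q) *v x))\<^sup>2 / 2 \<le> (w \<bullet> (Q *v w)) / 2"
proof -
  let ?I = "matrix_inv Q"
  have inj: "x = y" if "Q *v x = Q *v y" for x y
  proof -
    have "c * ((x - y) \<bullet> (x - y)) \<le> 0" using pd[of "x - y"] that by (simp add: matrix_vector_mult_diff_distrib)
    then have "(x - y) \<bullet> (x - y) \<le> 0" using c by (simp add: mult_le_0_iff)
    then have "(x - y) \<bullet> (x - y) = 0" using inner_ge_zero by (rule antisym)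
    then show ?thesis by simp
  qed
  then obtain A where "A ** Q = mat 1"
    using matrix_left_invertible_injective[of Q] by (auto simp: inj_def)
  then have "\<exists>A. Q ** A = mat 1 \<and> A ** Q = mat 1"
    using matrix_left_right_inverse by blast
  then have I: "Q ** ?I = mat 1" "?I ** Q = mat 1"
    unfolding matrix_inv_def by (metis (mono_tags, lifting) someI_ex)+
  have QI: "Q *v (?I *v x) = x" for x by (simp add: matrix_vector_mul_assoc I)
  have adj: "(Q *v x) \<bullet> y = x \<bullet> (Q *v y)" for x y
    using dot_lmul_matrix[of x Q y] transpose_matrix_vector[of Q x] sym by simp
  have Isym: "transpose ?I = ?I"
  proof -
    have "transpose ?I ** Q = mat 1"
      using I(1) sym by (metis matrix_transpose_mul transpose_mat)
    then have "transpose ?I ** (Q ** ?I) = ?I" by (simp add: matrix_mul_assoc)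
    then show ?thesis by (simp add: I)
  qed
  have form: "x \<bullet> (?I *v x) = (?I *v x) \<bullet> (Q *v (?I *v x))" for x
    by (simp add: QI inner_commute)
  have nonneg: "0 \<le> y \<bullet> (Q *v y)" for y
    using pd[of y] c by (smt (verit) inner_ge_zero mult_nonneg_nonneg)
  have Ipsd: "0 \<le> x \<bullet> (?I *v x)" for x
    unfolding form by (rule nonneg)
  note eq = norm_mat_sqrt[OF Isym Ipsd]
  let ?y = "?I *v x"
  have "c * (x \<bullet> ?y) \<le> x \<bullet> x"
  proof -
    have "0 \<le> (x - c *\<^sub>R ?y) \<bullet> (x - c *\<^sub>R ?y)" by simp
    also have "\<dots> = x \<bullet> x - 2 * c * (x \<bullet> ?y) + c * (c * (?y \<bullet> ?y))"
      by (simp add: inner_diff_left inner_diff_right inner_commute algebra_simps)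
    also have "\<dots> \<le> x \<bullet> x - 2 * c * (x \<bullet> ?y) + c * (x \<bullet> ?y)"
      using mult_left_mono[OF pd[of ?y], of c] c form[of x] by simp
    finally show ?thesis by simp
  qed
  then show "(norm (mat_sqrt ?I *v x))\<^sup>2 \<le> (x \<bullet> x) / c"
    unfolding eq using c by (simp add: field_simps)
  have "0 \<le> (?y - w) \<bullet> (Q *v (?y - w))" by (rule nonneg)
  also have "\<dots> = ?y \<bullet> (Q *v ?y) - 2 * (w \<bullet> x) + w \<bullet> (Q *v w)"
    using adj[of ?y w] QI[of x]
    by (simp add: matrix_vector_mult_diff_distrib inner_diff_left inner_diff_right inner_commute)
  finally show "x \<bullet> w - (norm (mat_sqrt ?I *v x))\<^sup>2 / 2 \<le> (w \<bullet> (Q *v w)) / 2"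
    unfolding eq form by (simp add: inner_commute)
qed

lemma sum_UNIV_Plus:
  "sum f (UNIV :: ('a::finite + 'b::finite) set) = (\<Sum>a\<in>UNIV. f (Inl a)) + (\<Sum>b\<in>UNIV. f (Inr b))"
  using sum.Plus[of "UNIV :: 'a set" "UNIV :: 'b set" f] by (simp add: o_def)

lemma sum_UNIV_1: "sum f (UNIV :: 1 set) = f 1"
  by (simp add: UNIV_1)

lemma vec10_nth [simp]:
  "vec10 a b c d $ Inl i = a" "vec10 a b c d $ Inr (Inl j) = b $ j"
  "vec10 a b c d $ Inr (Inr (Inl j)) = c $ j" "vec10 a b c d $ Inr (Inr (Inr j)) = d $ j"
  by (simp_all add: vec10_def)

lemma vec10_exhaust: 
  obtains a b c d where "x = vec10 a b c d"
proof
  show "x = vec10 (x $ Inl 1) (\<chi> j. x $ Inr (Inl j)) (\<chi> j. x $ Inr (Inr (Inl j))) (\<chi> j. x $ Inr (Inr (Inr j)))"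
    by (auto simp: vec_eq_iff vec10_def split: sum.split)
qed

lemma inner_vec10: "vec10 a b c d \<bullet> vec10 a' b' c' d' = a * a' + b \<bullet> b' + c \<bullet> c' + d \<bullet> d'"
  by (simp add: inner_vec_def sum_UNIV_Plus sum_UNIV_1)

lemma transpose_Qr_mat: "transpose (Qr_mat r b d v p) = Qr_mat r b d v p"
  by (auto simp: Qr_mat_def Q_mat_def diag_1111000000_def transpose_def mat_def vec_eq_iff split: sum.split)

text \<open>
  The antisymmetric part of the Jacobian of \<open>bs\<close> acts as the cross product with its
  curl; this yields the last term of the bracket.
\<close>
lemma Qr_mat_form:
  "vec10 a b c d \<bullet> (Qr_mat r bs ds vs p *v vec10 a b c d) =
    2 * (- a\<^sup>2 * div_vec vs p + a * (b \<bullet> curl ds p) - a * (c \<bullet> curl bs p) - b \<bullet> dir_deriv b vs p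
      + c \<bullet> c + d \<bullet> d + b \<bullet> cross3 (curl bs p) d) + r * (a\<^sup>2 + b \<bullet> b)"
proof -
  have "(Qr_mat r bs ds vs p *v vec10 a b c d) = vec10
     (- 2 * div_vec vs p * a + curl ds p \<bullet> b - curl bs p \<bullet> c + r * a)
     (a *\<^sub>R curl ds p - (jac vs p + transpose (jac vs p)) *v b + (jac bs p - transpose (jac bs p)) *v d + r *\<^sub>R b)
     (- a *\<^sub>R curl bs p + 2 *\<^sub>R c)
     ((transpose (jac bs p) - jac bs p) *v b + 2 *\<^sub>R d)"
    by (auto simp: vec_eq_iff matrix_vector_mult_def sum_UNIV_Plus sum_UNIV_1 Qr_mat_def Q_mat_def
      diag_1111000000_def vec10_def mat_def sum_3 inner_vec_def algebra_simps split: sum.split)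
      (use exhaust_3 in \<open>auto simp: algebra_simps\<close>)
  then show ?thesis
    by (simp only: inner_vec10)
      (simp add: inner_vec_def sum_3 matrix_vector_mult_def jac_def transpose_def cross3_def curl_def
        dir_deriv_def vector_3 power2_eq_square algebra_simps)
qed

lemma Qr_mat_mono:
  assumes "loewner_le (mat 1) (Qr_mat r0 b d v p)" "r0 \<le> r"
  shows "x \<bullet> x \<le> x \<bullet> (Qr_mat r b d v p *v x)"
proof -
  obtain a' b' c' d' where x: "x = vec10 a' b' c' d'" by (rule vec10_exhaust)
  have "x \<bullet> x \<le> x \<bullet> (Qr_mat r0 b d v p *v x)" using assms(1) by (simp add: loewner_le_def)
  also have "\<dots> \<le> x \<bullet> (Qr_mat r b d v p *v x)"
    unfolding x Qr_mat_form using assms(2) by (intro add_left_mono mult_right_mono) auto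
  finally show ?thesis .
qed

text \<open>
  The lower right block of Q is twice the identity. One half of it gives the identity, the other
  half absorbs the mixed terms by Young's inequality; what they cost in the first four
  components, of size K and K squared, is covered by r.
\<close>
lemma Qr_mat_ge_mat_1:
  assumes K: "\<bar>div_vec vs p\<bar> \<le> K" "norm (curl ds p) \<le> K" "norm (curl bs p) \<le> K"
    "\<And>b. norm (dir_deriv b vs p) \<le> K * norm b" "0 \<le> K"
  shows "loewner_le (mat 1) (Qr_mat (1 + 5 * K + 2 * K\<^sup>2) bs ds vs p)"
  unfolding loewner_le_def
proof
  fix x :: "real^i10"
  obtain a b c d where x: "x = vec10 a b c d" by (rule vec10_exhaust)
  have cs: "\<bar>y \<bullet> z\<bar> \<le> norm y * norm z" for y z :: "real^3" by (rule Cauchy_Schwarz_ineq2)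
  have ab: "2 * (\<bar>a\<bar> * norm b) \<le> a\<^sup>2 + (norm b)\<^sup>2"
    using sum_squares_bound[of "\<bar>a\<bar>" "norm b"] by simp
  have 1: "a\<^sup>2 * div_vec vs p \<le> a\<^sup>2 * K"
    using K(1) by (intro mult_left_mono) auto
  have 2: "- (a * (b \<bullet> curl ds p)) \<le> K * (\<bar>a\<bar> * norm b)"
  proof -
    have "- (a * (b \<bullet> curl ds p)) \<le> \<bar>a\<bar> * \<bar>b \<bullet> curl ds p\<bar>" by (simp add: abs_mult[symmetric])
    also have "\<dots> \<le> \<bar>a\<bar> * (norm b * K)"
      using cs[of b "curl ds p"] K(2) by (intro mult_left_mono order.trans[OF cs] mult_mono) auto
    finally show ?thesis by (simp add: mult_ac)
  qed
  have 3: "2 * (a * (c \<bullet> curl bs p)) \<le> (norm c)\<^sup>2 + K\<^sup>2 * a\<^sup>2"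
  proof -
    have "a * (c \<bullet> curl bs p) \<le> \<bar>a\<bar> * \<bar>c \<bullet> curl bs p\<bar>" by (simp add: abs_mult[symmetric])
    also have "\<dots> \<le> \<bar>a\<bar> * (norm c * K)"
      using K(3) by (intro mult_left_mono order.trans[OF cs] mult_mono) auto
    finally show ?thesis using sum_squares_bound[of "norm c" "K * \<bar>a\<bar>"]
      by (simp add: power_mult_distrib mult_ac)
  qed
  have 4: "b \<bullet> dir_deriv b vs p \<le> K * (norm b)\<^sup>2"
  proof -
    have "b \<bullet> dir_deriv b vs p \<le> norm b * norm (dir_deriv b vs p)" by (rule norm_cauchy_schwarz)
    also have "\<dots> \<le> norm b * (K * norm b)" using K(4) by (intro mult_left_mono) auto
    finally show ?thesis by (simp add: power2_eq_square mult_ac)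
  qed
  have 5: "- (2 * (b \<bullet> cross3 (curl bs p) d)) \<le> (norm d)\<^sup>2 + K\<^sup>2 * (norm b)\<^sup>2"
  proof -
    have nc: "norm (cross3 (curl bs p) d) \<le> norm (curl bs p) * norm d"
      using norm_cross_dot[of "curl bs p" d] zero_le_power2[of "curl bs p \<bullet> d"]
      by (metis add_increasing2 le_add_same_cancel1 mult_nonneg_nonneg norm_ge_zero power2_le_imp_le)
    have "- (b \<bullet> cross3 (curl bs p) d) \<le> norm b * norm (cross3 (curl bs p) d)"
      using cs[of b "cross3 (curl bs p) d"] by simp
    also have "\<dots> \<le> norm b * (K * norm d)"
      using K(3,5) by (intro mult_left_mono order.trans[OF nc] mult_right_mono) auto
    finally show ?thesis using sum_squares_bound[of "norm d" "K * norm b"]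
      by (simp add: power_mult_distrib mult_ac)
  qed
  have 6: "K * (2 * (\<bar>a\<bar> * norm b)) \<le> K * (a\<^sup>2 + (norm b)\<^sup>2)" using ab K(5) by (rule mult_left_mono)
  have 7: "0 \<le> K * a\<^sup>2" "0 \<le> K * (norm b)\<^sup>2" "0 \<le> K\<^sup>2 * a\<^sup>2" "0 \<le> K\<^sup>2 * (norm b)\<^sup>2" using K(5) by auto
  show "x \<bullet> (mat 1 *v x) \<le> x \<bullet> (Qr_mat (1 + 5 * K + 2 * K\<^sup>2) bs ds vs p *v x)"
    unfolding x Qr_mat_form matrix_vector_mul_lid inner_vec10
    unfolding power2_norm_eq_inner[symmetric]
    using 1 2 3 4 5 6 7 unfolding ring_distribs mult.assoc mult.commute[of "a\<^sup>2" K] mult_1_left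
      power2_eq_square[of a, symmetric] minus_mult_left[symmetric] by linarith
qed

section \<open>The relative energy identity\<close>

lemma bounded_bilinear_cross3: "bounded_bilinear cross3"
  using bilinear_cross bilinear_conv_bounded_bilinear by blast

lemma bounded_bilinear_outer: "bounded_bilinear outer"
  unfolding bilinear_conv_bounded_bilinear[symmetric] bilinear_def
  by (auto intro!: linearI simp: outer_def vec_eq_iff algebra_simps)

lemmas C1_scaleR = C1_bilinear[OF bounded_bilinear_scaleR]
lemmas C1_mult = C1_bilinear[OF bounded_bilinear_mult]
lemmas C1_inner = C1_bilinear[OF bounded_bilinear_inner]
lemmas C1_cross3 = C1_bilinear[OF bounded_bilinear_cross3]
lemmas C1_outer = C1_bilinear[OF bounded_bilinear_outer]

lemma div_vec_scaleR:
  assumes "f \<in> C1_slab T" "w \<in> C1_slab T" "0 < T" "p \<in> slab T"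
  shows "div_vec (\<lambda>q. f q *\<^sub>R w q) p = f p * div_vec w p + w p \<bullet> grad f p"
  by (simp add: div_vec_def grad_def C1_scaleR(2)[OF assms] inner_vec_def sum.distrib sum_distrib_left mult.commute)

lemma div_vec_add:
  assumes "f \<in> C1_slab T" "w \<in> C1_slab T" "0 < T" "p \<in> slab T"
  shows "div_vec (\<lambda>q. f q + w q) p = div_vec f p + div_vec w p"
  by (simp add: div_vec_def C1_add(2)[OF assms] sum.distrib)

lemma div_vec_diff:
  assumes "f \<in> C1_slab T" "w \<in> C1_slab T" "0 < T" "p \<in> slab T"
  shows "div_vec (\<lambda>q. f q - w q) p = div_vec f p - div_vec w p"
  by (simp add: div_vec_def C1_diff(2)[OF assms] sum_subtractf)

lemma curl_diff:
  assumes "f \<in> C1_slab T" "w \<in> C1_slab T" "0 < T" "p \<in> slab T"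
  shows "curl (\<lambda>q. f q - w q) p = curl f p - curl w p"
  by (simp add: curl_def C1_diff(2)[OF assms] vec_eq_iff forall_3)

lemma curl_add:
  assumes "f \<in> C1_slab T" "w \<in> C1_slab T" "0 < T" "p \<in> slab T"
  shows "curl (\<lambda>q. f q + w q) p = curl f p + curl w p"
  by (simp add: curl_def C1_add(2)[OF assms] vec_eq_iff forall_3)

lemma div_vec_cross3:
  assumes "f \<in> C1_slab T" "w \<in> C1_slab T" "0 < T" "p \<in> slab T"
  shows "div_vec (\<lambda>q. cross3 (f q) (w q)) p = w p \<bullet> curl f p - f p \<bullet> curl w p"
  unfolding div_vec_def C1_cross3(2)[OF assms]
  by (simp add: curl_def cross3_def inner_vec_def sum_3 algebra_simps)

lemma curl_cross3:
  assumes "f \<in> C1_slab T" "w \<in> C1_slab T" "0 < T" "p \<in> slab T"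
  shows "curl (\<lambda>q. cross3 (f q) (w q)) p =
    div_vec w p *\<^sub>R f p - div_vec f p *\<^sub>R w p + dir_deriv (w p) f p - dir_deriv (f p) w p"
  unfolding curl_def C1_cross3(2)[OF assms]
  by (simp add: div_vec_def dir_deriv_def cross3_def vec_eq_iff forall_3 sum_3 algebra_simps)

lemma dir_deriv_diff:
  assumes "f \<in> C1_slab T" "w \<in> C1_slab T" "0 < T" "p \<in> slab T"
  shows "dir_deriv a (\<lambda>q. f q - w q) p = dir_deriv a f p - dir_deriv a w p"
  by (simp add: dir_deriv_def C1_diff(2)[OF assms] scaleR_diff_right sum_subtractf)

lemma dir_deriv_scaleR:
  assumes "f \<in> C1_slab T" "w \<in> C1_slab T" "0 < T" "p \<in> slab T"
  shows "dir_deriv a (\<lambda>q. f q *\<^sub>R w q) p = f p *\<^sub>R dir_deriv a w p + (a \<bullet> grad f p) *\<^sub>R w p"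
  by (simp add: dir_deriv_def grad_def C1_scaleR(2)[OF assms] inner_vec_def sum_3 algebra_simps)

lemma dir_deriv_scaleR_left: "dir_deriv (c *\<^sub>R a) w p = c *\<^sub>R dir_deriv a w p"
  by (simp add: dir_deriv_def scaleR_sum_right)

lemma grad_add:
  assumes "f \<in> C1_slab T" "w \<in> C1_slab T" "0 < T" "p \<in> slab T"
  shows "grad (\<lambda>q. f q + w q) p = grad f p + grad w p"
  by (simp add: grad_def C1_add(2)[OF assms] vec_eq_iff)

lemma grad_diff:
  assumes "f \<in> C1_slab T" "w \<in> C1_slab T" "0 < T" "p \<in> slab T"
  shows "grad (\<lambda>q. f q - w q) p = grad f p - grad w p"
  by (simp add: grad_def C1_diff(2)[OF assms] vec_eq_iff)

lemma inner_grad_inner: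
  assumes "f \<in> C1_slab T" "w \<in> C1_slab T" "0 < T" "p \<in> slab T"
  shows "a \<bullet> grad (\<lambda>q. f q \<bullet> w q) p = dir_deriv a f p \<bullet> w p + f p \<bullet> dir_deriv a w p"
  unfolding grad_def C1_inner(2)[OF assms]
  by (simp add: dir_deriv_def inner_vec_def sum_3 algebra_simps)

lemma inner_grad_mult:
  assumes "f \<in> C1_slab T" "w \<in> C1_slab T" "0 < T" "p \<in> slab T"
  shows "a \<bullet> grad (\<lambda>q. f q * w q) p = f p * (a \<bullet> grad w p) + (a \<bullet> grad f p) * w p"
  by (simp add: grad_def C1_mult(2)[OF assms] inner_vec_def sum_3 algebra_simps)

lemma div_mat_outer:
  assumes "f \<in> C1_slab T" "w \<in> C1_slab T" "0 < T" "p \<in> slab T"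
  shows "div_mat (\<lambda>q. outer (f q) (w q)) p = div_vec w p *\<^sub>R f p + dir_deriv (w p) f p"
  unfolding div_mat_def C1_outer(2)[OF assms]
  by (simp add: div_vec_def dir_deriv_def outer_def vec_eq_iff sum_3 algebra_simps)

text \<open>
  The components of L are the equations of the system after division by h, with \<open>div B =
  0\<close> used in the expansions of \<open>curl (B \<times> v)\<close> and of \<open>div (B
  \<otimes> B / h)\<close>.
\<close>
lemma classical_solves_L_op:
  assumes cl: "classical_DMHD T h B D P" and T: "0 < T"
  defines "\<tau> \<equiv> \<lambda>q. inverse (h q)" and "b \<equiv> \<lambda>q. B q /\<^sub>R h q"
    and "d \<equiv> \<lambda>q. D q /\<^sub>R h q" and "v \<equiv> \<lambda>q. P q /\<^sub>R h q"
  shows "\<tau> \<in> C1_slab T" "b \<in> C1_slab T" "d \<in> C1_slab T" "v \<in> C1_slab T"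
    and "p \<in> slab T \<Longrightarrow> L_op T h b d v p = 0"
    and "p \<in> slab T \<Longrightarrow> dt T h p + div_vec P p = 0"
    and "p \<in> slab T \<Longrightarrow> dt T h p + h p * div_vec v p + v p \<bullet> grad h p = 0"
proof -
  have C1: "h \<in> C1_slab T" "B \<in> C1_slab T" "D \<in> C1_slab T" "P \<in> C1_slab T"
    and pos: "\<forall>p\<in>slab T. h p > 0"
    using cl unfolding classical_DMHD_def by blast+
  have nz: "h p \<noteq> 0" if "p \<in> slab T" for p using pos[rule_format, OF that] by simp
  have eqs: "\<And>p. p \<in> slab T \<Longrightarrow> dt T h p + div_vec (\<lambda>q. h q *\<^sub>R v q) p = 0"
    "\<And>p. p \<in> slab T \<Longrightarrow> dt T B p + curl (\<lambda>q. cross3 (B q) (v q) + d q) p = 0"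
    "\<And>p. p \<in> slab T \<Longrightarrow> div_vec B p = 0"
    "\<And>p. p \<in> slab T \<Longrightarrow> D p = curl b p"
    "\<And>p. p \<in> slab T \<Longrightarrow> P p = div_mat (\<lambda>q. outer (B q) (B q) /\<^sub>R h q) p + grad \<tau> p"
    using cl unfolding classical_DMHD_def Let_def b_def d_def v_def \<tau>_def by blast+
  show \<tau>: "\<tau> \<in> C1_slab T" unfolding \<tau>_def using C1_inverse(1)[OF C1(1) nz T] .
  have b': "b = (\<lambda>q. \<tau> q *\<^sub>R B q)" and d': "d = (\<lambda>q. \<tau> q *\<^sub>R D q)" and v': "v = (\<lambda>q. \<tau> q *\<^sub>R P q)"
    by (simp_all add: b_def d_def v_def \<tau>_def)
  show b: "b \<in> C1_slab T" unfolding b' using C1_scaleR(1)[OF \<tau> C1(2) T] .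
  show d: "d \<in> C1_slab T" unfolding d' using C1_scaleR(1)[OF \<tau> C1(3) T] .
  show v: "v \<in> C1_slab T" unfolding v' using C1_scaleR(1)[OF \<tau> C1(4) T] .
  show cont: "dt T h p + h p * div_vec v p + v p \<bullet> grad h p = 0" if p: "p \<in> slab T" for p
    using eqs(1)[OF p] by (simp add: div_vec_scaleR[OF C1(1) v T p])
  have h\<tau>: "h p * \<tau> p = 1" if "p \<in> slab T" for p
    using nz[OF that] by (simp add: \<tau>_def)
  show "dt T h p + div_vec P p = 0" if p: "p \<in> slab T" for p
  proof -
    have "dx j (\<lambda>q. h q *\<^sub>R v q) p = dx j P p" for j
    proof -
      have "h (fst p, y) *\<^sub>R v (fst p, y) = P (fst p, y)" for y
        using p h\<tau>[of "(fst p, y)"] by (auto simp: v' mem_Times_iff)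
      then show ?thesis by (simp add: dx_def)
    qed
    then show ?thesis using eqs(1)[OF p] by (simp add: div_vec_def)
  qed
  show "L_op T h b d v p = 0" if p: "p \<in> slab T"
  proof -
    have dt\<tau>: "dt T \<tau> p = - (dt T h p * (\<tau> p)\<^sup>2)" and dx\<tau>: "\<And>i. dx i \<tau> p = - (dx i h p * (\<tau> p)\<^sup>2)"
      unfolding \<tau>_def using C1_inverse(2,3)[OF C1(1) nz T p] by simp_all
    have "grad \<tau> p = - ((\<tau> p)\<^sup>2 *\<^sub>R grad h p)"
      by (simp add: grad_def vec_eq_iff dx\<tau> mult.commute)
    then have "dt T \<tau> p - \<tau> p * div_vec v p + v p \<bullet> grad \<tau> p =
        - (\<tau> p)\<^sup>2 * (dt T h p + h p * div_vec v p + v p \<bullet> grad h p) + (h p * \<tau> p - 1) * \<tau> p * div_vec v p"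
      by (simp add: dt\<tau> power2_eq_square algebra_simps)
    then have Lh: "dt T \<tau> p - \<tau> p * div_vec v p + v p \<bullet> grad \<tau> p = 0"
      by (simp add: cont[OF p] h\<tau>[OF p])
    have dtB: "dt T B p = - (div_vec v p *\<^sub>R B p + dir_deriv (v p) B p - dir_deriv (B p) v p + curl d p)"
      using eqs(2)[OF p] unfolding curl_add[OF C1_cross3(1)[OF C1(2) v T] d T p] curl_cross3[OF C1(2) v T p] eqs(3)[OF p]
        scaleR_zero_left diff_zero by (simp only: eq_neg_iff_add_eq_0)
    have "dt T b p + dir_deriv (v p) b p - dir_deriv (b p) v p + \<tau> p *\<^sub>R curl d p
        = (dt T \<tau> p - \<tau> p * div_vec v p + v p \<bullet> grad \<tau> p) *\<^sub>R B p"
      unfolding b' C1_scaleR(3)[OF \<tau> C1(2) T p] dir_deriv_scaleR[OF \<tau> C1(2) T p] dir_deriv_scaleR_left dtB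
      by (simp add: algebra_simps)
    then have LB: "dt T b p + dir_deriv (v p) b p - dir_deriv (b p) v p + \<tau> p *\<^sub>R curl d p = 0"
      by (simp add: Lh)
    have LD: "d p - \<tau> p *\<^sub>R curl b p = 0"
      using eqs(4)[OF p] by (simp add: d')
    have o: "(\<lambda>q. outer (B q) (B q) /\<^sub>R h q) = (\<lambda>q. outer (b q) (B q))"
      by (simp add: fun_eq_iff b_def outer_def vec_eq_iff)
    have "b p = \<tau> p *\<^sub>R B p" by (simp add: b')
    then have LP: "v p - dir_deriv (b p) b p - \<tau> p *\<^sub>R grad \<tau> p = 0"
      using eqs(5)[OF p] unfolding o div_mat_outer[OF b C1(2) T p] eqs(3)[OF p]
      by (simp add: v' dir_deriv_scaleR_left scaleR_add_right)
    have z: "vec10 0 0 0 0 = 0"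
      by (simp add: vec10_def vec_eq_iff split: sum.split)
    show ?thesis
      unfolding L_op_def Let_def \<tau>_def[symmetric] Lh LB LD LP z ..
  qed
qed

text \<open>
  Here e is the relative energy density, and the flux is
  \<open>G = \<alpha> \<pi> + \<beta> \<times> \<delta> + (\<beta> \<bullet> \<pi>) B - e v\<close>. By conservation of mass, \<open>e_t + div (e v)\<close> is h times the
  material derivative of \<open>(\<alpha>\<^sup>2 + |\<beta>|\<^sup>2) / 2\<close>. The time derivatives of the test fields cancel against
  those in L, and those of the solution are expressed by \<open>L = 0\<close>. What remains splits
  into three groups, which contain \<open>\<tau>\<close>, the field d, and the pair b, v; up to the factor h they are the
  divergences of the first three parts of G.
\<close>
lemma relative_energy_identity:
  assumes cl: "classical_DMHD T h B D P" and T: "0 < T"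
    and hs: "hs \<in> C1_slab T" "\<And>p. p \<in> slab T \<Longrightarrow> hs p > 0"
    and bs: "bs \<in> C1_slab T" and ds: "ds \<in> C1_slab T" and vs: "vs \<in> C1_slab T"
  defines "\<alpha> \<equiv> \<lambda>q. inverse (h q) - inverse (hs q)" and "\<beta> \<equiv> \<lambda>q. B q /\<^sub>R h q - bs q"
    and "\<delta> \<equiv> \<lambda>q. D q /\<^sub>R h q - ds q" and "\<pi> \<equiv> \<lambda>q. P q /\<^sub>R h q - vs q"
  defines "e \<equiv> \<lambda>q. h q * ((\<alpha> q * \<alpha> q + \<beta> q \<bullet> \<beta> q) / 2)"
  defines "w \<equiv> \<lambda>q. vec10 (\<alpha> q) (\<beta> q) (\<delta> q) (\<pi> q)"
  obtains G where "e \<in> C1_slab T" "G \<in> C1_slab T"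
    "\<And>p. p \<in> slab T \<Longrightarrow> dt T e p + h p * (w p \<bullet> L_op T hs bs ds vs p)
       + h p * (w p \<bullet> (Qr_mat 0 bs ds vs p *v w p)) / 2 = div_vec G p"
proof -
  define \<tau> where "\<tau> = (\<lambda>q. inverse (h q))"
  define b where "b = (\<lambda>q. B q /\<^sub>R h q)"
  define d where "d = (\<lambda>q. D q /\<^sub>R h q)"
  define v where "v = (\<lambda>q. P q /\<^sub>R h q)"
  define \<sigma> where "\<sigma> = (\<lambda>q. inverse (hs q))"
  note w_solves = classical_solves_L_op[OF cl T, folded \<tau>_def b_def d_def v_def]
  note \<tau> = w_solves(1) and b = w_solves(2) and d = w_solves(3) and v = w_solves(4)
  have h: "h \<in> C1_slab T" and B: "B \<in> C1_slab T"
    and pos: "\<And>p. p \<in> slab T \<Longrightarrow> h p > 0" and divB: "\<And>p. p \<in> slab T \<Longrightarrow> div_vec B p = 0"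
    using cl unfolding classical_DMHD_def Let_def by blast+
  have \<sigma>: "\<sigma> \<in> C1_slab T" unfolding \<sigma>_def
  proof (rule C1_inverse(1)[OF hs(1) _ T])
    show "hs p \<noteq> 0" if "p \<in> slab T" for p using hs(2)[OF that] by simp
  qed
  have \<alpha>': "\<alpha> = (\<lambda>q. \<tau> q - \<sigma> q)" and \<beta>': "\<beta> = (\<lambda>q. b q - bs q)"
    and \<delta>': "\<delta> = (\<lambda>q. d q - ds q)" and \<pi>': "\<pi> = (\<lambda>q. v q - vs q)"
    by (simp_all add: \<alpha>_def \<beta>_def \<delta>_def \<pi>_def \<tau>_def \<sigma>_def b_def d_def v_def)
  have \<alpha>: "\<alpha> \<in> C1_slab T" and \<beta>: "\<beta> \<in> C1_slab T" and \<delta>: "\<delta> \<in> C1_slab T" and \<pi>: "\<pi> \<in> C1_slab T"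
    unfolding \<alpha>' \<beta>' \<delta>' \<pi>' by (intro C1_diff(1) \<tau> \<sigma> b bs d ds v vs T)+
  define u where "u = (\<lambda>q. \<alpha> q * \<alpha> q + \<beta> q \<bullet> \<beta> q)"
  have u: "u \<in> C1_slab T" unfolding u_def by (intro C1_add(1) C1_mult(1) C1_inner(1) \<alpha> \<beta> T)
  have hu: "(\<lambda>q. h q * u q) \<in> C1_slab T" by (intro C1_mult(1) h u T)
  have e': "e = (\<lambda>q. (1/2) *\<^sub>R (h q * u q))" by (simp add: e_def u_def)
  note half = bounded_linear_scaleR_right[of "1/2 :: real"]
  have e: "e \<in> C1_slab T" unfolding e' by (intro C1_linear(1)[OF half] hu T)
  define G1 where "G1 = (\<lambda>q. \<alpha> q *\<^sub>R \<pi> q)"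
  define G2 where "G2 = (\<lambda>q. cross3 (\<beta> q) (\<delta> q))"
  define G3 where "G3 = (\<lambda>q. (\<beta> q \<bullet> \<pi> q) *\<^sub>R B q)"
  define G4 where "G4 = (\<lambda>q. e q *\<^sub>R v q)"
  have bp: "(\<lambda>q. \<beta> q \<bullet> \<pi> q) \<in> C1_slab T" by (intro C1_inner(1) \<beta> \<pi> T)
  have G: "G1 \<in> C1_slab T" "G2 \<in> C1_slab T" "G3 \<in> C1_slab T" "G4 \<in> C1_slab T"
    unfolding G1_def G2_def G3_def G4_def by (intro C1_scaleR(1) C1_cross3(1) \<alpha> \<beta> \<delta> \<pi> bp B e v T)+
  have G12: "(\<lambda>q. G1 q + G2 q) \<in> C1_slab T" by (intro C1_add(1) G T)
  have G123: "(\<lambda>q. G1 q + G2 q + G3 q) \<in> C1_slab T" by (intro C1_add(1) G12 G T)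
  have G1234: "(\<lambda>q. G1 q + G2 q + G3 q - G4 q) \<in> C1_slab T" by (intro C1_diff(1) G123 G T)
  have identity: "dt T e p + h p * (w p \<bullet> L_op T hs bs ds vs p)
      + h p * (w p \<bullet> (Qr_mat 0 bs ds vs p *v w p)) / 2 = div_vec (\<lambda>q. G1 q + G2 q + G3 q - G4 q) p"
    if p: "p \<in> slab T" for p
  proof -
    have h\<tau>: "h p * \<tau> p = 1" and Bp: "B p = h p *\<^sub>R b p"
      using pos[OF p] by (simp_all add: \<tau>_def b_def)
    have L: "vec10 (dt T \<tau> p - \<tau> p * div_vec v p + v p \<bullet> grad \<tau> p)
        (dt T b p + dir_deriv (v p) b p - dir_deriv (b p) v p + \<tau> p *\<^sub>R curl d p)
        (d p - \<tau> p *\<^sub>R curl b p) (v p - dir_deriv (b p) b p - \<tau> p *\<^sub>R grad \<tau> p) = vec10 0 0 0 0"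
    proof -
      have "vec10 0 0 0 0 = 0" by (simp add: vec10_def vec_eq_iff split: sum.split)
      then show ?thesis using w_solves(5)[OF p] unfolding L_op_def Let_def \<tau>_def[symmetric] by simp
    qed
    have "w = w' \<and> x = x' \<and> y = y' \<and> z = z'" if "vec10 w x y z = vec10 w' x' y' z'" for w x y z w' x' y' z'
      using arg_cong[OF that, of "\<lambda>V. V $ Inl 1"] arg_cong[OF that, of "\<lambda>V. \<chi> j. V $ Inr (Inl j)"]
        arg_cong[OF that, of "\<lambda>V. \<chi> j. V $ Inr (Inr (Inl j))"] arg_cong[OF that, of "\<lambda>V. \<chi> j. V $ Inr (Inr (Inr j))"]
      by (simp add: vec_lambda_eta)
    note L' = this[OF L]
    have dt\<tau>: "dt T \<tau> p = \<tau> p * div_vec v p - v p \<bullet> grad \<tau> p"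
      and dtb: "dt T b p = dir_deriv (b p) v p - dir_deriv (v p) b p - \<tau> p *\<^sub>R curl d p"
      and LD: "ds p - \<sigma> p *\<^sub>R curl bs p = \<tau> p *\<^sub>R curl b p - \<sigma> p *\<^sub>R curl bs p - \<delta> p"
      and LP: "vs p - dir_deriv (bs p) bs p - \<sigma> p *\<^sub>R grad \<sigma> p = dir_deriv (b p) b p + \<tau> p *\<^sub>R grad \<tau> p
        - dir_deriv (bs p) bs p - \<sigma> p *\<^sub>R grad \<sigma> p - \<pi> p"
      using L' by (auto simp: \<delta>' \<pi>' algebra_simps)
    \<comment> \<open>the three groups that become divergences\<close>
    have S1: "\<alpha> p * (\<tau> p * div_vec v p - v p \<bullet> grad \<tau> p - dt T \<sigma> p) + \<alpha> p * (v p \<bullet> (grad \<tau> p - grad \<sigma> p))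
        + \<alpha> p * (dt T \<sigma> p - \<sigma> p * div_vec vs p + vs p \<bullet> grad \<sigma> p)
        + \<pi> p \<bullet> (\<tau> p *\<^sub>R grad \<tau> p - \<sigma> p *\<^sub>R grad \<sigma> p) - (\<alpha> p)\<^sup>2 * div_vec vs p
        = \<tau> p * (\<alpha> p * (div_vec v p - div_vec vs p) + \<pi> p \<bullet> (grad \<tau> p - grad \<sigma> p))"
      unfolding \<alpha>' \<pi>' by (simp add: power2_eq_square inner_diff_left inner_diff_right algebra_simps)
    have S2: "- (\<tau> p * (\<beta> p \<bullet> curl d p)) + \<sigma> p * (\<beta> p \<bullet> curl ds p) + \<alpha> p * (\<beta> p \<bullet> curl ds p)
        + \<delta> p \<bullet> (\<tau> p *\<^sub>R curl b p - \<sigma> p *\<^sub>R curl bs p) - \<alpha> p * (\<delta> p \<bullet> curl bs p)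
        = \<tau> p * (\<delta> p \<bullet> (curl b p - curl bs p) - \<beta> p \<bullet> (curl d p - curl ds p))"
      unfolding \<alpha>' by (simp add: inner_diff_right algebra_simps)
    have S3: "\<beta> p \<bullet> (dir_deriv (b p) v p - dir_deriv (v p) b p - dt T bs p) + \<beta> p \<bullet> (dir_deriv (v p) b p - dir_deriv (v p) bs p)
        + \<beta> p \<bullet> (dt T bs p + dir_deriv (vs p) bs p - dir_deriv (bs p) vs p)
        + \<pi> p \<bullet> (dir_deriv (b p) b p - dir_deriv (bs p) bs p) - \<beta> p \<bullet> dir_deriv (\<beta> p) vs p
        + \<beta> p \<bullet> cross3 (curl bs p) (\<pi> p)
        = (dir_deriv (b p) b p - dir_deriv (b p) bs p) \<bullet> \<pi> p + \<beta> p \<bullet> (dir_deriv (b p) v p - dir_deriv (b p) vs p)"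
      unfolding \<beta>' \<pi>'
      by (simp add: inner_vec_def sum_3 cross3_def curl_def dir_deriv_def algebra_simps)
    have dte: "dt T e p = (dt T h p * u p + h p * dt T u p) / 2"
      unfolding e' C1_linear(3)[OF half hu T p] C1_mult(3)[OF h u T p] by simp
    have dtu: "dt T u p / 2 = \<alpha> p * (dt T \<tau> p - dt T \<sigma> p) + \<beta> p \<bullet> (dt T b p - dt T bs p)"
      unfolding u_def C1_add(3)[OF C1_mult(1)[OF \<alpha> \<alpha> T] C1_inner(1)[OF \<beta> \<beta> T] T p] C1_mult(3)[OF \<alpha> \<alpha> T p]
        C1_inner(3)[OF \<beta> \<beta> T p]
      by (simp add: \<alpha>' \<beta>' C1_diff(3)[OF \<tau> \<sigma> T p] C1_diff(3)[OF b bs T p] inner_commute mult.commute)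
    have gu: "v p \<bullet> grad u p / 2 = \<alpha> p * (v p \<bullet> (grad \<tau> p - grad \<sigma> p)) + \<beta> p \<bullet> (dir_deriv (v p) b p - dir_deriv (v p) bs p)"
    proof -
      have "v p \<bullet> grad u p = v p \<bullet> grad (\<lambda>q. \<alpha> q * \<alpha> q) p + v p \<bullet> grad (\<lambda>q. \<beta> q \<bullet> \<beta> q) p"
        unfolding u_def grad_add[OF C1_mult(1)[OF \<alpha> \<alpha> T] C1_inner(1)[OF \<beta> \<beta> T] T p] inner_add_right ..
      then show ?thesis
        unfolding inner_grad_mult[OF \<alpha> \<alpha> T p] inner_grad_inner[OF \<beta> \<beta> T p]
        by (simp add: \<alpha>' \<beta>' grad_diff[OF \<tau> \<sigma> T p] dir_deriv_diff[OF b bs T p] inner_commute mult.commute)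
    qed
    have ge: "v p \<bullet> grad e p = (h p * (v p \<bullet> grad u p) + (v p \<bullet> grad h p) * u p) / 2"
    proof -
      have "grad e p = (1/2) *\<^sub>R grad (\<lambda>q. h q * u q) p"
        unfolding e' grad_def C1_linear(2)[OF half hu T p] by (simp add: vec_eq_iff)
      then show ?thesis by (simp add: inner_grad_mult[OF h u T p])
    qed
    have "dt T e p + div_vec G4 p = (dt T h p + h p * div_vec v p + v p \<bullet> grad h p) * u p / 2
        + h p * (dt T u p / 2 + v p \<bullet> grad u p / 2)"
      unfolding G4_def div_vec_scaleR[OF e v T p] ge dte by (simp add: e' field_simps)
    then have eG4: "dt T e p = h p * (dt T u p / 2 + v p \<bullet> grad u p / 2) - div_vec G4 p"
      using classical_solves_L_op(7)[OF cl T p] unfolding v_def by simp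
    have dG1: "div_vec G1 p = h p * (\<tau> p * (\<alpha> p * (div_vec v p - div_vec vs p) + \<pi> p \<bullet> (grad \<tau> p - grad \<sigma> p)))"
      unfolding G1_def div_vec_scaleR[OF \<alpha> \<pi> T p] mult.assoc[symmetric] h\<tau>
      by (simp add: \<alpha>' \<pi>' div_vec_diff[OF v vs T p] grad_diff[OF \<tau> \<sigma> T p])
    have dG2: "div_vec G2 p = h p * (\<tau> p * (\<delta> p \<bullet> (curl b p - curl bs p) - \<beta> p \<bullet> (curl d p - curl ds p)))"
      unfolding G2_def div_vec_cross3[OF \<beta> \<delta> T p] mult.assoc[symmetric] h\<tau>
      by (simp add: \<beta>' \<delta>' curl_diff[OF b bs T p] curl_diff[OF d ds T p])
    have dG3: "div_vec G3 p = h p * ((dir_deriv (b p) b p - dir_deriv (b p) bs p) \<bullet> \<pi> p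
        + \<beta> p \<bullet> (dir_deriv (b p) v p - dir_deriv (b p) vs p))"
      unfolding G3_def div_vec_scaleR[OF bp B T p] divB[OF p] inner_grad_inner[OF \<beta> \<pi> T p] Bp dir_deriv_scaleR_left
      by (simp add: \<beta>' \<pi>' dir_deriv_diff[OF b bs T p] dir_deriv_diff[OF v vs T p] algebra_simps)
    have dG: "div_vec (\<lambda>q. G1 q + G2 q + G3 q - G4 q) p = div_vec G1 p + div_vec G2 p + div_vec G3 p - div_vec G4 p"
      by (simp add: div_vec_diff[OF G123 G(4) T p] div_vec_add[OF G12 G(3) T p] div_vec_add[OF G(1,2) T p])
    have wL: "w p \<bullet> L_op T hs bs ds vs p = \<alpha> p * (dt T \<sigma> p - \<sigma> p * div_vec vs p + vs p \<bullet> grad \<sigma> p)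
       + \<beta> p \<bullet> (dt T bs p + dir_deriv (vs p) bs p - dir_deriv (bs p) vs p) + \<sigma> p * (\<beta> p \<bullet> curl ds p)
       + \<delta> p \<bullet> (\<tau> p *\<^sub>R curl b p - \<sigma> p *\<^sub>R curl bs p) - \<delta> p \<bullet> \<delta> p
       + \<pi> p \<bullet> (dir_deriv (b p) b p - dir_deriv (bs p) bs p) + \<pi> p \<bullet> (\<tau> p *\<^sub>R grad \<tau> p - \<sigma> p *\<^sub>R grad \<sigma> p) - \<pi> p \<bullet> \<pi> p"
      unfolding L_op_def Let_def \<sigma>_def[symmetric] w_def inner_vec10 LD LP
      by (simp add: inner_add_right inner_diff_right)
    have wQ: "w p \<bullet> (Qr_mat 0 bs ds vs p *v w p) / 2 = - (\<alpha> p)\<^sup>2 * div_vec vs p + \<alpha> p * (\<beta> p \<bullet> curl ds p)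
       - \<alpha> p * (\<delta> p \<bullet> curl bs p) - \<beta> p \<bullet> dir_deriv (\<beta> p) vs p + \<delta> p \<bullet> \<delta> p + \<pi> p \<bullet> \<pi> p
       + \<beta> p \<bullet> cross3 (curl bs p) (\<pi> p)"
      unfolding w_def Qr_mat_form by simp
    have "dt T u p / 2 + v p \<bullet> grad u p / 2 + w p \<bullet> L_op T hs bs ds vs p + w p \<bullet> (Qr_mat 0 bs ds vs p *v w p) / 2
      = \<tau> p * (\<alpha> p * (div_vec v p - div_vec vs p) + \<pi> p \<bullet> (grad \<tau> p - grad \<sigma> p))
      + \<tau> p * (\<delta> p \<bullet> (curl b p - curl bs p) - \<beta> p \<bullet> (curl d p - curl ds p))
      + ((dir_deriv (b p) b p - dir_deriv (b p) bs p) \<bullet> \<pi> p + \<beta> p \<bullet> (dir_deriv (b p) v p - dir_deriv (b p) vs p))"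
    proof -
      have "\<beta> p \<bullet> (dt T b p - dt T bs p) = \<beta> p \<bullet> (dir_deriv (b p) v p - dir_deriv (v p) b p - dt T bs p)
          - \<tau> p * (\<beta> p \<bullet> curl d p)"
        unfolding dtb by (simp add: inner_diff_right)
      then show ?thesis
        unfolding dtu gu wL wQ dt\<tau> S1[symmetric] S2[symmetric] S3[symmetric] by linarith
    qed
    from arg_cong[OF this, of "\<lambda>z. h p * z"] show ?thesis
      unfolding dG dG1 dG2 dG3 eG4 by (simp add: distrib_left)
  qed
  show thesis by (rule that[OF e G1234 identity])
qed

section \<open>Measures with continuous densities\<close>

definition slab_int :: "real \<Rightarrow> (real \<times> (real^3) \<Rightarrow> real) \<Rightarrow> real" where
  "slab_int t f = integral {0..t} (\<lambda>s. cell_integral (\<lambda>x. f (s, x)))"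

lemma slab_int_cong:
  assumes "\<And>p. p \<in> slab t \<Longrightarrow> f p = g p"
  shows "slab_int t f = slab_int t g"
  unfolding slab_int_def by (rule integral_cong, rule integral_cong) (simp add: assms)

lemma slab_int_add:
  assumes "continuous_on (slab t) f" "continuous_on (slab t) g"
  shows "slab_int t (\<lambda>p. f p + g p) = slab_int t f + slab_int t g"
proof -
  have "integral {0..t} (\<lambda>s. cell_integral (\<lambda>x. f (s, x) + g (s, x)))
      = integral {0..t} (\<lambda>s. cell_integral (\<lambda>x. f (s, x)) + cell_integral (\<lambda>x. g (s, x)))"
    by (rule integral_cong, rule integral_add) (auto intro: slice_integrable assms)
  then show ?thesis
    unfolding slab_int_def by (simp add: integral_add slab_integrable assms)
qed

lemma slab_int_cmult: "slab_int t (\<lambda>p. c * f p) = c * slab_int t f"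
  by (simp add: slab_int_def)

lemma slab_int_diff:
  assumes "continuous_on (slab t) f" "continuous_on (slab t) g"
  shows "slab_int t (\<lambda>p. f p - g p) = slab_int t f - slab_int t g"
  using slab_int_add[OF assms(1), of "\<lambda>p. - 1 * g p"] assms(2)
  by (simp only: slab_int_cmult) (simp add: continuous_on_minus)

lemma slab_int_mono:
  assumes "continuous_on (slab t) f" "continuous_on (slab t) g" "\<And>p. p \<in> slab t \<Longrightarrow> f p \<le> g p"
  shows "slab_int t f \<le> slab_int t g"
  unfolding slab_int_def
  by (rule integral_le, rule slab_integrable[OF assms(1)], rule slab_integrable[OF assms(2)],
      rule integral_le) (auto intro: slice_integrable assms)

lemma content_cell: "Henstock_Kurzweil_Integration.content cell = 1"
proof -
  have "cell \<noteq> {}" using zero_in_cell by blast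
  then show ?thesis by (simp add: content_cbox_cart)
qed

lemma slab_int_abs_le:
  assumes "continuous_on (slab t) f" "\<And>p. p \<in> slab t \<Longrightarrow> \<bar>f p\<bar> \<le> M" "0 \<le> t"
  shows "\<bar>slab_int t f\<bar> \<le> t * M"
proof -
  have c: "slab_int t (\<lambda>_. K) = t * K" for K using assms(3) by (simp add: slab_int_def content_cell)
  have b: "f p \<le> M" "- M \<le> f p" if "p \<in> slab t" for p using assms(2)[OF that] by simp_all
  have "slab_int t f \<le> slab_int t (\<lambda>_. M)" "slab_int t (\<lambda>_. - M) \<le> slab_int t f"
    by (intro slab_int_mono assms(1) continuous_on_const b; assumption)+
  then show ?thesis unfolding c by (simp add: abs_le_iff)
qed

lemma continuous_on_componentwise_cart:
  fixes f :: "'a::topological_space \<Rightarrow> real^'n"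
  assumes "\<And>i. continuous_on S (\<lambda>p. f p $ i)"
  shows "continuous_on S f"
  using continuous_on_vec_lambda[of S "\<lambda>i p. f p $ i", OF assms] by (simp add: vec_lambda_eta)

lemma vec10_continuous:
  assumes "continuous_on S a" "continuous_on S b" "continuous_on S c" "continuous_on S d"
  shows "continuous_on S (\<lambda>p. vec10 (a p) (b p) (c p) (d p))"
proof (rule continuous_on_componentwise_cart)
  fix i :: i10
  show "continuous_on S (\<lambda>p. vec10 (a p) (b p) (c p) (d p) $ i)"
  proof -
    consider k where "i = Inl k" | k where "i = Inr (Inl k)" | k where "i = Inr (Inr (Inl k))"
      | k where "i = Inr (Inr (Inr k))" by (metis sum.exhaust)
    then show ?thesis using assms by cases (auto intro!: continuous_on_component)
  qed
qed

context
  fixes T :: real assumes T: "0 < T"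
begin

lemma grad_continuous: "f \<in> C1_slab T \<Longrightarrow> continuous_on (slab T) (grad f)"
  unfolding grad_def by (intro continuous_on_vec_lambda C1_dx_continuous T)

lemma div_vec_continuous: "f \<in> C1_slab T \<Longrightarrow> continuous_on (slab T) (div_vec f)"
  unfolding div_vec_def by (intro continuous_intros C1_dx_continuous T)

lemma dir_deriv_continuous:
  "continuous_on (slab T) a \<Longrightarrow> f \<in> C1_slab T \<Longrightarrow> continuous_on (slab T) (\<lambda>p. dir_deriv (a p) f p)"
  unfolding dir_deriv_def by (intro continuous_intros C1_dx_continuous T)

lemma curl_continuous: "f \<in> C1_slab T \<Longrightarrow> continuous_on (slab T) (curl f)"
proof (rule continuous_on_componentwise_cart)
  fix i :: 3 assume f: "f \<in> C1_slab T"
  have "continuous_on (slab T) (\<lambda>p. dx j f p $ k - dx k f p $ j)" for j k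
    by (intro continuous_intros C1_dx_continuous T f)
  then show "continuous_on (slab T) (\<lambda>p. curl f p $ i)"
    using exhaust_3[of i] by (auto simp: curl_def)
qed

lemma L_op_continuous:
  assumes "hs \<in> C1_slab T" "\<And>p. p \<in> slab T \<Longrightarrow> hs p > 0" "bs \<in> C1_slab T" "ds \<in> C1_slab T" "vs \<in> C1_slab T"
  shows "continuous_on (slab T) (L_op T hs bs ds vs)"
proof -
  have s: "(\<lambda>q. inverse (hs q)) \<in> C1_slab T"
  proof (rule C1_inverse(1)[OF assms(1) _ T])
    show "hs p \<noteq> 0" if "p \<in> slab T" for p using assms(2)[OF that] by simp
  qed
  note c = C1_continuous[OF s] C1_continuous[OF assms(3)] C1_continuous[OF assms(4)] C1_continuous[OF assms(5)]
  show ?thesis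
    unfolding L_op_def Let_def
    by (intro vec10_continuous continuous_intros c dir_deriv_continuous curl_continuous grad_continuous
      div_vec_continuous C1_dt_continuous s assms(3-5) T)
qed

lemma Qr_mat_form_continuous:
  assumes "continuous_on (slab T) a" "continuous_on (slab T) b" "continuous_on (slab T) c" "continuous_on (slab T) d"
    "bs \<in> C1_slab T" "ds \<in> C1_slab T" "vs \<in> C1_slab T"
  shows "continuous_on (slab T) (\<lambda>p. vec10 (a p) (b p) (c p) (d p) \<bullet> (Qr_mat r bs ds vs p *v vec10 (a p) (b p) (c p) (d p)))"
  unfolding Qr_mat_form
  by (intro continuous_intros bounded_bilinear.continuous_on[OF bounded_bilinear_cross3] assms(1-4)
    dir_deriv_continuous curl_continuous div_vec_continuous assms(5-7))

end

lemma cell_integral_div_vec_zero: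
  assumes f: "f \<in> C1_slab T" and T: "0 < T" and t: "t \<in> {0..T}"
  shows "cell_integral (\<lambda>x. div_vec f (t, x)) = 0"
proof -
  note comp = C1_linear[OF bounded_linear_vec_nth f T]
  have eq: "dx i f (t, x) $ i = dx i (\<lambda>q. f q $ i) (t, x)" for i x
    using comp(2)[of "(t, x)" i i] t by simp
  have "cell_integral (\<lambda>x. div_vec f (t, x)) = (\<Sum>i\<in>UNIV. cell_integral (\<lambda>x. dx i (\<lambda>q. f q $ i) (t, x)))"
    unfolding div_vec_def eq
    by (rule integral_sum) (auto intro: slice_integrable[OF C1_dx_continuous[OF comp(1) T]] t)
  then show ?thesis using cell_integral_dx_zero[OF comp(1) T t] by simp
qed

lemma slab_density_eq: "slab_density T g F = slab_int T (\<lambda>p. g p \<bullet> F p)"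
  by (simp add: slab_density_def times_fun_def time_measure_def lebesgue_torus_def slab_int_def)

lemma torus_density_eq: "torus_density g f = cell_integral (\<lambda>x. g x \<bullet> f x)"
  by (simp add: torus_density_def times_fun_def lebesgue_torus_def)

lemma slab_integral_slab_int:
  fixes w f :: "real \<times> (real^3) \<Rightarrow> 'b::euclidean_space"
  assumes "\<And>F. continuous_on (slab T) F \<Longrightarrow> W F = slab_int T (\<lambda>p. w p \<bullet> F p)"
    and "continuous_on (slab T) w" "continuous_on (slab t) f" "t \<in> {0..T}"
  shows "slab_integral 0 t W f = slab_int t (\<lambda>p. w p \<bullet> f p)"
  using slab_integral_density[OF assms(1)[unfolded slab_int_def] assms(2-4)] by (simp add: slab_int_def)

lemma slab_int_dt:
  assumes "f \<in> C1_slab T" "0 < T" "t \<in> {0..T}"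
  shows "slab_int t (dt T f) = cell_integral (\<lambda>x. f (t, x)) - cell_integral (\<lambda>x. f (0, x))"
  using time_integral_dt[OF assms] by (simp add: slab_int_def)

definition vec4 :: "real \<Rightarrow> real^3 \<Rightarrow> real^i4" where
  "vec4 a b = (\<chi> i. case i of Inl _ \<Rightarrow> a | Inr j \<Rightarrow> b $ j)"

lemma inner_vec4: "vec4 a b \<bullet> A = a * A $ Inl 1 + b \<bullet> (\<chi> j. A $ Inr j)"
  by (simp add: inner_vec_def sum_UNIV_Plus sum_UNIV_1 vec4_def)

lemma norm_vec4: "(norm (vec4 a b))\<^sup>2 = a * a + b \<bullet> b"
  unfolding power2_norm_eq_inner inner_vec4 by (simp add: vec4_def inner_vec_def)

lemma vec4_continuous:
  assumes "continuous_on S a" "continuous_on S b"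
  shows "continuous_on S (\<lambda>p. vec4 (a p) (b p))"
proof (rule continuous_on_componentwise_cart)
  fix i :: i4
  show "continuous_on S (\<lambda>p. vec4 (a p) (b p) $ i)"
    using assms by (cases i) (auto simp: vec4_def intro!: continuous_on_component)
qed

lemma cell_integrable: "continuous_on cell f \<Longrightarrow> f integrable_on cell" for f :: "real^3 \<Rightarrow> real"
  by (rule integrable_continuous)

text \<open>
  The relative fields have density h times a difference of states, for example \<open>1 - h / hs
  = h (1 / h - 1 / hs)\<close>.
\<close>
lemma classical_U_tilde:
  fixes h :: "real \<times> (real^3) \<Rightarrow> real"
  assumes h: "continuous_on (slab T) h" "\<And>p. p \<in> slab T \<Longrightarrow> h p > 0" and B: "continuous_on (slab T) B"
    and hs: "continuous_on (slab T) hs" "\<And>p. p \<in> slab T \<Longrightarrow> hs p > 0" and bs: "continuous_on (slab T) bs"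
    and t: "t \<in> {0..T}" and A: "continuous_on UNIV A"
  shows "U_tilde (\<lambda>t. torus_density (\<lambda>x. h (t, x))) (\<lambda>t. torus_density (\<lambda>x. B (t, x))) hs bs t A
    = cell_integral (\<lambda>x. h (t, x) * (vec4 (inverse (h (t, x)) - inverse (hs (t, x))) (B (t, x) /\<^sub>R h (t, x) - bs (t, x)) \<bullet> A x))"
proof -
  let ?A1 = "\<lambda>x. A x $ Inl 1" and ?A2 = "\<lambda>x. \<chi> j. A x $ Inr j"
  have A1: "continuous_on cell ?A1" by (intro continuous_intros continuous_on_subset[OF A]) auto
  have A2: "continuous_on cell ?A2" by (intro continuous_intros continuous_on_subset[OF A]) auto
  have hh: "continuous_on cell (\<lambda>x. h (t, x))" and hhs: "continuous_on cell (\<lambda>x. hs (t, x))"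
    and BB: "continuous_on cell (\<lambda>x. B (t, x))" and bbs: "continuous_on cell (\<lambda>x. bs (t, x))"
    using h(1) hs(1) B bs t by (auto intro: slice_continuous)
  have pos: "hs (t, x) \<noteq> 0" "h (t, x) \<noteq> 0" for x using h(2)[of "(t, x)"] hs(2)[of "(t, x)"] t by auto
  have i: "?A1 integrable_on cell" "(\<lambda>x. h (t, x) * (inverse (hs (t, x)) * ?A1 x)) integrable_on cell"
    "(\<lambda>x. B (t, x) \<bullet> ?A2 x) integrable_on cell" "(\<lambda>x. h (t, x) * (bs (t, x) \<bullet> ?A2 x)) integrable_on cell"
    by (intro cell_integrable continuous_intros A1 A2 hh hhs BB bbs ballI pos)+
  have "U_tilde (\<lambda>t. torus_density (\<lambda>x. h (t, x))) (\<lambda>t. torus_density (\<lambda>x. B (t, x))) hs bs t A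
     = cell_integral ?A1 - cell_integral (\<lambda>x. h (t, x) * (inverse (hs (t, x)) * ?A1 x))
     + (cell_integral (\<lambda>x. B (t, x) \<bullet> ?A2 x) - cell_integral (\<lambda>x. h (t, x) * (bs (t, x) \<bullet> ?A2 x)))"
    by (simp add: U_tilde_def meas4_def minus_fn_def times_fun_def torus_density_eq lebesgue_torus_def)
  also have "\<dots> = cell_integral (\<lambda>x. (?A1 x - h (t, x) * (inverse (hs (t, x)) * ?A1 x))
      + (B (t, x) \<bullet> ?A2 x - h (t, x) * (bs (t, x) \<bullet> ?A2 x)))"
    by (simp add: integral_add integral_diff integrable_diff i)
  also have "\<dots> = cell_integral (\<lambda>x. h (t, x) * (vec4 (inverse (h (t, x)) - inverse (hs (t, x))) (B (t, x) /\<^sub>R h (t, x) - bs (t, x)) \<bullet> A x))"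
  proof (rule integral_cong)
    fix x
    have c: "h (t, x) * (inverse (h (t, x)) * z) = z" for z
      using pos(2) by (simp add: mult.assoc[symmetric])
    show "(?A1 x - h (t, x) * (inverse (hs (t, x)) * ?A1 x)) + (B (t, x) \<bullet> ?A2 x - h (t, x) * (bs (t, x) \<bullet> ?A2 x))
      = h (t, x) * (vec4 (inverse (h (t, x)) - inverse (hs (t, x))) (B (t, x) /\<^sub>R h (t, x) - bs (t, x)) \<bullet> A x)"
      unfolding inner_vec4 by (simp add: algebra_simps inner_diff_left c)
  qed
  finally show ?thesis .
qed

lemma classical_W_tilde:
  fixes h :: "real \<times> (real^3) \<Rightarrow> real"
  assumes h: "continuous_on (slab T) h" "\<And>p. p \<in> slab T \<Longrightarrow> h p > 0"
    and B: "continuous_on (slab T) B" and D: "continuous_on (slab T) D" and P: "continuous_on (slab T) P"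
    and hs: "continuous_on (slab T) hs" "\<And>p. p \<in> slab T \<Longrightarrow> hs p > 0" and bs: "continuous_on (slab T) bs"
    and ds: "continuous_on (slab T) ds" and vs: "continuous_on (slab T) vs"
    and F: "continuous_on (slab T) F"
  shows "W_tilde T (\<lambda>t. torus_density (\<lambda>x. h (t, x))) (\<lambda>t. torus_density (\<lambda>x. B (t, x))) (slab_density T D) (slab_density T P) hs bs ds vs F
    = slab_int T (\<lambda>p. (h p *\<^sub>R vec10 (inverse (h p) - inverse (hs p)) (B p /\<^sub>R h p - bs p) (D p /\<^sub>R h p - ds p) (P p /\<^sub>R h p - vs p)) \<bullet> F p)"
proof -
  let ?F1 = "\<lambda>p. (\<chi> i. case i of Inl u \<Rightarrow> F p $ Inl u | Inr j \<Rightarrow> F p $ Inr (Inl j)) :: real^i4"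
  let ?F2 = "\<lambda>p. \<chi> j. F p $ Inr (Inr (Inl j))" and ?F3 = "\<lambda>p. \<chi> j. F p $ Inr (Inr (Inr j))"
  let ?u = "\<lambda>p. vec4 (inverse (h p) - inverse (hs p)) (B p /\<^sub>R h p - bs p)"
  have F1: "continuous_on (slab T) ?F1"
  proof (rule continuous_on_vec_lambda)
    show "continuous_on (slab T) (\<lambda>p. case i of Inl u \<Rightarrow> F p $ Inl u | Inr j \<Rightarrow> F p $ Inr (Inl j))" for i :: i4
      using F by (cases i) (auto intro!: continuous_intros)
  qed
  have F2: "continuous_on (slab T) ?F2" and F3: "continuous_on (slab T) ?F3"
    by (intro continuous_intros F)+
  have pos: "h p \<noteq> 0" "hs p \<noteq> 0" if "p \<in> slab T" for p using h(2)[OF that] hs(2)[OF that] by auto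
  have uF: "continuous_on (slab T) (\<lambda>p. h p * (?u p \<bullet> ?F1 p))"
    using pos by (intro continuous_intros vec4_continuous h(1) B hs(1) bs F1) auto
  have DF: "continuous_on (slab T) (\<lambda>p. D p \<bullet> ?F2 p)" "continuous_on (slab T) (\<lambda>p. h p * (ds p \<bullet> ?F2 p))"
    and PF: "continuous_on (slab T) (\<lambda>p. P p \<bullet> ?F3 p)" "continuous_on (slab T) (\<lambda>p. h p * (vs p \<bullet> ?F3 p))"
    by (intro continuous_intros D P h(1) ds vs F2 F3)+
  have 1: "time_measure T (U_tilde (\<lambda>t. torus_density (\<lambda>x. h (t, x))) (\<lambda>t. torus_density (\<lambda>x. B (t, x))) hs bs) ?F1
      = slab_int T (\<lambda>p. h p * (?u p \<bullet> ?F1 p))"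
    unfolding time_measure_def slab_int_def
    by (rule integral_cong, rule classical_U_tilde[OF h B hs bs]) (auto intro: slice_continuous[OF F1])
  have 2: "time_measure T (\<lambda>t. torus_density (\<lambda>x. h (t, x))) G = slab_int T (\<lambda>p. h p * G p)" for G
    by (simp add: time_measure_def torus_density_eq slab_int_def)
  have "W_tilde T (\<lambda>t. torus_density (\<lambda>x. h (t, x))) (\<lambda>t. torus_density (\<lambda>x. B (t, x))) (slab_density T D) (slab_density T P) hs bs ds vs F
    = slab_int T (\<lambda>p. h p * (?u p \<bullet> ?F1 p)) + (slab_int T (\<lambda>p. D p \<bullet> ?F2 p) - slab_int T (\<lambda>p. h p * (ds p \<bullet> ?F2 p)))
      + (slab_int T (\<lambda>p. P p \<bullet> ?F3 p) - slab_int T (\<lambda>p. h p * (vs p \<bullet> ?F3 p)))"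
    unfolding W_tilde_def meas10_def minus_fn_def times_fun_def 1 2 slab_density_eq ..
  also have "\<dots> = slab_int T (\<lambda>p. h p * (?u p \<bullet> ?F1 p) + (D p \<bullet> ?F2 p - h p * (ds p \<bullet> ?F2 p)) + (P p \<bullet> ?F3 p - h p * (vs p \<bullet> ?F3 p)))"
    by (simp only: slab_int_add slab_int_diff continuous_on_add continuous_on_diff uF DF PF)
  also have "\<dots> = slab_int T (\<lambda>p. (h p *\<^sub>R vec10 (inverse (h p) - inverse (hs p)) (B p /\<^sub>R h p - bs p) (D p /\<^sub>R h p - ds p) (P p /\<^sub>R h p - vs p)) \<bullet> F p)"
  proof (rule slab_int_cong)
    fix p assume p: "p \<in> slab T"
    obtain a b c d where Fp: "F p = vec10 a b c d" by (rule vec10_exhaust)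
    have c: "h p * (inverse (h p) * z) = z" for z
      using pos(1)[OF p] by (simp add: mult.assoc[symmetric])
    show "h p * (?u p \<bullet> ?F1 p) + (D p \<bullet> ?F2 p - h p * (ds p \<bullet> ?F2 p)) + (P p \<bullet> ?F3 p - h p * (vs p \<bullet> ?F3 p))
      = (h p *\<^sub>R vec10 (inverse (h p) - inverse (hs p)) (B p /\<^sub>R h p - bs p) (D p /\<^sub>R h p - ds p) (P p /\<^sub>R h p - vs p)) \<bullet> F p"
      unfolding Fp inner_vec4 inner_scaleR_left inner_vec10
      by (simp add: vec_lambda_eta algebra_simps inner_diff_left c)
  qed
  finally show ?thesis .
qed

section \<open>The energy inequality for classical solutions\<close>

lemma classical_DMHD_D:
  assumes "classical_DMHD T h B D P"
  shows "h \<in> C1_slab T" "B \<in> C1_slab T" "D \<in> C1_slab T" "P \<in> C1_slab T"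
    "\<And>p. p \<in> slab T \<Longrightarrow> h p > 0" "\<And>p. p \<in> slab T \<Longrightarrow> div_vec B p = 0"
  using assms unfolding classical_DMHD_def Let_def by blast+

lemma relative_fields_C1:
  assumes cl: "classical_DMHD T h B D P" and T: "0 < T"
    and hs: "hs \<in> C1_slab T" "\<And>p. p \<in> slab T \<Longrightarrow> hs p > 0"
  shows "(\<lambda>q. inverse (h q) - inverse (hs q)) \<in> C1_slab T"
    and "bs \<in> C1_slab T \<Longrightarrow> (\<lambda>q. B q /\<^sub>R h q - bs q) \<in> C1_slab T"
    and "ds \<in> C1_slab T \<Longrightarrow> (\<lambda>q. D q /\<^sub>R h q - ds q) \<in> C1_slab T"
    and "vs \<in> C1_slab T \<Longrightarrow> (\<lambda>q. P q /\<^sub>R h q - vs q) \<in> C1_slab T"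
proof -
  note c = classical_solves_L_op(1-4)[OF cl T]
  have "(\<lambda>q. inverse (hs q)) \<in> C1_slab T"
  proof (rule C1_inverse(1)[OF hs(1) _ T])
    show "hs p \<noteq> 0" if "p \<in> slab T" for p using hs(2)[OF that] by simp
  qed
  then show "(\<lambda>q. inverse (h q) - inverse (hs q)) \<in> C1_slab T"
    by (rule C1_diff(1)[OF c(1) _ T])
  show "bs \<in> C1_slab T \<Longrightarrow> (\<lambda>q. B q /\<^sub>R h q - bs q) \<in> C1_slab T"
    by (rule C1_diff(1)[OF c(2) _ T])
  show "ds \<in> C1_slab T \<Longrightarrow> (\<lambda>q. D q /\<^sub>R h q - ds q) \<in> C1_slab T"
    by (rule C1_diff(1)[OF c(3) _ T])
  show "vs \<in> C1_slab T \<Longrightarrow> (\<lambda>q. P q /\<^sub>R h q - vs q) \<in> C1_slab T"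
    by (rule C1_diff(1)[OF c(4) _ T])
qed

lemma slice_C_torus:
  assumes "f \<in> C_slab {0..T}" "t \<in> {0..T}"
  shows "(\<lambda>x. f (t, x)) \<in> C_torus"
  using assms slice_continuous[of 0 T f t UNIV] by (auto simp: C_slab_def C_torus_def)

text \<open>
  Pointwise the constraint gives \<open>a + u \<bullet> A \<le> |u|\<^sup>2 / 2\<close> with
  equality for \<open>A = u\<close>, \<open>a = - |u|\<^sup>2 / 2\<close>; as u is continuous
  and periodic, this choice is admissible and the supremum is attained.
\<close>
lemma Lambda_density:
  fixes g :: "real^3 \<Rightarrow> real" and u :: "real^3 \<Rightarrow> real^i4"
  assumes g: "continuous_on UNIV g" "\<And>x. g x > 0" and u: "u \<in> C_torus"
    and U: "\<And>A. A \<in> C_torus \<Longrightarrow> U A = cell_integral (\<lambda>x. g x * (u x \<bullet> A x))"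
  shows "Lambda (torus_density g) U = ereal (cell_integral (\<lambda>x. g x * ((norm (u x))\<^sup>2 / 2)))"
    (is "_ = ereal ?E")
proof -
  have uc: "continuous_on UNIV u" and per: "u (x + axis i 1) = u x" for x i
    using u by (auto simp: C_torus_def)
  have gc': "continuous_on cell g" and uc': "continuous_on cell u"
    using g(1) uc by (auto intro: continuous_on_subset)
  have form: "torus_density g a + U A = cell_integral (\<lambda>x. g x * (a x + u x \<bullet> A x))"
    if aA: "a \<in> C_torus" "A \<in> C_torus" for a A
  proof -
    have cont: "continuous_on cell a" "continuous_on cell A"
      using aA by (auto simp: C_torus_def intro: continuous_on_subset)
    have "torus_density g a + U A = cell_integral (\<lambda>x. g x * a x) + cell_integral (\<lambda>x. g x * (u x \<bullet> A x))"
      by (simp add: torus_density_eq U[OF aA(2)])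
    also have "\<dots> = cell_integral (\<lambda>x. g x * a x + g x * (u x \<bullet> A x))"
      by (subst integral_add) (auto intro!: cell_integrable continuous_intros gc' uc' cont)
    finally show ?thesis by (simp add: distrib_left)
  qed
  show ?thesis
  proof (rule antisym)
    show "Lambda (torus_density g) U \<le> ereal ?E"
      unfolding Lambda_def
    proof (rule SUP_least, clarify)
      fix a and A :: "real^3 \<Rightarrow> real^i4"
      assume aA: "a \<in> C_torus" "A \<in> C_torus" "\<forall>x. a x + (norm (A x))\<^sup>2 / 2 \<le> 0"
      have cont: "continuous_on cell a" "continuous_on cell A"
        using aA by (auto simp: C_torus_def intro: continuous_on_subset)
      have "cell_integral (\<lambda>x. g x * (a x + u x \<bullet> A x)) \<le> ?E"
      proof (rule integral_le)
        show "(\<lambda>x. g x * (a x + u x \<bullet> A x)) integrable_on cell"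
          "(\<lambda>x. g x * ((norm (u x))\<^sup>2 / 2)) integrable_on cell"
          by (auto intro!: cell_integrable continuous_intros gc' uc' cont)
        fix x
        have "u x \<bullet> A x \<le> (norm (u x))\<^sup>2 / 2 + (norm (A x))\<^sup>2 / 2"
          using norm_cauchy_schwarz[of "u x" "A x"] sum_squares_bound[of "norm (u x)" "norm (A x)"] by argo
        then have "a x + u x \<bullet> A x \<le> (norm (u x))\<^sup>2 / 2" using aA(3)[rule_format, of x] by linarith
        then show "g x * (a x + u x \<bullet> A x) \<le> g x * ((norm (u x))\<^sup>2 / 2)"
          using g(2)[of x] by (intro mult_left_mono) auto
      qed
      then show "ereal (torus_density g a + U A) \<le> ereal ?E"
        unfolding form[OF aA(1,2)] by simp
    qed
    let ?a = "\<lambda>x. - ((norm (u x))\<^sup>2 / 2)"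
    have a: "?a \<in> C_torus"
      unfolding C_torus_def by (auto simp: per intro!: continuous_intros uc)
    have "(?a, u) \<in> {(a, A). a \<in> C_torus \<and> A \<in> C_torus \<and> (\<forall>x. a x + (norm (A x))\<^sup>2 / 2 \<le> 0)}"
      using a u by simp
    from SUP_upper[OF this, of "\<lambda>(a, A). ereal (torus_density g a + U A)"]
    have "ereal (torus_density g ?a + U u) \<le> Lambda (torus_density g) U" by (simp add: Lambda_def)
    moreover have "torus_density g ?a + U u = ?E"
      unfolding form[OF a u] by (rule integral_cong) (simp add: power2_norm_eq_inner)
    ultimately show "ereal ?E \<le> Lambda (torus_density g) U" by simp
  qed
qed

lemma vec4_C_torus: "a \<in> C_torus \<Longrightarrow> b \<in> C_torus \<Longrightarrow> (\<lambda>x. vec4 (a x) (b x)) \<in> C_torus"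
  by (auto simp: C_torus_def intro: vec4_continuous)

lemma classical_Lambda_eq:
  assumes cl: "classical_DMHD T h B D P" and T: "0 < T" and t: "t \<in> {0..T}"
    and hs: "hs \<in> C1_slab T" "\<And>p. p \<in> slab T \<Longrightarrow> hs p > 0" and bs: "bs \<in> C1_slab T"
  defines "\<alpha> \<equiv> \<lambda>q. inverse (h q) - inverse (hs q)" and "\<beta> \<equiv> \<lambda>q. B q /\<^sub>R h q - bs q"
  shows "Lambda (torus_density (\<lambda>x. h (t, x))) (U_tilde (\<lambda>t. torus_density (\<lambda>x. h (t, x))) (\<lambda>t. torus_density (\<lambda>x. B (t, x))) hs bs t)
    = ereal (cell_integral (\<lambda>x. h (t, x) * ((\<alpha> (t, x) * \<alpha> (t, x) + \<beta> (t, x) \<bullet> \<beta> (t, x)) / 2)))"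
  unfolding norm_vec4[symmetric]
proof (rule Lambda_density)
  note cD = classical_DMHD_D[OF cl]
  note c = C1_continuous[OF cD(1)] C1_continuous[OF cD(2)] C1_continuous[OF hs(1)] C1_continuous[OF bs]
  have \<alpha>: "\<alpha> \<in> C1_slab T" and \<beta>: "\<beta> \<in> C1_slab T"
    unfolding \<alpha>_def \<beta>_def using relative_fields_C1[OF cl T hs] bs by blast+
  show "continuous_on UNIV (\<lambda>x. h (t, x))" by (rule slice_continuous[OF c(1) t])
  show "h (t, x) > 0" for x using cD(5) t by simp
  show "(\<lambda>x. vec4 (\<alpha> (t, x)) (\<beta> (t, x))) \<in> C_torus"
    by (intro vec4_C_torus slice_C_torus[OF C1_C_slab[OF \<alpha>] t] slice_C_torus[OF C1_C_slab[OF \<beta>] t])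
  fix A :: "real^3 \<Rightarrow> real^i4" assume "A \<in> C_torus"
  then have A: "continuous_on UNIV A" by (simp add: C_torus_def)
  show "U_tilde (\<lambda>t. torus_density (\<lambda>x. h (t, x))) (\<lambda>t. torus_density (\<lambda>x. B (t, x))) hs bs t A
    = cell_integral (\<lambda>x. h (t, x) * (vec4 (\<alpha> (t, x)) (\<beta> (t, x)) \<bullet> A x))"
    unfolding \<alpha>_def \<beta>_def by (rule classical_U_tilde[OF c(1) cD(5) c(2,3) hs(2) c(4) t A])
qed

text \<open>
  Only \<open>Lambda_tilde\<close> is estimated; the other terms are computed exactly, and the
  integrated relative energy identity makes the bounds add up to the relative energy at time 0.
\<close>
lemma classical_energy_inequality:
  assumes cl: "classical_DMHD T h B D P" and T: "0 < T" and t: "t \<in> {0..T}"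
    and vs: "vs \<in> C1_slab T" and bs: "bs \<in> C1_slab T" and ds: "ds \<in> C1_slab T"
    and hs: "hs \<in> C1_slab T" "\<And>p. p \<in> slab T \<Longrightarrow> hs p > 0"
    and r0: "\<And>p. p \<in> slab T \<Longrightarrow> loewner_le (mat 1) (Qr_mat r0 bs ds vs p)" and r: "r0 \<le> r"
  defines "H \<equiv> \<lambda>t. torus_density (\<lambda>x. h (t, x))" and "M \<equiv> \<lambda>t. torus_density (\<lambda>x. B (t, x))"
  shows "ereal (exp (- r * t)) * Lambda (H t) (U_tilde H M hs bs t) +
     Lambda_tilde (time_measure T H) (W_tilde T H M (slab_density T D) (slab_density T P) hs bs ds vs)
       (\<lambda>p. exp (- r * fst p) *\<^sub>R Qr_mat r bs ds vs p) 0 t +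
     ereal (slab_integral 0 t (W_tilde T H M (slab_density T D) (slab_density T P) hs bs ds vs)
       (\<lambda>p. exp (- r * fst p) *\<^sub>R L_op T hs bs ds vs p))
     \<le> Lambda (H 0) (U_tilde H M hs bs 0)"
proof -
  note cD = classical_DMHD_D[OF cl]
  define \<alpha> where "\<alpha> = (\<lambda>q. inverse (h q) - inverse (hs q))"
  define \<beta> where "\<beta> = (\<lambda>q. B q /\<^sub>R h q - bs q)"
  define \<delta> where "\<delta> = (\<lambda>q. D q /\<^sub>R h q - ds q)"
  define \<pi> where "\<pi> = (\<lambda>q. P q /\<^sub>R h q - vs q)"
  define w where "w = (\<lambda>q. vec10 (\<alpha> q) (\<beta> q) (\<delta> q) (\<pi> q))"
  define e where "e = (\<lambda>q. h q * ((\<alpha> q * \<alpha> q + \<beta> q \<bullet> \<beta> q) / 2))"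
  obtain G where G: "e \<in> C1_slab T" "G \<in> C1_slab T"
    "\<And>p. p \<in> slab T \<Longrightarrow> dt T e p + h p * (w p \<bullet> L_op T hs bs ds vs p)
       + h p * (w p \<bullet> (Qr_mat 0 bs ds vs p *v w p)) / 2 = div_vec G p"
    by (rule relative_energy_identity[OF cl T hs bs ds vs, folded \<alpha>_def \<beta>_def \<delta>_def \<pi>_def])
      (auto simp: w_def e_def \<alpha>_def \<beta>_def \<delta>_def \<pi>_def)
  have "\<alpha> \<in> C1_slab T" "\<beta> \<in> C1_slab T" "\<delta> \<in> C1_slab T" "\<pi> \<in> C1_slab T"
    unfolding \<alpha>_def \<beta>_def \<delta>_def \<pi>_def using relative_fields_C1[OF cl T hs] bs ds vs by blast+
  note ac = this[THEN C1_continuous]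
  have wc: "continuous_on (slab T) w" unfolding w_def by (intro vec10_continuous ac)
  have hc: "continuous_on (slab T) h" by (rule C1_continuous[OF cD(1)])
  have Lc: "continuous_on (slab T) (L_op T hs bs ds vs)" by (rule L_op_continuous[OF T hs bs ds vs])
  have Qc: "continuous_on (slab T) (\<lambda>p. w p \<bullet> (Qr_mat r' bs ds vs p *v w p))" for r'
    unfolding w_def by (rule Qr_mat_form_continuous[OF T ac bs ds vs])
  have ec: "continuous_on (slab T) (\<lambda>p. exp (- r * fst p))" by (intro continuous_intros)
  define W where "W = W_tilde T H M (slab_density T D) (slab_density T P) hs bs ds vs"
  have W: "W F = slab_int T (\<lambda>p. (h p *\<^sub>R w p) \<bullet> F p)" if "continuous_on (slab T) F" for F
    unfolding W_def H_def M_def w_def \<alpha>_def \<beta>_def \<delta>_def \<pi>_def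
    by (rule classical_W_tilde[OF C1_continuous[OF cD(1)] cD(5) C1_continuous[OF cD(2)] C1_continuous[OF cD(3)]
      C1_continuous[OF cD(4)] C1_continuous[OF hs(1)] hs(2) C1_continuous[OF bs] C1_continuous[OF ds] C1_continuous[OF vs] that])
  have H: "time_measure T H F = slab_int T (\<lambda>p. h p \<bullet> F p)" for F
    by (simp add: time_measure_def H_def torus_density_eq slab_int_def)
  have sub: "slab t \<subseteq> slab T" using t by auto
  note hc' = continuous_on_subset[OF hc sub] and wc' = continuous_on_subset[OF wc sub]
    and ec' = continuous_on_subset[OF ec sub] and Lc' = continuous_on_subset[OF Lc sub]
    and Qc' = continuous_on_subset[OF Qc sub]
  have hwc: "continuous_on (slab T) (\<lambda>p. h p *\<^sub>R w p)" by (intro continuous_intros hc wc)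
  define X where "X = slab_int t (\<lambda>p. exp (- r * fst p) * (h p * (w p \<bullet> (Qr_mat r bs ds vs p *v w p)) / 2))"
  define Y where "Y = slab_int t (\<lambda>p. exp (- r * fst p) * (h p * (w p \<bullet> L_op T hs bs ds vs p)))"
  define E where "E = (\<lambda>s. cell_integral (\<lambda>x. e (s, x)))"
  have "slab_integral 0 t W (\<lambda>p. exp (- r * fst p) *\<^sub>R L_op T hs bs ds vs p)
      = slab_int t (\<lambda>p. (h p *\<^sub>R w p) \<bullet> (exp (- r * fst p) *\<^sub>R L_op T hs bs ds vs p))"
    by (intro slab_integral_slab_int[OF W hwc _ t] continuous_on_scaleR ec' Lc')
  then have Y: "slab_integral 0 t W (\<lambda>p. exp (- r * fst p) *\<^sub>R L_op T hs bs ds vs p) = Y"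
    by (simp add: Y_def mult_ac)
  have X: "Lambda_tilde (time_measure T H) W (\<lambda>p. exp (- r * fst p) *\<^sub>R Qr_mat r bs ds vs p) 0 t \<le> ereal X"
    unfolding Lambda_tilde_def
  proof (rule SUP_least, clarify)
    fix a :: "real \<times> (real^3) \<Rightarrow> real" and A :: "real \<times> (real^3) \<Rightarrow> real^i10"
    assume aA: "a \<in> C_slab {0..t}" "A \<in> C_slab {0..t}"
      and adm: "\<forall>p\<in>slab t. a p + (norm (mat_sqrt (matrix_inv (exp (- r * fst p) *\<^sub>R Qr_mat r bs ds vs p)) *v A p))\<^sup>2 / 2 \<le> 0"
    then have c: "continuous_on (slab t) a" "continuous_on (slab t) A" by (auto simp: C_slab_def)
    have "slab_integral 0 t (time_measure T H) a + slab_integral 0 t W A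
        = slab_int t (\<lambda>p. h p * a p) + slab_int t (\<lambda>p. (h p *\<^sub>R w p) \<bullet> A p)"
      using slab_integral_slab_int[OF H hc c(1) t] slab_integral_slab_int[OF W hwc c(2) t] by simp
    also have "\<dots> = slab_int t (\<lambda>p. h p * a p + (h p *\<^sub>R w p) \<bullet> A p)"
      by (rule slab_int_add[symmetric]) (intro continuous_intros hc' wc' c)+
    also have "\<dots> \<le> X"
      unfolding X_def
    proof (rule slab_int_mono)
      show "continuous_on (slab t) (\<lambda>p. h p * a p + (h p *\<^sub>R w p) \<bullet> A p)"
        by (intro continuous_intros hc' wc' c)
      show "continuous_on (slab t) (\<lambda>p. exp (- r * fst p) * (h p * (w p \<bullet> (Qr_mat r bs ds vs p *v w p)) / 2))"
        by (intro continuous_on_mult continuous_on_divide continuous_on_const hc' ec' Qc') auto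
      fix p assume p: "p \<in> slab t"
      then have pT: "p \<in> slab T" using sub by auto
      let ?c = "exp (- r * fst p)"
      let ?Q = "?c *\<^sub>R Qr_mat r bs ds vs p"
      have sym: "transpose ?Q = ?Q" by (simp add: transpose_scalar transpose_Qr_mat)
      have pd: "?c * (x \<bullet> x) \<le> x \<bullet> (?Q *v x)" for x
        using Qr_mat_mono[OF r0[OF pT] r, of x] by (simp add: scaleR_matrix_vector_assoc[symmetric])
      have "A p \<bullet> w p - (norm (mat_sqrt (matrix_inv ?Q) *v A p))\<^sup>2 / 2 \<le> (w p \<bullet> (?Q *v w p)) / 2"
        by (rule mat_sqrt_matrix_inv_bounds(2)[OF sym _ pd]) simp
      then have "a p + w p \<bullet> A p \<le> ?c * (w p \<bullet> (Qr_mat r bs ds vs p *v w p)) / 2"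
        using adm[rule_format, OF p] by (simp add: scaleR_matrix_vector_assoc[symmetric] inner_commute)
      then have "h p * (a p + w p \<bullet> A p) \<le> h p * (?c * (w p \<bullet> (Qr_mat r bs ds vs p *v w p)) / 2)"
        using cD(5)[OF pT] by (intro mult_left_mono) auto
      then show "h p * a p + (h p *\<^sub>R w p) \<bullet> A p \<le> ?c * (h p * (w p \<bullet> (Qr_mat r bs ds vs p *v w p)) / 2)"
        by (simp add: distrib_left mult_ac)
    qed
    finally show "ereal (slab_integral 0 t (time_measure T H) a + slab_integral 0 t W A) \<le> ereal X" by simp
  qed
  have Lam: "Lambda (H s) (U_tilde H M hs bs s) = ereal (E s)" if "s \<in> {0..T}" for s
    unfolding H_def M_def E_def e_def \<alpha>_def \<beta>_def by (rule classical_Lambda_eq[OF cl T that hs bs])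
  have balance: "exp (- r * t) * E t + X + Y = E 0"
  proof -
    have C1: "(\<lambda>q. exp (- r * fst q) * e q) \<in> C1_slab T"
      by (intro C1_mult(1) C1_exp_time(1) G(1) T)
    have "slab_int t (dt T (\<lambda>q. exp (- r * fst q) * e q)) = exp (- r * t) * E t - E 0"
      unfolding slab_int_dt[OF C1 T t] by (simp add: E_def)
    moreover have "slab_int t (dt T (\<lambda>q. exp (- r * fst q) * e q)) = slab_int t (\<lambda>p. exp (- r * fst p) * div_vec G p
        - exp (- r * fst p) * (h p * (w p \<bullet> L_op T hs bs ds vs p))
        - exp (- r * fst p) * (h p * (w p \<bullet> (Qr_mat r bs ds vs p *v w p)) / 2))"
    proof (rule slab_int_cong)
      fix p assume "p \<in> slab t"
      then have p: "p \<in> slab T" using sub by auto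
      have "w p \<bullet> (Qr_mat r bs ds vs p *v w p) = w p \<bullet> (Qr_mat 0 bs ds vs p *v w p) + r * (\<alpha> p * \<alpha> p + \<beta> p \<bullet> \<beta> p)"
        unfolding w_def Qr_mat_form by (simp add: power2_eq_square)
      then have Q: "h p * (w p \<bullet> (Qr_mat r bs ds vs p *v w p)) / 2 = h p * (w p \<bullet> (Qr_mat 0 bs ds vs p *v w p)) / 2 + r * e p"
        by (simp add: e_def field_simps)
      have dte: "dt T e p = div_vec G p - h p * (w p \<bullet> L_op T hs bs ds vs p) - h p * (w p \<bullet> (Qr_mat 0 bs ds vs p *v w p)) / 2"
        using G(3)[OF p] by linarith
      show "dt T (\<lambda>q. exp (- r * fst q) * e q) p = exp (- r * fst p) * div_vec G p
        - exp (- r * fst p) * (h p * (w p \<bullet> L_op T hs bs ds vs p))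
        - exp (- r * fst p) * (h p * (w p \<bullet> (Qr_mat r bs ds vs p *v w p)) / 2)"
        unfolding C1_mult(3)[OF C1_exp_time(1)[OF T] G(1) T p] C1_exp_time(2)[OF T p] dte Q
        by (simp only: right_diff_distrib distrib_left) (simp add: mult_ac)
    qed
    moreover have "\<dots> = slab_int t (\<lambda>p. exp (- r * fst p) * div_vec G p) - Y - X"
    proof -
      have c: "continuous_on (slab t) (\<lambda>p. exp (- r * fst p) * div_vec G p)"
        "continuous_on (slab t) (\<lambda>p. exp (- r * fst p) * (h p * (w p \<bullet> L_op T hs bs ds vs p)))"
        "continuous_on (slab t) (\<lambda>p. exp (- r * fst p) * (h p * (w p \<bullet> (Qr_mat r bs ds vs p *v w p)) / 2))"
        by (intro continuous_on_mult continuous_on_divide continuous_on_const continuous_on_inner hc' wc' ec' Lc' Qc'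
          continuous_on_subset[OF div_vec_continuous[OF T G(2)] sub]; simp)+
      show ?thesis unfolding X_def Y_def
        by (simp only: slab_int_diff continuous_on_diff c)
    qed
    moreover have "slab_int t (\<lambda>p. exp (- r * fst p) * div_vec G p) = 0"
    proof -
      have "integral {0..t} (\<lambda>s. cell_integral (\<lambda>x. exp (- r * s) * div_vec G (s, x))) = integral {0..t} (\<lambda>s. 0)"
        by (rule integral_cong) (use cell_integral_div_vec_zero[OF G(2) T] t in simp)
      then show ?thesis by (simp add: slab_int_def)
    qed
    ultimately show ?thesis by linarith
  qed
  have "ereal (exp (- r * t)) * Lambda (H t) (U_tilde H M hs bs t)
      + Lambda_tilde (time_measure T H) W (\<lambda>p. exp (- r * fst p) *\<^sub>R Qr_mat r bs ds vs p) 0 t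
      + ereal (slab_integral 0 t W (\<lambda>p. exp (- r * fst p) *\<^sub>R L_op T hs bs ds vs p))
    \<le> ereal (exp (- r * t) * E t) + ereal X + ereal Y"
    unfolding Lam[OF t] Y by (intro add_mono X order.refl) simp
  also have "\<dots> = Lambda (H 0) (U_tilde H M hs bs 0)"
    using balance Lam[of 0] T by simp
  finally show ?thesis unfolding W_def .
qed

section \<open>Classical solutions are dissipative\<close>

lemma C_slab_inner: "f \<in> C_slab I \<Longrightarrow> g \<in> C_slab I \<Longrightarrow> (\<lambda>p. f p \<bullet> g p) \<in> C_slab I"
  by (auto simp: C_slab_def intro: continuous_on_inner)

lemma C_torus_inner: "f \<in> C_torus \<Longrightarrow> g \<in> C_torus \<Longrightarrow> (\<lambda>p. f p \<bullet> g p) \<in> C_torus"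
  by (auto simp: C_torus_def intro: continuous_on_inner)

lemma C_slab_compose: 
  assumes "continuous_on UNIV F" "f \<in> C_slab I" shows "(\<lambda>p. F (f p)) \<in> C_slab I"
  using assms continuous_on_compose2[OF assms(1), of "I \<times> UNIV" f] by (auto simp: C_slab_def)

lemma C_torus_compose:
  assumes "continuous_on UNIV F" "f \<in> C_torus" shows "(\<lambda>p. F (f p)) \<in> C_torus"
  using assms continuous_on_compose2[OF assms(1), of UNIV f] by (auto simp: C_torus_def)

lemma cell_integral_abs_le:
  assumes "continuous_on cell f" "\<And>x. \<bar>f x\<bar> \<le> M"
  shows "\<bar>cell_integral f\<bar> \<le> M"
proof -
  have b: "f x \<le> M" "- M \<le> f x" for x using assms(2)[of x] by simp_all
  have c: "cell_integral (\<lambda>_. K) = K" "(\<lambda>_. K) integrable_on cell" for K :: real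
    by (simp_all add: content_cell integrable_const)
  have "cell_integral f \<le> cell_integral (\<lambda>_. M)" "cell_integral (\<lambda>_. - M) \<le> cell_integral f"
    by (intro integral_le cell_integrable[OF assms(1)] c(2) b)+
  then show ?thesis unfolding c(1) by (simp add: abs_le_iff)
qed

lemma torus_measure_density:
  fixes g :: "real^3 \<Rightarrow> 'b::euclidean_space"
  assumes g: "g \<in> C_torus"
  shows "torus_measure (torus_density g)"
proof -
  have c: "(\<lambda>x. g x \<bullet> f x) integrable_on cell" "continuous_on cell (\<lambda>x. g x \<bullet> f x)" if "f \<in> C_torus" for f
    using C_torus_inner[OF g that] by (auto simp: C_torus_def intro: continuous_on_subset intro!: cell_integrable)
  obtain N where N: "0 \<le> N" "\<And>x. norm (g x) \<le> N" by (rule C_torus_bounded[OF g]) blast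
  have "\<bar>torus_density g f\<bar> \<le> N * M" if "f \<in> C_torus" "\<forall>p\<in>UNIV. norm (f p) \<le> M" for f M
    unfolding torus_density_eq
  proof (rule cell_integral_abs_le[OF c(2)[OF that(1)]])
    fix x
    have "\<bar>g x \<bullet> f x\<bar> \<le> norm (g x) * norm (f x)" by (rule Cauchy_Schwarz_ineq2)
    also have "\<dots> \<le> N * M" using N that(2) by (intro mult_mono) auto
    finally show "\<bar>g x \<bullet> f x\<bar> \<le> N * M" .
  qed
  moreover have "torus_density g (\<lambda>p. f p + f' p) = torus_density g f + torus_density g f'"
    if "f \<in> C_torus" "f' \<in> C_torus" for f f'
    unfolding torus_density_eq inner_add_right by (rule integral_add[OF c(1)[OF that(1)] c(1)[OF that(2)]])
  moreover have "torus_density g (\<lambda>p. r *\<^sub>R f p) = r * torus_density g f" for r f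
    by (simp add: torus_density_eq)
  ultimately show ?thesis unfolding in_dual_def by blast
qed

lemma slab_measure_density:
  fixes g :: "real \<times> (real^3) \<Rightarrow> 'b::euclidean_space"
  assumes g: "g \<in> C_slab {0..T}" and T: "0 < T"
  shows "slab_measure T (slab_density T g)"
proof -
  have c: "continuous_on (slab T) (\<lambda>x. g x \<bullet> f x)" if "f \<in> C_slab {0..T}" for f
    using C_slab_inner[OF g that] by (simp add: C_slab_def)
  obtain N where N: "0 \<le> N" "\<And>p. p \<in> slab T \<Longrightarrow> norm (g p) \<le> N" by (rule C_slab_bounded[OF g]) blast
  have "\<bar>slab_density T g f\<bar> \<le> (T * N) * M" if "f \<in> C_slab {0..T}" "\<forall>p\<in>slab T. norm (f p) \<le> M" for f M
  proof -
    have "\<bar>slab_int T (\<lambda>p. g p \<bullet> f p)\<bar> \<le> T * (N * M)"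
    proof (rule slab_int_abs_le[OF c[OF that(1)]])
      fix p assume p: "p \<in> slab T"
      have "\<bar>g p \<bullet> f p\<bar> \<le> norm (g p) * norm (f p)" by (rule Cauchy_Schwarz_ineq2)
      also have "\<dots> \<le> N * M" using N(1) N(2)[OF p] that(2)[rule_format, OF p] by (intro mult_mono) auto
      finally show "\<bar>g p \<bullet> f p\<bar> \<le> N * M" .
    qed (use T in simp)
    then show ?thesis by (simp add: slab_density_eq mult_ac)
  qed
  moreover have "slab_density T g (\<lambda>p. f p + f' p) = slab_density T g f + slab_density T g f'"
    if "f \<in> C_slab {0..T}" "f' \<in> C_slab {0..T}" for f f'
    unfolding slab_density_eq inner_add_right by (rule slab_int_add[OF c[OF that(1)] c[OF that(2)]])
  moreover have "slab_density T g (\<lambda>p. r *\<^sub>R f p) = r * slab_density T g f" for r f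
    by (simp add: slab_density_eq slab_int_cmult)
  ultimately show ?thesis unfolding in_dual_def by blast
qed

lemma weak_star_continuous_density:
  fixes g :: "real \<times> (real^3) \<Rightarrow> 'b::euclidean_space"
  assumes g: "g \<in> C_slab {0..T}"
  shows "weak_star_continuous T (\<lambda>t. torus_density (\<lambda>x. g (t, x)))"
proof -
  have "continuous_on {0..T} (\<lambda>t. torus_density (\<lambda>x. g (t, x)) f)" if f: "f \<in> C_torus" for f
  proof -
    have "continuous_on ({0..T} \<times> UNIV) (\<lambda>p. f (snd p))"
      using f by (auto simp: C_torus_def intro!: continuous_on_compose2[of UNIV f] continuous_intros)
    then have "continuous_on ({0..T} \<times> UNIV) (\<lambda>p. g p \<bullet> f (snd p))"
      using g by (intro continuous_on_inner) (auto simp: C_slab_def)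
    from cell_integral_continuous[OF this] show ?thesis by (simp add: torus_density_eq)
  qed
  then show ?thesis
    unfolding weak_star_continuous_def using torus_measure_density[OF slice_C_torus[OF g]] by blast
qed

lemma C1_time_Lipschitz:
  assumes f: "f \<in> C1_slab T" and T: "0 < T"
  obtains L where "0 \<le> L" "\<And>s t x. s \<in> {0..T} \<Longrightarrow> t \<in> {0..T} \<Longrightarrow> norm (f (s, x) - f (t, x)) \<le> L * \<bar>s - t\<bar>"
proof -
  obtain L where L: "0 \<le> L" "\<And>p. p \<in> slab T \<Longrightarrow> norm (dt T f p) \<le> L"
    by (rule C_slab_bounded[OF C1_dt_C_slab[OF f T]]) blast
  show ?thesis
  proof (rule that[OF L(1)])
    fix s t x assume st: "s \<in> {0..T}" "t \<in> {0..T}"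
    have "norm (f (s, x) - f (t, x)) \<le> L * norm (s - t)"
    proof (rule differentiable_bound[where S = "{0..T}" and f = "\<lambda>s. f (s, x)" and f' = "\<lambda>s r. r *\<^sub>R dt T f (s, x)"])
      fix s assume "s \<in> {0..T}"
      then have p: "(s, x) \<in> slab T" by simp
      show "((\<lambda>s. f (s, x)) has_derivative (\<lambda>r. r *\<^sub>R dt T f (s, x))) (at s within {0..T})"
        using dt_eqI(1)[OF C1_has_derivative[OF f T p] p T] by (simp add: slab_diff_axis has_vector_derivative_def)
      show "onorm (\<lambda>r. r *\<^sub>R dt T f (s, x)) \<le> L"
      proof (rule onorm_le)
        fix r :: real
        have "\<bar>r\<bar> * norm (dt T f (s, x)) \<le> \<bar>r\<bar> * L" using L(2)[OF p] by (intro mult_left_mono) auto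
        then show "norm (r *\<^sub>R dt T f (s, x)) \<le> L * norm r" by (simp add: mult.commute)
      qed
    qed (use st in auto)
    then show "norm (f (s, x) - f (t, x)) \<le> L * \<bar>s - t\<bar>" by simp
  qed
qed

lemma norm_vec4_le: "norm (vec4 a b) \<le> \<bar>a\<bar> + norm b"
proof (rule power2_le_imp_le)
  have "(norm (vec4 a b))\<^sup>2 = a\<^sup>2 + (norm b)\<^sup>2"
    unfolding norm_vec4 by (simp add: power2_norm_eq_inner power2_eq_square[of a])
  also have "\<dots> \<le> (\<bar>a\<bar> + norm b)\<^sup>2" by (simp add: power2_sum)
  finally show "(norm (vec4 a b))\<^sup>2 \<le> (\<bar>a\<bar> + norm b)\<^sup>2" .
qed simp

lemma meas4_torus_density:
  assumes "g \<in> C_torus" "m \<in> C_torus" "A \<in> C_torus"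
  shows "meas4 (torus_density g) (torus_density m) A = cell_integral (\<lambda>x. vec4 (g x) (m x) \<bullet> A x)"
proof -
  have "continuous_on cell g" "continuous_on cell m" "continuous_on cell A"
    using assms by (auto simp: C_torus_def intro: continuous_on_subset)
  then have "cell_integral (\<lambda>x. g x * A x $ Inl 1 + m x \<bullet> (\<chi> j. A x $ Inr j))
     = cell_integral (\<lambda>x. g x * A x $ Inl 1) + cell_integral (\<lambda>x. m x \<bullet> (\<chi> j. A x $ Inr j))"
    by (intro integral_add cell_integrable continuous_intros)
  then show ?thesis by (simp add: meas4_def torus_density_eq inner_vec4)
qed

text \<open>
  The densities are Lipschitz in time since their time derivatives are bounded. The summability
  of the weighted norms of the test functions carries this over to the weak-star distance, and
  on an interval of length T a Lipschitz bound is a Hoelder bound with an additional factor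
  \<open>sqrt T\<close>.
\<close>
lemma classical_holder:
  assumes \<phi>: "test_family \<phi>" and cl: "classical_DMHD T h B D P" and T: "0 < T"
  shows "\<exists>C. holder_half_bounded \<phi> C T (\<lambda>t. meas4 (torus_density (\<lambda>x. h (t, x))) (torus_density (\<lambda>x. B (t, x))))"
proof -
  define \<mu> where "\<mu> = (\<lambda>t. meas4 (torus_density (\<lambda>x. h (t, x))) (torus_density (\<lambda>x. B (t, x))))"
  note cD = classical_DMHD_D[OF cl]
  define N where "N n = (SUP x. norm (\<phi> n x))" for n
  have "Ck_torus 0 (\<phi> n)" for n using \<phi> unfolding test_family_def by blast
  then have \<phi>C: "\<phi> n \<in> C_torus" for n by simp
  have sumN: "summable (\<lambda>n. (1/2)^n * N n)" using \<phi> unfolding test_family_def N_def by blast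
  have N: "norm (\<phi> n x) \<le> N n" for n x
  proof -
    obtain M where "\<And>x. norm (\<phi> n x) \<le> M" by (rule C_torus_bounded[OF \<phi>C]) blast
    then have "bdd_above (range (\<lambda>x. norm (\<phi> n x)))" by (auto simp: bdd_above_def)
    then show ?thesis unfolding N_def by (rule cSUP_upper[OF UNIV_I])
  qed
  obtain Lh where Lh: "0 \<le> Lh" "\<And>s t x. s \<in> {0..T} \<Longrightarrow> t \<in> {0..T} \<Longrightarrow> norm (h (s, x) - h (t, x)) \<le> Lh * \<bar>s - t\<bar>"
    by (rule C1_time_Lipschitz[OF cD(1) T]) blast
  obtain Lb where Lb: "0 \<le> Lb" "\<And>s t x. s \<in> {0..T} \<Longrightarrow> t \<in> {0..T} \<Longrightarrow> norm (B (s, x) - B (t, x)) \<le> Lb * \<bar>s - t\<bar>"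
    by (rule C1_time_Lipschitz[OF cD(2) T]) blast
  define L where "L = Lh + Lb"
  have L0: "0 \<le> L" using Lh(1) Lb(1) by (simp add: L_def)
  have diff: "\<bar>\<mu> s (\<phi> n) - \<mu> t (\<phi> n)\<bar> \<le> L * \<bar>s - t\<bar> * N n" if st: "s \<in> {0..T}" "t \<in> {0..T}" for s t n
  proof -
    let ?u = "\<lambda>s x. vec4 (h (s, x)) (B (s, x))"
    note hC = slice_C_torus[OF C1_C_slab[OF cD(1)]] and BC = slice_C_torus[OF C1_C_slab[OF cD(2)]]
    have c: "continuous_on cell (\<lambda>x. ?u s x \<bullet> \<phi> n x)" if "s \<in> {0..T}" for s
      using hC[OF that] BC[OF that] \<phi>C[of n]
      by (intro continuous_on_inner vec4_continuous) (auto simp: C_torus_def intro: continuous_on_subset)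
    have "\<mu> s (\<phi> n) - \<mu> t (\<phi> n) = cell_integral (\<lambda>x. ?u s x \<bullet> \<phi> n x - ?u t x \<bullet> \<phi> n x)"
      unfolding \<mu>_def meas4_torus_density[OF hC[OF st(1)] BC[OF st(1)] \<phi>C] meas4_torus_density[OF hC[OF st(2)] BC[OF st(2)] \<phi>C]
      by (rule integral_diff[symmetric]) (intro cell_integrable c st)+
    also have "\<bar>\<dots>\<bar> \<le> L * \<bar>s - t\<bar> * N n"
    proof (rule cell_integral_abs_le)
      show "continuous_on cell (\<lambda>x. ?u s x \<bullet> \<phi> n x - ?u t x \<bullet> \<phi> n x)" by (intro continuous_on_diff c st)
      fix x
      have "?u s x \<bullet> \<phi> n x - ?u t x \<bullet> \<phi> n x = vec4 (h (s, x) - h (t, x)) (B (s, x) - B (t, x)) \<bullet> \<phi> n x"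
        by (simp add: inner_vec4 algebra_simps inner_diff_left)
      also have "\<bar>\<dots>\<bar> \<le> norm (vec4 (h (s, x) - h (t, x)) (B (s, x) - B (t, x))) * norm (\<phi> n x)"
        by (rule Cauchy_Schwarz_ineq2)
      also have "\<dots> \<le> (L * \<bar>s - t\<bar>) * N n"
      proof (rule mult_mono)
        show "norm (vec4 (h (s, x) - h (t, x)) (B (s, x) - B (t, x))) \<le> L * \<bar>s - t\<bar>"
          using norm_vec4_le[of "h (s, x) - h (t, x)" "B (s, x) - B (t, x)"] Lh(2)[OF st, of x] Lb(2)[OF st, of x]
          by (simp add: L_def distrib_right)
      qed (use N L0 in auto)
      finally show "\<bar>?u s x \<bullet> \<phi> n x - ?u t x \<bullet> \<phi> n x\<bar> \<le> L * \<bar>s - t\<bar> * N n" .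
    qed
    finally show ?thesis .
  qed
  have frac_le: "0 \<le> x / (1 + x)" "x / (1 + x) \<le> 1" "x / (1 + x) \<le> x" if "0 \<le> x" for x :: real
    using that by (simp_all add: divide_simps) (simp add: distrib_left)
  have geo: "summable (\<lambda>n. (1/2::real)^n)" "(\<Sum>n. (1/2::real)^n) = 2"
    by (simp add: summable_geometric, simp add: suminf_geometric)
  have sumd: "summable (\<lambda>n. (1/2::real)^n * (\<bar>\<nu> (\<phi> n) - \<nu>' (\<phi> n)\<bar> / (1 + \<bar>\<nu> (\<phi> n) - \<nu>' (\<phi> n)\<bar>)))" for \<nu> \<nu>'
  proof (rule summable_comparison_test[OF _ geo(1)], intro exI allI impI)
    fix n
    have "(1/2)^n * (\<bar>\<nu> (\<phi> n) - \<nu>' (\<phi> n)\<bar> / (1 + \<bar>\<nu> (\<phi> n) - \<nu>' (\<phi> n)\<bar>)) \<le> (1/2)^n * 1"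
      by (intro mult_left_mono frac_le) auto
    then show "norm ((1/2)^n * (\<bar>\<nu> (\<phi> n) - \<nu>' (\<phi> n)\<bar> / (1 + \<bar>\<nu> (\<phi> n) - \<nu>' (\<phi> n)\<bar>))) \<le> (1/2)^n" by simp
  qed
  have le2: "weak_star_dist \<phi> \<nu> \<nu>' \<le> 2" for \<nu> \<nu>'
  proof -
    have "weak_star_dist \<phi> \<nu> \<nu>' \<le> (\<Sum>n. (1/2::real)^n)"
      unfolding weak_star_dist_def
    proof (rule suminf_le[OF _ sumd geo(1)])
      show "(1/2)^n * (\<bar>\<nu> (\<phi> n) - \<nu>' (\<phi> n)\<bar> / (1 + \<bar>\<nu> (\<phi> n) - \<nu>' (\<phi> n)\<bar>)) \<le> (1/2)^n" for n
        using mult_left_mono[OF frac_le(2)[of "\<bar>\<nu> (\<phi> n) - \<nu>' (\<phi> n)\<bar>"], of "(1/2)^n"] by simp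
    qed
    then show ?thesis by (simp only: geo(2))
  qed
  define S where "S = (\<Sum>n. (1/2)^n * N n)"
  have N0: "0 \<le> N n" for n using order.trans[OF norm_ge_zero N] .
  have S0: "0 \<le> S" unfolding S_def using sumN by (intro suminf_nonneg) (auto simp: N0)
  have dist: "weak_star_dist \<phi> (\<mu> s) (\<mu> t) \<le> L * \<bar>s - t\<bar> * S" if st: "s \<in> {0..T}" "t \<in> {0..T}" for s t
  proof -
    have "weak_star_dist \<phi> (\<mu> s) (\<mu> t) \<le> (\<Sum>n. (L * \<bar>s - t\<bar>) * ((1/2)^n * N n))"
      unfolding weak_star_dist_def
    proof (rule suminf_le[OF _ sumd summable_mult[OF sumN]])
      fix n
      have "(1/2)^n * (\<bar>\<mu> s (\<phi> n) - \<mu> t (\<phi> n)\<bar> / (1 + \<bar>\<mu> s (\<phi> n) - \<mu> t (\<phi> n)\<bar>)) \<le> (1/2)^n * (L * \<bar>s - t\<bar> * N n)"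
        by (intro mult_left_mono order.trans[OF frac_le(3) diff[OF st]]) auto
      then show "(1/2)^n * (\<bar>\<mu> s (\<phi> n) - \<mu> t (\<phi> n)\<bar> / (1 + \<bar>\<mu> s (\<phi> n) - \<mu> t (\<phi> n)\<bar>)) \<le> (L * \<bar>s - t\<bar>) * ((1/2)^n * N n)"
        by (simp only: mult_ac)
    qed
    also have "\<dots> = L * \<bar>s - t\<bar> * S" unfolding S_def by (rule suminf_mult[OF sumN])
    finally show ?thesis .
  qed
  have "holder_half_bounded \<phi> (max 2 (L * S * sqrt T)) T \<mu>"
    unfolding holder_half_bounded_def
  proof (intro conjI ballI)
    show "weak_star_dist \<phi> (\<mu> t) (\<lambda>_. 0) \<le> max 2 (L * S * sqrt T)" for t
      using le2[of "\<mu> t" "\<lambda>_. 0"] by simp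
    fix s t assume st: "s \<in> {0..T}" "t \<in> {0..T}"
    have "\<bar>s - t\<bar> = sqrt \<bar>s - t\<bar> * sqrt \<bar>s - t\<bar>" by simp
    also have "\<dots> \<le> sqrt T * sqrt \<bar>s - t\<bar>" using st by (intro mult_right_mono real_sqrt_le_mono) auto
    finally have "L * S * \<bar>s - t\<bar> \<le> L * S * (sqrt T * sqrt \<bar>s - t\<bar>)"
      using L0 S0 by (intro mult_left_mono) auto
    also have "\<dots> \<le> max 2 (L * S * sqrt T) * sqrt \<bar>s - t\<bar>"
      unfolding mult.assoc[symmetric] by (intro mult_right_mono) auto
    finally show "weak_star_dist \<phi> (\<mu> s) (\<mu> t) \<le> max 2 (L * S * sqrt T) * sqrt \<bar>s - t\<bar>"
      using dist[OF st] by (simp add: mult_ac)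
  qed
  then show ?thesis unfolding \<mu>_def by blast
qed

text \<open>
  By conservation of mass, \<open>h dt u + P \<bullet> grad u = dt (h u) + div (u P)\<close>;
  and \<open>B \<bullet> grad u = div (u B)\<close>.
\<close>
lemma classical_weak_equations:
  assumes cl: "classical_DMHD T h B D P" and T: "0 < T" and u: "u \<in> C1_slab T" and t: "t \<in> {0..T}"
  shows "slab_integral 0 t (time_measure T (\<lambda>t. torus_density (\<lambda>x. h (t, x)))) (dt T u) + slab_integral 0 t (slab_density T P) (grad u)
      = torus_density (\<lambda>x. h (t, x)) (\<lambda>x. u (t, x)) - torus_density (\<lambda>x. h (0, x)) (\<lambda>x. u (0, x))"
    and "torus_density (\<lambda>x. B (t, x)) (\<lambda>x. grad u (t, x)) = 0"
proof -
  note cD = classical_DMHD_D[OF cl]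
  have sub: "slab t \<subseteq> slab T" using t by auto
  have hc: "continuous_on (slab T) h" and Pc: "continuous_on (slab T) P"
    by (intro C1_continuous cD)+
  have gc: "continuous_on (slab T) (grad u)" by (rule grad_continuous[OF T u])
  have dc: "continuous_on (slab T) (dt T u)" by (rule C1_dt_continuous[OF u T])
  note c' = continuous_on_subset[OF hc sub] continuous_on_subset[OF Pc sub] continuous_on_subset[OF gc sub] continuous_on_subset[OF dc sub]
  have hu: "(\<lambda>q. h q * u q) \<in> C1_slab T" by (intro C1_mult(1) cD u T)
  have uP: "(\<lambda>q. u q *\<^sub>R P q) \<in> C1_slab T" by (intro C1_scaleR(1) cD u T)
  have 1: "slab_integral 0 t (time_measure T (\<lambda>t. torus_density (\<lambda>x. h (t, x)))) (dt T u) = slab_int t (\<lambda>p. h p \<bullet> dt T u p)"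
    by (rule slab_integral_slab_int[OF _ hc c'(4) t]) (simp add: time_measure_def torus_density_eq slab_int_def)
  have 2: "slab_integral 0 t (slab_density T P) (grad u) = slab_int t (\<lambda>p. P p \<bullet> grad u p)"
    by (rule slab_integral_slab_int[OF slab_density_eq Pc c'(3) t])
  have "slab_int t (\<lambda>p. h p \<bullet> dt T u p) + slab_int t (\<lambda>p. P p \<bullet> grad u p) = slab_int t (\<lambda>p. h p \<bullet> dt T u p + P p \<bullet> grad u p)"
    by (rule slab_int_add[symmetric]) (intro continuous_on_inner c')+
  also have "\<dots> = slab_int t (\<lambda>p. dt T (\<lambda>q. h q * u q) p + div_vec (\<lambda>q. u q *\<^sub>R P q) p)"
  proof (rule slab_int_cong)
    fix p assume "p \<in> slab t"
    then have p: "p \<in> slab T" using sub by auto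
    have "dt T h p = - div_vec P p" using classical_solves_L_op(6)[OF cl T p] by simp
    then show "h p \<bullet> dt T u p + P p \<bullet> grad u p = dt T (\<lambda>q. h q * u q) p + div_vec (\<lambda>q. u q *\<^sub>R P q) p"
      unfolding C1_mult(3)[OF cD(1) u T p] div_vec_scaleR[OF u cD(4) T p] by simp
  qed
  also have "\<dots> = slab_int t (dt T (\<lambda>q. h q * u q)) + slab_int t (div_vec (\<lambda>q. u q *\<^sub>R P q))"
    by (rule slab_int_add) (rule continuous_on_subset[OF _ sub], rule C1_dt_continuous[OF hu T] div_vec_continuous[OF T uP])+
  also have "slab_int t (div_vec (\<lambda>q. u q *\<^sub>R P q)) = 0"
  proof -
    have "integral {0..t} (\<lambda>s. cell_integral (\<lambda>x. div_vec (\<lambda>q. u q *\<^sub>R P q) (s, x))) = integral {0..t} (\<lambda>s. 0)"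
      by (rule integral_cong) (use cell_integral_div_vec_zero[OF uP T] t in simp)
    then show ?thesis by (simp add: slab_int_def)
  qed
  finally show "slab_integral 0 t (time_measure T (\<lambda>t. torus_density (\<lambda>x. h (t, x)))) (dt T u) + slab_integral 0 t (slab_density T P) (grad u)
      = torus_density (\<lambda>x. h (t, x)) (\<lambda>x. u (t, x)) - torus_density (\<lambda>x. h (0, x)) (\<lambda>x. u (0, x))"
    unfolding 1 2 slab_int_dt[OF hu T t] torus_density_eq by simp
  have uB: "(\<lambda>q. u q *\<^sub>R B q) \<in> C1_slab T" by (intro C1_scaleR(1) cD u T)
  have "torus_density (\<lambda>x. B (t, x)) (\<lambda>x. grad u (t, x)) = cell_integral (\<lambda>x. div_vec (\<lambda>q. u q *\<^sub>R B q) (t, x))"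
    unfolding torus_density_eq
    by (rule integral_cong) (use t in \<open>simp add: div_vec_scaleR[OF u cD(2) T] cD(6)\<close>)
  then show "torus_density (\<lambda>x. B (t, x)) (\<lambda>x. grad u (t, x)) = 0"
    by (simp add: cell_integral_div_vec_zero[OF uB T t])
qed

lemma classical_dissipative:
  assumes cl: "classical_DMHD T h B D P" and T: "0 < T"
    and K: "holder_half_bounded \<phi> (K T (torus_density (\<lambda>x. h (0, x))) (torus_density (\<lambda>x. B (0, x)))) T
      (\<lambda>t. meas4 (torus_density (\<lambda>x. h (t, x))) (torus_density (\<lambda>x. B (t, x))))"
  shows "dissipative_solution \<phi> K T (torus_density (\<lambda>x. h (0, x))) (torus_density (\<lambda>x. B (0, x)))
        (\<lambda>t. torus_density (\<lambda>x. h (t, x))) (\<lambda>t. torus_density (\<lambda>x. B (t, x)))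
        (slab_density T D) (slab_density T P)"
proof -
  note cD = classical_DMHD_D[OF cl]
  note CS = C1_C_slab[OF cD(1)] C1_C_slab[OF cD(2)] C1_C_slab[OF cD(3)] C1_C_slab[OF cD(4)]
  have z: "0 \<in> {0..T}" using T by simp
  note h0 = slice_C_torus[OF CS(1) z] and B0 = slice_C_torus[OF CS(2) z]
  have pos: "h (0, x) > 0" for x using cD(5) z by simp
  have "Lambda (torus_density (\<lambda>x. h (0, x))) (meas4 lebesgue_torus (torus_density (\<lambda>x. B (0, x)))) < \<infinity>"
  proof -
    let ?u = "\<lambda>x. vec4 (inverse (h (0, x))) (B (0, x) /\<^sub>R h (0, x))"
    note L = classical_solves_L_op(1,2)[OF cl T]
    have one: "(\<lambda>x. 1) \<in> C_torus" by (simp add: C_torus_def)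
    have leb: "lebesgue_torus = torus_density (\<lambda>x. 1)"
      by (simp add: fun_eq_iff torus_density_eq lebesgue_torus_def)
    have "Lambda (torus_density (\<lambda>x. h (0, x))) (meas4 lebesgue_torus (torus_density (\<lambda>x. B (0, x))))
      = ereal (cell_integral (\<lambda>x. h (0, x) * ((norm (?u x))\<^sup>2 / 2)))"
    proof (rule Lambda_density)
      show "?u \<in> C_torus"
        using slice_C_torus[OF C1_C_slab[OF L(1)] z] slice_C_torus[OF C1_C_slab[OF L(2)] z] by (rule vec4_C_torus)
      show "meas4 lebesgue_torus (torus_density (\<lambda>x. B (0, x))) A = cell_integral (\<lambda>x. h (0, x) * (?u x \<bullet> A x))"
        if "A \<in> C_torus" for A
        unfolding leb meas4_torus_density[OF one B0 that]
      proof (rule integral_cong)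
        fix x
        have c: "h (0, x) * (inverse (h (0, x)) * y) = y" for y
          using pos[of x] by (simp add: mult.assoc[symmetric])
        show "vec4 1 (B (0, x)) \<bullet> A x = h (0, x) * (?u x \<bullet> A x)"
          by (simp add: inner_vec4 distrib_left c)
      qed
    qed (use h0 pos in \<open>auto simp: C_torus_def\<close>)
    then show ?thesis by simp
  qed
  then show ?thesis
    unfolding dissipative_solution_def
    using torus_measure_density[OF h0] torus_measure_density[OF B0] weak_star_continuous_density[OF CS(1)]
      weak_star_continuous_density[OF CS(2)] slab_measure_density[OF CS(3) T] slab_measure_density[OF CS(4) T] K
    by (intro conjI ballI allI impI classical_weak_equations[OF cl T] classical_energy_inequality[OF cl T])
      (auto simp: same_measure_def)
qed

section \<open>Uniqueness\<close>

text \<open>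
  The first derivatives of the test fields are bounded on the slab, by periodicity and
  compactness.
\<close>
lemma Qr_mat_ge_mat_1_uniformly:
  assumes bs: "bs \<in> C1_slab T" and ds: "ds \<in> C1_slab T" and vs: "vs \<in> C1_slab T" and T: "0 < T"
  obtains r0 where "\<And>p. p \<in> slab T \<Longrightarrow> loewner_le (mat 1) (Qr_mat r0 bs ds vs p)"
proof -
  have "\<exists>M\<ge>0. \<forall>p\<in>slab T. \<forall>i. norm (dx i f p) \<le> M" if f: "f \<in> C1_slab T" for f :: "real \<times> (real^3) \<Rightarrow> real^3"
  proof -
    have "\<exists>M\<ge>0. \<forall>p\<in>slab T. norm (dx i f p) \<le> M" for i
    proof (rule C_slab_bounded[OF C1_dx_C_slab[OF f T]])
      fix M assume "0 \<le> M" "\<And>p. p \<in> slab T \<Longrightarrow> norm (dx i f p) \<le> M"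
      then show ?thesis by blast
    qed
    then obtain M where M: "\<And>i. 0 \<le> M i" "\<And>i p. p \<in> slab T \<Longrightarrow> norm (dx i f p) \<le> M i" by metis
    have "M i \<le> sum M UNIV" for i using M(1) by (intro member_le_sum) auto
    then have "norm (dx i f p) \<le> sum M UNIV" if "p \<in> slab T" for i p
      using M(2)[OF that] order.trans by blast
    then show ?thesis using M(1) by (intro exI[of _ "sum M UNIV"]) (auto intro: sum_nonneg)
  qed
  from this[OF bs] this[OF ds] this[OF vs] obtain Mb Md Mv where
    M0: "0 \<le> Mb" "0 \<le> Md" "0 \<le> Mv" and
    Mb: "\<And>p i. p \<in> slab T \<Longrightarrow> norm (dx i bs p) \<le> Mb" and
    Md: "\<And>p i. p \<in> slab T \<Longrightarrow> norm (dx i ds p) \<le> Md" and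
    Mv: "\<And>p i. p \<in> slab T \<Longrightarrow> norm (dx i vs p) \<le> Mv" by metis
  define K where "K = 6 * (Mb + Md + Mv)"
  have curl: "norm (curl f p) \<le> 6 * M" if "\<And>i. norm (dx i f p) \<le> M" for f p M
  proof -
    have c: "\<bar>dx i f p $ j\<bar> \<le> M" for i j
      using component_le_norm_cart[of "dx i f p" j] that[of i] by linarith
    have d: "\<bar>dx i f p $ j - dx k f p $ l\<bar> \<le> 2 * M" for i j k l
      using c[of i j] c[of k l] by linarith
    have "norm (curl f p) \<le> (\<Sum>i\<in>UNIV. \<bar>curl f p $ i\<bar>)" by (rule norm_le_l1_cart)
    also have "\<dots> \<le> 6 * M"
      using d[of 2 3 3 2] d[of 3 1 1 3] d[of 1 2 2 1] by (simp add: sum_3 curl_def)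
    finally show ?thesis .
  qed
  show ?thesis
  proof (rule that[of "1 + 5 * K + 2 * K\<^sup>2"])
    fix p assume p: "p \<in> slab T"
    show "loewner_le (mat 1) (Qr_mat (1 + 5 * K + 2 * K\<^sup>2) bs ds vs p)"
    proof (rule Qr_mat_ge_mat_1)
      have "\<bar>dx i vs p $ j\<bar> \<le> Mv" for i j
        using component_le_norm_cart[of "dx i vs p" j] Mv[OF p, of i] by linarith
      from this[of 1 1] this[of 2 2] this[of 3 3] show "\<bar>div_vec vs p\<bar> \<le> K"
        using M0 by (simp add: div_vec_def sum_3 K_def)
      show "norm (curl ds p) \<le> K" "norm (curl bs p) \<le> K"
        using curl[OF Md[OF p]] curl[OF Mb[OF p]] M0 by (simp_all add: K_def)
      show "0 \<le> K" using M0 by (simp add: K_def)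
      fix b :: "real^3"
      have "norm (dir_deriv b vs p) \<le> (\<Sum>j\<in>UNIV. norm ((b $ j) *\<^sub>R dx j vs p))"
        unfolding dir_deriv_def by (rule norm_sum)
      also have "\<dots> \<le> (\<Sum>j\<in>(UNIV::3 set). norm b * Mv)"
      proof (rule sum_mono)
        fix j
        show "norm ((b $ j) *\<^sub>R dx j vs p) \<le> norm b * Mv"
          using component_le_norm_cart[of b j] Mv[OF p, of j] by (simp add: mult_mono)
      qed
      also have "\<dots> = (3 * Mv) * norm b" by simp
      also have "\<dots> \<le> K * norm b" using M0 by (intro mult_right_mono) (auto simp: K_def)
      finally show "norm (dir_deriv b vs p) \<le> K * norm b" .
    qed
  qed
qed

lemma in_dual_add: "in_dual S F \<mu> \<Longrightarrow> f \<in> F \<Longrightarrow> g \<in> F \<Longrightarrow> \<mu> (\<lambda>p. f p + g p) = \<mu> f + \<mu> g"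
  unfolding in_dual_def by blast

lemma in_dual_scale: "in_dual S F \<mu> \<Longrightarrow> f \<in> F \<Longrightarrow> \<mu> (\<lambda>p. c *\<^sub>R f p) = c * \<mu> f"
  unfolding in_dual_def by blast

lemma in_dual_zero: "in_dual S F \<mu> \<Longrightarrow> (\<lambda>_. 0) \<in> F \<Longrightarrow> \<mu> (\<lambda>_. 0) = 0"
  using in_dual_scale[of S F \<mu> "\<lambda>_. 0" 0] by simp

text \<open>
  The bound by the supremum over the slab makes a measure blind to values outside of it.
\<close>
lemma slab_measure_cong:
  assumes W: "slab_measure T W" and f: "f \<in> C_slab {0..T}" and g: "g \<in> C_slab {0..T}"
    and eq: "\<And>p. p \<in> slab T \<Longrightarrow> f p = g p"
  shows "W f = W g"
proof -
  have m: "(\<lambda>p. (- 1) *\<^sub>R g p) \<in> C_slab {0..T}"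
    by (rule C_slab_compose[OF _ g]) (intro continuous_intros)
  have d: "(\<lambda>p. f p + (- 1) *\<^sub>R g p) \<in> C_slab {0..T}"
    using f g by (auto simp: C_slab_def intro: continuous_on_diff)
  have "W (\<lambda>p. f p + (- 1) *\<^sub>R g p) = W f + W (\<lambda>p. (- 1) *\<^sub>R g p)"
    by (rule in_dual_add[OF W f m])
  also have "W (\<lambda>p. (- 1) *\<^sub>R g p) = - 1 * W g" by (rule in_dual_scale[OF W g])
  finally have e: "W (\<lambda>p. f p + (- 1) *\<^sub>R g p) = W f - W g" by simp
  obtain C where C: "\<forall>f\<in>C_slab {0..T}. \<forall>M. (\<forall>p\<in>slab T. norm (f p) \<le> M) \<longrightarrow> \<bar>W f\<bar> \<le> C * M"
    using W unfolding in_dual_def by blast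
  have "\<bar>W (\<lambda>p. f p + (- 1) *\<^sub>R g p)\<bar> \<le> C * 0"
    by (rule C[rule_format, OF d]) (simp add: eq)
  then show ?thesis unfolding e by simp
qed

text \<open>
  For \<open>t = T\<close> the cut-offs change the test function outside the slab only.
\<close>
lemma slab_integral_full:
  fixes f :: "real \<times> (real^3) \<Rightarrow> 'b::euclidean_space"
  assumes cong: "\<And>f g. f \<in> C_slab {0..T} \<Longrightarrow> g \<in> C_slab {0..T} \<Longrightarrow> (\<And>p. p \<in> slab T \<Longrightarrow> f p = g p) \<Longrightarrow> W f = W g"
    and f: "f \<in> C_slab {0..T}"
  shows "slab_integral 0 T W f = W f"
proof -
  have "W (\<lambda>(\<tau>, x). max 0 (1 - real n * \<bar>\<tau> - max 0 (min T \<tau>)\<bar>) *\<^sub>R f (max 0 (min T \<tau>), x)) = W f" for n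
  proof (rule cong[OF _ f])
    let ?g = "\<lambda>(\<tau>, x). max 0 (1 - real n * \<bar>\<tau> - max 0 (min T \<tau>)\<bar>) *\<^sub>R f (max 0 (min T \<tau>), x)"
    show eq: "?g p = f p" if "p \<in> slab T" for p using that by (auto simp: split_beta)
    have "continuous_on (slab T) f" using f by (simp add: C_slab_def)
    then have "continuous_on (slab T) ?g" by (rule continuous_on_eq) (rule eq[symmetric])
    then show "?g \<in> C_slab {0..T}" using f by (auto simp: C_slab_def)
  qed
  then show ?thesis unfolding slab_integral_def by simp
qed

text \<open>
  The test value \<open>\<epsilon> = u / (|k| + 1)\<close> makes the linear term dominate.
\<close>
lemma linear_minus_quadratic_le_0:
  fixes u k :: real
  assumes "\<And>\<epsilon>. \<epsilon> * u \<le> \<epsilon>\<^sup>2 * k"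
  shows "u = 0"
proof (rule ccontr)
  assume "u \<noteq> 0"
  define c where "c = \<bar>k\<bar> + 1"
  have c: "c > 0" "k < c" by (auto simp: c_def)
  have "u / c * u \<le> (u / c)\<^sup>2 * k" by (rule assms)
  then have "c * u\<^sup>2 \<le> u\<^sup>2 * k" using c(1) by (simp add: field_simps power2_eq_square)
  then have "u\<^sup>2 * (c - k) \<le> 0" by (simp add: algebra_simps)
  moreover have "0 < u\<^sup>2 * (c - k)" using \<open>u \<noteq> 0\<close> c(2) by simp
  ultimately show False by simp
qed

lemma U_tilde_scale:
  assumes m: "torus_measure (h t)" "torus_measure (B t)"
    and hs: "(\<lambda>x. inverse (hs (t, x))) \<in> C_torus" and bs: "(\<lambda>x. bs (t, x)) \<in> C_torus" and A: "A \<in> C_torus"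
  shows "U_tilde h B hs bs t (\<lambda>x. c *\<^sub>R A x) = c * U_tilde h B hs bs t A"
proof -
  let ?A1 = "\<lambda>x. A x $ Inl 1" and ?A2 = "\<lambda>x. \<chi> j. A x $ Inr j"
  have A1: "?A1 \<in> C_torus" and A2: "?A2 \<in> C_torus"
    by (rule C_torus_compose[OF _ A], intro continuous_intros)+
  have h1: "h t (\<lambda>x. c * (inverse (hs (t, x)) * ?A1 x)) = c * h t (\<lambda>x. inverse (hs (t, x)) * ?A1 x)"
    using in_dual_scale[OF m(1) C_torus_inner[OF hs A1], of c] by simp
  have h2: "h t (\<lambda>x. c * (bs (t, x) \<bullet> ?A2 x)) = c * h t (\<lambda>x. bs (t, x) \<bullet> ?A2 x)"
    using in_dual_scale[OF m(1) C_torus_inner[OF bs A2], of c] by simp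
  have B2: "B t (\<lambda>x. c *\<^sub>R ?A2 x) = c * B t ?A2" by (rule in_dual_scale[OF m(2) A2])
  have e: "(\<chi> j. c * A x $ Inr j) = c *\<^sub>R ?A2 x" for x by (simp add: vec_eq_iff)
  show ?thesis
    using h1 h2 B2
    by (simp add: e U_tilde_def meas4_def minus_fn_def times_fun_def lebesgue_torus_def mult.left_commute algebra_simps)
qed

lemma zero_C_torus: "(\<lambda>_. 0) \<in> C_torus"
  by (simp add: C_torus_def)

lemma zero_C_slab: "(\<lambda>_. 0) \<in> C_slab I"
  by (simp add: C_slab_def)

lemma slab_integral_zero: "slab_integral s t V (\<lambda>_. 0) = V (\<lambda>_. 0)"
  by (simp add: slab_integral_def case_prod_beta')

lemma U_tilde_vec4:
  "U_tilde h B hs bs t (\<lambda>x. vec4 (f x) (g x)) = lebesgue_torus f - h t (\<lambda>x. inverse (hs (t, x)) * f x)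
    + (B t g - h t (\<lambda>x. bs (t, x) \<bullet> g x))"
  by (simp add: U_tilde_def meas4_def minus_fn_def times_fun_def vec4_def vec_lambda_eta)

lemma ereal_nonneg_sum_le_0:
  fixes a b :: ereal
  assumes "0 \<le> a" "0 \<le> b" "0 < c" "ereal c * a + b \<le> 0"
  shows "a \<le> 0" "b \<le> 0"
proof -
  have ca: "0 \<le> ereal c * a" using assms by simp
  have "b \<le> ereal c * a + b" using ca add_right_mono[of 0 "ereal c * a" b] by simp
  then show "b \<le> 0" using assms(4) by (rule order.trans)
  have "ereal c * a \<le> ereal c * a + b" using assms(2) add_left_mono[of 0 b "ereal c * a"] by simp
  then have "ereal c * a \<le> 0" using assms(4) by (rule order.trans)
  then show "a \<le> 0" using assms(3) ereal_zero_le_0_iff[of "ereal c" "- a"] ereal_mult_le_0_iff[of "ereal c" a] by auto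
qed

lemma vec4_components: "A = vec4 (A $ Inl 1) (\<chi> j. A $ Inr j)"
  by (auto simp: vec_eq_iff vec4_def split: sum.split)

text \<open>
  The test state is the classical solution \<open>(h, b, d, v)\<close>. First \<open>Lambda
  \<le> 0\<close> at time t identifies h' and B' there; then the part of \<open>Lambda_tilde
  \<le> 0\<close> on the whole slab that involves D' and P' identifies these measures.
\<close>
lemma dissipative_unique:
  assumes cl: "classical_DMHD T h B D P" and T: "0 < T"
    and ds: "dissipative_solution \<phi> K T (torus_density (\<lambda>x. h (0, x))) (torus_density (\<lambda>x. B (0, x))) h' B' D' P'"
  shows "t \<in> {0..T} \<Longrightarrow> same_measure C_torus (h' t) (torus_density (\<lambda>x. h (t, x)))"
    and "t \<in> {0..T} \<Longrightarrow> same_measure C_torus (B' t) (torus_density (\<lambda>x. B (t, x)))"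
    and "same_measure (C_slab {0..T}) D' (slab_density T D)"
    and "same_measure (C_slab {0..T}) P' (slab_density T P)"
proof -
  note cD = classical_DMHD_D[OF cl]
  define b where "b = (\<lambda>q. B q /\<^sub>R h q)"
  define d where "d = (\<lambda>q. D q /\<^sub>R h q)"
  define v where "v = (\<lambda>q. P q /\<^sub>R h q)"
  note cs = classical_solves_L_op(1-5)[OF cl T, folded b_def d_def v_def]
  note C = C1_C_slab[OF cD(1)] C1_C_slab[OF cs(1)] C1_C_slab[OF cs(2)] C1_C_slab[OF cs(3)] C1_C_slab[OF cs(4)]
  obtain r where r: "\<And>p. p \<in> slab T \<Longrightarrow> loewner_le (mat 1) (Qr_mat r b d v p)"
    using Qr_mat_ge_mat_1_uniformly[OF cs(2-4) T] by blast
  define U where "U = U_tilde h' B' h b"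
  define W where "W = W_tilde T h' B' D' P' h b d v"
  define Q where "Q = (\<lambda>p. exp (- r * fst p) *\<^sub>R Qr_mat r b d v p)"
  have mh: "\<And>t. t \<in> {0..T} \<Longrightarrow> torus_measure (h' t)" and mB: "\<And>t. t \<in> {0..T} \<Longrightarrow> torus_measure (B' t)"
    and mD: "slab_measure T D'" and mP: "slab_measure T P'"
    and init: "same_measure C_torus (h' 0) (torus_density (\<lambda>x. h (0, x)))" "same_measure C_torus (B' 0) (torus_density (\<lambda>x. B (0, x)))"
    using ds unfolding dissipative_solution_def weak_star_continuous_def by blast+
  have ineq: "ereal (exp (- r * t)) * Lambda (h' t) (U t) + Lambda_tilde (time_measure T h') W Q 0 t
      + ereal (slab_integral 0 t W (\<lambda>p. exp (- r * fst p) *\<^sub>R L_op T h b d v p)) \<le> Lambda (h' 0) (U 0)"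
    if t: "t \<in> {0..T}" for t
  proof -
    have "\<forall>t\<in>{0..T}. \<forall>vs\<in>C1_slab T. \<forall>bs\<in>C1_slab T. \<forall>ds\<in>C1_slab T. \<forall>hs\<in>C1_slab T.
        (\<forall>p\<in>{0..T} \<times> UNIV. hs p > 0) \<longrightarrow>
        (\<forall>r0. (\<forall>p\<in>{0..T} \<times> UNIV. loewner_le (mat 1) (Qr_mat r0 bs ds vs p)) \<longrightarrow>
          (\<forall>r\<ge>r0.
             ereal (exp (- r * t)) * Lambda (h' t) (U_tilde h' B' hs bs t) +
             Lambda_tilde (time_measure T h') (W_tilde T h' B' D' P' hs bs ds vs)
               (\<lambda>p. exp (- r * fst p) *\<^sub>R Qr_mat r bs ds vs p) 0 t +
             ereal (slab_integral 0 t (W_tilde T h' B' D' P' hs bs ds vs)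
               (\<lambda>p. exp (- r * fst p) *\<^sub>R L_op T hs bs ds vs p))
             \<le> Lambda (h' 0) (U_tilde h' B' hs bs 0)))"
      using ds unfolding dissipative_solution_def by (elim conjE)
    note this[rule_format, OF t cs(4) cs(2) cs(3) cD(1) cD(5) r order.refl]
    then show ?thesis unfolding U_def W_def Q_def .
  qed
  have \<tau>C: "(\<lambda>x. inverse (h (t, x))) \<in> C_torus" and bC: "(\<lambda>x. b (t, x)) \<in> C_torus" and hC: "(\<lambda>x. h (t, x)) \<in> C_torus"
    if "t \<in> {0..T}" for t
    using slice_C_torus[OF C(1) that] slice_C_torus[OF C(2) that] slice_C_torus[OF C(3) that] by simp_all
  have pos: "h (t, x) > 0" if "t \<in> {0..T}" for t x using cD(5) that by simp
  have hb: "h p *\<^sub>R b p = B p" "h p *\<^sub>R d p = D p" "h p *\<^sub>R v p = P p" if "p \<in> slab T" for p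
    using cD(5)[OF that] by (simp_all add: b_def d_def v_def)
  have h'0: "h' t (\<lambda>_. 0) = 0" and B'0: "B' t (\<lambda>_. 0) = 0" if "t \<in> {0..T}" for t
    using in_dual_zero[OF mh[OF that] zero_C_torus] in_dual_zero[OF mB[OF that] zero_C_torus] by simp_all
  have D'0: "D' (\<lambda>_. 0) = 0" and P'0: "P' (\<lambda>_. 0) = 0"
    using in_dual_zero[OF mD zero_C_slab] in_dual_zero[OF mP zero_C_slab] by simp_all
  have U0: "U t (\<lambda>_. 0) = 0" if "t \<in> {0..T}" for t
  proof -
    have "(\<lambda>_. 0) = (\<lambda>x::real^3. vec4 0 0)" by (simp add: fun_eq_iff vec4_def vec_eq_iff split: sum.split)
    then show ?thesis unfolding U_def using U_tilde_vec4[of h' B' h b t "\<lambda>_. 0" "\<lambda>_. 0"] h'0[OF that] B'0[OF that]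
      by (simp add: lebesgue_torus_def)
  qed
  have th0: "time_measure T h' (\<lambda>_. 0) = 0"
  proof -
    have "time_measure T h' (\<lambda>_. 0) = integral {0..T} (\<lambda>t. 0)"
      unfolding time_measure_def by (rule integral_cong) (simp add: h'0)
    then show ?thesis by simp
  qed
  have tU0: "time_measure T U (\<lambda>_. 0) = 0"
  proof -
    have "time_measure T U (\<lambda>_. 0) = integral {0..T} (\<lambda>t. 0)"
      unfolding time_measure_def by (rule integral_cong) (simp add: U0)
    then show ?thesis by simp
  qed
  have Wvec: "W F = time_measure T U (\<lambda>p. \<chi> i. case i of Inl u \<Rightarrow> F p $ Inl u | Inr j \<Rightarrow> F p $ Inr (Inl j))
      + (D' (\<lambda>p. \<chi> j. F p $ Inr (Inr (Inl j))) - time_measure T h' (\<lambda>p. d p \<bullet> (\<chi> j. F p $ Inr (Inr (Inl j)))))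
      + (P' (\<lambda>p. \<chi> j. F p $ Inr (Inr (Inr j))) - time_measure T h' (\<lambda>p. v p \<bullet> (\<chi> j. F p $ Inr (Inr (Inr j)))))" for F
    by (simp add: W_def W_tilde_def meas10_def minus_fn_def times_fun_def U_def)
  have W0: "W (\<lambda>_. 0) = 0"
  proof -
    have "(\<chi> i. case i of Inl u \<Rightarrow> 0 $ Inl u | Inr j \<Rightarrow> 0 $ Inr (Inl j)) = (0::real^i4)" "(\<chi> j. 0) = (0::real^3)" "(\<chi> i. 0) = (0::real^i4)"
      by (auto simp: vec_eq_iff split: sum.split)
    then show ?thesis unfolding Wvec by (simp add: tU0 th0 D'0 P'0)
  qed
  \<comment> \<open>the relative energy at time 0: the test state agrees with the initial data\<close>
  have R: "Lambda (h' 0) (U 0) \<le> 0"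
    unfolding Lambda_def
  proof (rule SUP_least, clarify)
    have z: "0 \<in> {0..T}" using T by simp
    fix a and A :: "real^3 \<Rightarrow> real^i4"
    assume aA: "a \<in> C_torus" "A \<in> C_torus" "\<forall>x. a x + (norm (A x))\<^sup>2 / 2 \<le> 0"
    let ?A1 = "\<lambda>x. A x $ Inl 1" and ?A2 = "\<lambda>x. \<chi> j. A x $ Inr j"
    have A1: "?A1 \<in> C_torus" and A2: "?A2 \<in> C_torus"
      by (rule C_torus_compose[OF _ aA(2)], intro continuous_intros)+
    have "h' 0 (\<lambda>x. inverse (h (0, x)) * ?A1 x) = cell_integral (\<lambda>x. h (0, x) * (inverse (h (0, x)) * ?A1 x))"
      using init(1) C_torus_inner[OF \<tau>C[OF z] A1] by (simp add: same_measure_def torus_density_eq)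
    also have "\<dots> = lebesgue_torus ?A1"
      unfolding lebesgue_torus_def using pos[OF z] by (intro integral_cong) (simp add: mult.assoc[symmetric] less_imp_neq[THEN not_sym])
    finally have 1: "h' 0 (\<lambda>x. inverse (h (0, x)) * ?A1 x) = lebesgue_torus ?A1" .
    have "h' 0 (\<lambda>x. b (0, x) \<bullet> ?A2 x) = cell_integral (\<lambda>x. h (0, x) * (b (0, x) \<bullet> ?A2 x))"
      using init(1) C_torus_inner[OF bC[OF z] A2] by (simp add: same_measure_def torus_density_eq)
    also have "\<dots> = cell_integral (\<lambda>x. B (0, x) \<bullet> ?A2 x)"
      using hb(1)[of "(0, _)"] z by (intro integral_cong) (simp flip: inner_scaleR_left)
    also have "\<dots> = B' 0 ?A2" using init(2) A2 by (simp add: same_measure_def torus_density_eq)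
    finally have 2: "h' 0 (\<lambda>x. b (0, x) \<bullet> ?A2 x) = B' 0 ?A2" .
    have "U 0 (\<lambda>x. vec4 (?A1 x) (?A2 x)) = 0"
      unfolding U_def U_tilde_vec4 by (simp add: 1 2)
    then have "U 0 A = 0" by (simp flip: vec4_components)
    moreover have "h' 0 a \<le> 0"
    proof -
      have "h' 0 a = cell_integral (\<lambda>x. h (0, x) * a x)"
        using init(1) aA(1) by (simp add: same_measure_def torus_density_eq)
      also have "\<dots> \<le> cell_integral (\<lambda>x. 0)"
      proof (rule integral_le)
        show "(\<lambda>x. h (0, x) * a x) integrable_on cell"
          using hC[OF z] aA(1) by (auto simp: C_torus_def intro!: cell_integrable continuous_intros intro: continuous_on_subset)
        fix x
        have "a x \<le> 0" using aA(3)[rule_format, of x] zero_le_power2[of "norm (A x)"] by linarith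
        then show "h (0, x) * a x \<le> 0" using pos[OF z, of x] by (simp add: mult_le_0_iff)
      qed (rule integrable_0)
      finally show ?thesis by simp
    qed
    ultimately show "ereal (h' 0 a + U 0 A) \<le> 0" by simp
  qed
  have S0: "slab_integral 0 t W (\<lambda>p. exp (- r * fst p) *\<^sub>R L_op T h b d v p) = 0" if t: "t \<in> {0..T}" for t
  proof -
    have "L_op T h b d v (max 0 (min t \<tau>), x) = 0" for \<tau> x using cs(5)[of "(max 0 (min t \<tau>), x)"] t by auto
    then have "slab_integral 0 t W (\<lambda>p. exp (- r * fst p) *\<^sub>R L_op T h b d v p) = lim (\<lambda>n::nat. W (\<lambda>_. 0))"
      unfolding slab_integral_def by (simp add: case_prod_beta')
    then show ?thesis by (simp add: W0)
  qed
  have Lam0: "0 \<le> Lambda (h' t) (U t)" if "t \<in> {0..T}" for t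
  proof -
    have "(\<lambda>_. 0, \<lambda>_. 0) \<in> {(a, A :: real^3 \<Rightarrow> real^i4). a \<in> C_torus \<and> A \<in> C_torus \<and> (\<forall>x. a x + (norm (A x))\<^sup>2 / 2 \<le> 0)}"
      by (simp add: zero_C_torus)
    from SUP_upper[OF this, of "\<lambda>(a, A). ereal (h' t a + U t A)"]
    show ?thesis unfolding Lambda_def by (simp add: h'0[OF that] U0[OF that] zero_ereal_def)
  qed
  have Lt0: "0 \<le> Lambda_tilde (time_measure T h') W Q 0 t" for t
  proof -
    have "(\<lambda>_. 0, \<lambda>_. 0) \<in> {(a, A :: real \<times> (real^3) \<Rightarrow> real^i10). a \<in> C_slab {0..t} \<and> A \<in> C_slab {0..t} \<and>
          (\<forall>p\<in>{0..t} \<times> UNIV. a p + (norm (mat_sqrt (matrix_inv (Q p)) *v A p))\<^sup>2 / 2 \<le> 0)}"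
      by (simp add: zero_C_slab)
    from SUP_upper[OF this, of "\<lambda>(a, A). ereal (slab_integral 0 t (time_measure T h') a + slab_integral 0 t W A)"]
    show ?thesis unfolding Lambda_tilde_def by (simp add: slab_integral_zero th0 W0 zero_ereal_def)
  qed
  have le0: "Lambda (h' t) (U t) \<le> 0" "Lambda_tilde (time_measure T h') W Q 0 t \<le> 0" if t: "t \<in> {0..T}" for t
  proof -
    have "ereal (exp (- r * t)) * Lambda (h' t) (U t) + Lambda_tilde (time_measure T h') W Q 0 t \<le> 0"
      using order.trans[OF ineq[OF t] R] unfolding S0[OF t] zero_ereal_def[symmetric] add_0_right .
    from ereal_nonneg_sum_le_0[OF Lam0[OF t] Lt0 _ this]
    show "Lambda (h' t) (U t) \<le> 0" "Lambda_tilde (time_measure T h') W Q 0 t \<le> 0" by simp_all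
  qed
  \<comment> \<open>\<open>\<epsilon> A\<close> with \<open>a = - |\<epsilon> A|\<^sup>2 / 2\<close> is admissible for every \<open>\<epsilon>\<close>\<close>
  have Uzero: "U t A = 0" if t: "t \<in> {0..T}" and A: "A \<in> C_torus" for t A
  proof (rule linear_minus_quadratic_le_0)
    fix \<epsilon> :: real
    let ?q = "\<lambda>x. (norm (A x))\<^sup>2 / 2"
    have q: "?q \<in> C_torus" by (rule C_torus_compose[OF _ A]) (intro continuous_intros; simp)
    have c: "(\<lambda>x. c *\<^sub>R A x) \<in> C_torus" "(\<lambda>x. c *\<^sub>R ?q x) \<in> C_torus" for c
      by (rule C_torus_compose[OF _ A] C_torus_compose[OF _ q], intro continuous_intros)+
    have adm: "(- (\<epsilon>\<^sup>2)) *\<^sub>R ?q x + (norm (\<epsilon> *\<^sub>R A x))\<^sup>2 / 2 \<le> 0" for x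
      by (simp add: power_mult_distrib)
    have "(\<lambda>x. (- (\<epsilon>\<^sup>2)) *\<^sub>R ?q x, \<lambda>x. \<epsilon> *\<^sub>R A x) \<in> {(a, A). a \<in> C_torus \<and> A \<in> C_torus \<and> (\<forall>x. a x + (norm (A x))\<^sup>2 / 2 \<le> 0)}"
      using c adm by blast
    from order.trans[OF SUP_upper[OF this, of "\<lambda>(a, A). ereal (h' t a + U t A)"] le0(1)[OF t, unfolded Lambda_def]]
    have "ereal (h' t (\<lambda>x. (- (\<epsilon>\<^sup>2)) *\<^sub>R ?q x) + U t (\<lambda>x. \<epsilon> *\<^sub>R A x)) \<le> 0"
      by (simp only: case_prod_conv)
    moreover have "h' t (\<lambda>x. (- (\<epsilon>\<^sup>2)) *\<^sub>R ?q x) = - (\<epsilon>\<^sup>2) * h' t ?q" by (rule in_dual_scale[OF mh[OF t] q])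
    moreover have "U t (\<lambda>x. \<epsilon> *\<^sub>R A x) = \<epsilon> * U t A"
      unfolding U_def by (rule U_tilde_scale[where h = h' and B = B' and t = t and hs = h and bs = b, OF mh[OF t] mB[OF t] \<tau>C[OF t] bC[OF t] A])
    ultimately show "\<epsilon> * U t A \<le> \<epsilon>\<^sup>2 * h' t ?q" by simp
  qed
  \<comment> \<open>the test field \<open>(h f, 0)\<close> undoes the division by h in the first component of \<open>U t\<close>\<close>
  have h_eq: "h' t f = torus_density (\<lambda>x. h (t, x)) f" if t: "t \<in> {0..T}" and f: "f \<in> C_torus" for t f
  proof -
    have hf: "(\<lambda>x. h (t, x) * f x) \<in> C_torus" using C_torus_inner[OF hC[OF t] f] by simp
    have "U t (\<lambda>x. vec4 (h (t, x) * f x) 0) = 0" by (intro Uzero t vec4_C_torus hf zero_C_torus)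
    moreover have "(\<lambda>x. inverse (h (t, x)) * (h (t, x) * f x)) = f"
      using pos[OF t] by (simp add: mult.assoc[symmetric] less_imp_neq[THEN not_sym])
    ultimately show ?thesis
      unfolding U_def U_tilde_vec4 by (simp add: h'0[OF t] B'0[OF t] torus_density_eq lebesgue_torus_def)
  qed
  have B_eq: "B' t f = torus_density (\<lambda>x. B (t, x)) f" if t: "t \<in> {0..T}" and f: "f \<in> C_torus" for t f
  proof -
    have "U t (\<lambda>x. vec4 0 (f x)) = 0" by (intro Uzero t vec4_C_torus f zero_C_torus)
    then have "B' t f = h' t (\<lambda>x. b (t, x) \<bullet> f x)"
      unfolding U_def U_tilde_vec4 by (simp add: h'0[OF t] lebesgue_torus_def)
    also have "\<dots> = cell_integral (\<lambda>x. h (t, x) * (b (t, x) \<bullet> f x))"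
      using h_eq[OF t C_torus_inner[OF bC[OF t] f]] by (simp add: torus_density_eq)
    also have "\<dots> = cell_integral (\<lambda>x. B (t, x) \<bullet> f x)"
      using hb(1)[of "(t, _)"] t by (intro integral_cong) (simp flip: inner_scaleR_left)
    finally show ?thesis by (simp add: torus_density_eq)
  qed
  show "t \<in> {0..T} \<Longrightarrow> same_measure C_torus (h' t) (torus_density (\<lambda>x. h (t, x)))"
    "t \<in> {0..T} \<Longrightarrow> same_measure C_torus (B' t) (torus_density (\<lambda>x. B (t, x)))"
    using h_eq B_eq by (simp_all add: same_measure_def)
  have tU: "time_measure T U F = 0" if F: "F \<in> C_slab {0..T}" for F
  proof -
    have "time_measure T U F = integral {0..T} (\<lambda>t. 0)"
      unfolding time_measure_def by (rule integral_cong) (rule Uzero, assumption, rule slice_C_torus[OF F])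
    then show ?thesis by simp
  qed
  have th: "time_measure T h' F = slab_int T (\<lambda>p. h p * F p)" if F: "F \<in> C_slab {0..T}" for F
    unfolding time_measure_def slab_int_def
    by (rule integral_cong) (simp add: h_eq slice_C_torus[OF F] torus_density_eq)
  have parts: "(\<lambda>p. \<chi> i. case i of Inl u \<Rightarrow> F p $ Inl u | Inr j \<Rightarrow> F p $ Inr (Inl j)) \<in> C_slab {0..T}"
    "(\<lambda>p. \<chi> j. F p $ Inr (Inr (Inl j))) \<in> C_slab {0..T}" "(\<lambda>p. \<chi> j. F p $ Inr (Inr (Inr j))) \<in> C_slab {0..T}"
    if F: "F \<in> C_slab {0..T}" for F :: "real \<times> (real^3) \<Rightarrow> real^i10"
  proof -
    have "continuous_on UNIV (\<lambda>y::real^i10. case i of Inl u \<Rightarrow> y $ Inl u | Inr j \<Rightarrow> y $ Inr (Inl j))" for i :: i4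
      by (cases i) (auto intro!: continuous_intros)
    then show "(\<lambda>p. \<chi> i. case i of Inl u \<Rightarrow> F p $ Inl u | Inr j \<Rightarrow> F p $ Inr (Inl j)) \<in> C_slab {0..T}"
      by (intro C_slab_compose[OF _ F] continuous_on_vec_lambda)
    show "(\<lambda>p. \<chi> j. F p $ Inr (Inr (Inl j))) \<in> C_slab {0..T}" "(\<lambda>p. \<chi> j. F p $ Inr (Inr (Inr j))) \<in> C_slab {0..T}"
      by (rule C_slab_compose[OF _ F], intro continuous_intros)+
  qed
  have WF: "W F = (D' (\<lambda>p. \<chi> j. F p $ Inr (Inr (Inl j))) - slab_int T (\<lambda>p. h p * (d p \<bullet> (\<chi> j. F p $ Inr (Inr (Inl j))))))
      + (P' (\<lambda>p. \<chi> j. F p $ Inr (Inr (Inr j))) - slab_int T (\<lambda>p. h p * (v p \<bullet> (\<chi> j. F p $ Inr (Inr (Inr j))))))"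
    if F: "F \<in> C_slab {0..T}" for F
    unfolding Wvec tU[OF parts(1)[OF F]] th[OF C_slab_inner[OF C(4) parts(2)[OF F]]] th[OF C_slab_inner[OF C(5) parts(3)[OF F]]]
    by simp
  have Wcong: "W f = W g" if f: "f \<in> C_slab {0..T}" and g: "g \<in> C_slab {0..T}" and eq: "\<And>p. p \<in> slab T \<Longrightarrow> f p = g p" for f g
    unfolding WF[OF f] WF[OF g]
    by (intro arg_cong2[where f = "(+)"] arg_cong2[where f = "(-)"] slab_int_cong
      slab_measure_cong[OF mD] slab_measure_cong[OF mP] parts f g) (simp_all add: eq)
  have Wscale: "W (\<lambda>p. c *\<^sub>R F p) = c * W F" if F: "F \<in> C_slab {0..T}" for c F
  proof -
    have cF: "(\<lambda>p. c *\<^sub>R F p) \<in> C_slab {0..T}" by (rule C_slab_compose[OF _ F]) (intro continuous_intros)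
    have e: "(\<lambda>p. \<chi> j. (c *\<^sub>R F p) $ Inr (Inr (Inl j))) = (\<lambda>p. c *\<^sub>R (\<chi> j. F p $ Inr (Inr (Inl j))))"
      "(\<lambda>p. \<chi> j. (c *\<^sub>R F p) $ Inr (Inr (Inr j))) = (\<lambda>p. c *\<^sub>R (\<chi> j. F p $ Inr (Inr (Inr j))))"
      by (simp_all add: fun_eq_iff vec_eq_iff)
    have s: "slab_int T (\<lambda>p. h p * (z p \<bullet> (c *\<^sub>R F' p))) = c * slab_int T (\<lambda>p. h p * (z p \<bullet> F' p))"
      for z F' :: "real \<times> (real^3) \<Rightarrow> real^3"
      unfolding slab_int_cmult[symmetric] by (simp add: mult.left_commute)
    show ?thesis
      unfolding WF[OF cF] WF[OF F] e[THEN fun_cong] e in_dual_scale[OF mD parts(2)[OF F]] in_dual_scale[OF mP parts(3)[OF F]]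
      using s[of d "\<lambda>p. \<chi> j. F p $ Inr (Inr (Inl j))"] s[of v "\<lambda>p. \<chi> j. F p $ Inr (Inr (Inr j))"]
      by (simp add: algebra_simps)
  qed
  have Wzero: "W A = 0" if A: "A \<in> C_slab {0..T}" for A
  proof (rule linear_minus_quadratic_le_0)
    fix \<epsilon> :: real
    have T_in: "T \<in> {0..T}" using T by simp
    \<comment> \<open>a lower bound for the matrices \<open>Q p\<close> that is uniform on the slab\<close>
    define c where "c = exp (- \<bar>r\<bar> * T)"
    have c: "c > 0" by (simp add: c_def)
    let ?q = "\<lambda>p. (A p \<bullet> A p) / (2 * c)"
    have q: "?q \<in> C_slab {0..T}" using c by (intro C_slab_compose[OF _ A] continuous_intros) simp
    have sc: "(\<lambda>x. k *\<^sub>R A x) \<in> C_slab {0..T}" "(\<lambda>x. k *\<^sub>R ?q x) \<in> C_slab {0..T}" for k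
      by (rule C_slab_compose[OF _ A] C_slab_compose[OF _ q], intro continuous_intros)+
    have adm: "(- (\<epsilon>\<^sup>2)) *\<^sub>R ?q p + (norm (mat_sqrt (matrix_inv (Q p)) *v (\<epsilon> *\<^sub>R A p)))\<^sup>2 / 2 \<le> 0" if p: "p \<in> slab T" for p
    proof -
      have "c \<le> exp (- r * fst p)"
      proof -
        have "r * fst p \<le> \<bar>r\<bar> * fst p" using p by (intro mult_right_mono) auto
        also have "\<dots> \<le> \<bar>r\<bar> * T" using p by (intro mult_left_mono) auto
        finally show ?thesis by (simp add: c_def)
      qed
      then have pd: "c * (x \<bullet> x) \<le> x \<bullet> (Q p *v x)" for x
      proof -
        have "c * (x \<bullet> x) \<le> exp (- r * fst p) * (x \<bullet> (Qr_mat r b d v p *v x))"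
          using \<open>c \<le> _\<close> c Qr_mat_mono[OF r[OF p] order.refl, of x] by (intro mult_mono) auto
        then show ?thesis by (simp add: Q_def scaleR_matrix_vector_assoc[symmetric])
      qed
      have sym: "transpose (Q p) = Q p" by (simp add: Q_def transpose_scalar transpose_Qr_mat)
      have "(norm (mat_sqrt (matrix_inv (Q p)) *v (\<epsilon> *\<^sub>R A p)))\<^sup>2 \<le> ((\<epsilon> *\<^sub>R A p) \<bullet> (\<epsilon> *\<^sub>R A p)) / c"
        by (rule mat_sqrt_matrix_inv_bounds(1)[OF sym c pd])
      also have "\<dots> = 2 * (\<epsilon>\<^sup>2 * ?q p)" by (simp add: power2_eq_square)
      finally show ?thesis by simp
    qed
    have "(\<lambda>p. (- (\<epsilon>\<^sup>2)) *\<^sub>R ?q p, \<lambda>p. \<epsilon> *\<^sub>R A p) \<in> {(a, A). a \<in> C_slab {0..T} \<and> A \<in> C_slab {0..T} \<and>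
          (\<forall>p\<in>{0..T} \<times> UNIV. a p + (norm (mat_sqrt (matrix_inv (Q p)) *v A p))\<^sup>2 / 2 \<le> 0)}"
      using sc adm by blast
    from order.trans[OF SUP_upper[OF this, of "\<lambda>(a, A). ereal (slab_integral 0 T (time_measure T h') a + slab_integral 0 T W A)"]
      le0(2)[OF T_in, unfolded Lambda_tilde_def]]
    have "ereal (slab_integral 0 T (time_measure T h') (\<lambda>p. (- (\<epsilon>\<^sup>2)) *\<^sub>R ?q p) + slab_integral 0 T W (\<lambda>p. \<epsilon> *\<^sub>R A p)) \<le> 0"
      by (simp only: case_prod_conv)
    moreover have "slab_integral 0 T W (\<lambda>p. \<epsilon> *\<^sub>R A p) = \<epsilon> * W A"
      unfolding Wscale[OF A, symmetric] by (rule slab_integral_full[OF Wcong sc(1)])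
    moreover have "slab_integral 0 T (time_measure T h') (\<lambda>p. (- (\<epsilon>\<^sup>2)) *\<^sub>R ?q p) = time_measure T h' (\<lambda>p. (- (\<epsilon>\<^sup>2)) *\<^sub>R ?q p)"
    proof (rule slab_integral_full[OF _ sc(2)])
      fix f g :: "real \<times> (real^3) \<Rightarrow> real"
      assume "\<And>p. p \<in> slab T \<Longrightarrow> f p = g p"
      then show "time_measure T h' f = time_measure T h' g"
        unfolding time_measure_def by (intro integral_cong) simp
    qed
    moreover have "time_measure T h' (\<lambda>p. (- (\<epsilon>\<^sup>2)) *\<^sub>R ?q p) = - (\<epsilon>\<^sup>2) * slab_int T (\<lambda>p. h p * ?q p)"
      unfolding th[OF sc(2)] slab_int_cmult[symmetric] by (simp add: mult_ac)
    ultimately show "\<epsilon> * W A \<le> \<epsilon>\<^sup>2 * slab_int T (\<lambda>p. h p * ?q p)" by simp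
  qed
  have vec10_C: "(\<lambda>p. vec10 0 0 (f p) (g p)) \<in> C_slab {0..T}" if "f \<in> C_slab {0..T}" "g \<in> C_slab {0..T}" for f g
    using that by (auto simp: C_slab_def intro!: vec10_continuous)
  have hz: "slab_int T (\<lambda>p. h p * (z p \<bullet> f p)) = slab_density T Z f" if "\<And>p. p \<in> slab T \<Longrightarrow> h p *\<^sub>R z p = Z p" for z Z f
    unfolding slab_density_eq by (rule slab_int_cong) (simp add: that[symmetric])
  have WDP: "(D' f - slab_density T D f) + (P' g - slab_density T P g) = 0"
    if "f \<in> C_slab {0..T}" "g \<in> C_slab {0..T}" for f g
    using Wzero[OF vec10_C[OF that]] unfolding WF[OF vec10_C[OF that]]
    by (simp add: vec_lambda_eta hz[OF hb(2)] hz[OF hb(3)])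
  show "same_measure (C_slab {0..T}) D' (slab_density T D)"
    using WDP[OF _ zero_C_slab] P'0 by (simp add: same_measure_def slab_density_eq slab_int_def)
  show "same_measure (C_slab {0..T}) P' (slab_density T P)"
    using WDP[OF zero_C_slab] D'0 by (simp add: same_measure_def slab_density_eq slab_int_def)
qed

lemma holder_half_bounded_cong:
  assumes "\<And>n t. t \<in> {0..T} \<Longrightarrow> \<mu> t (\<phi> n) = \<nu> t (\<phi> n)" "holder_half_bounded \<phi> C T \<mu>"
  shows "holder_half_bounded \<phi> C T \<nu>"
  using assms by (simp add: holder_half_bounded_def weak_star_dist_def)

theorem proposition4p3:
  fixes \<phi> :: "nat \<Rightarrow> real^3 \<Rightarrow> real^i4"
  assumes "test_family \<phi>"
  shows "\<exists>K :: real \<Rightarrow> (real^3, real) functional \<Rightarrow> (real^3, real^3) functional \<Rightarrow> real.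
    \<forall>(T :: real) (h :: real \<times> (real^3) \<Rightarrow> real) (B :: real \<times> (real^3) \<Rightarrow> real^3)
      (D :: real \<times> (real^3) \<Rightarrow> real^3) (P :: real \<times> (real^3) \<Rightarrow> real^3)
      (h0 :: real^3 \<Rightarrow> real) (B0 :: real^3 \<Rightarrow> real^3).
      T > 0 \<longrightarrow> classical_DMHD T h B D P \<longrightarrow>
      (\<forall>x. h (0, x) = h0 x) \<longrightarrow> (\<forall>x. B (0, x) = B0 x) \<longrightarrow>
      dissipative_solution \<phi> K T (torus_density h0) (torus_density B0)
        (\<lambda>t. torus_density (\<lambda>x. h (t, x))) (\<lambda>t. torus_density (\<lambda>x. B (t, x)))
        (slab_density T D) (slab_density T P) \<and>
      (\<forall>K' h' B' D' P'.
        dissipative_solution \<phi> K' T (torus_density h0) (torus_density B0) h' B' D' P' \<longrightarrow>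
        (\<forall>t\<in>{0..T}. same_measure C_torus (h' t) (torus_density (\<lambda>x. h (t, x))) \<and>
                     same_measure C_torus (B' t) (torus_density (\<lambda>x. B (t, x)))) \<and>
        same_measure (C_slab {0..T}) D' (slab_density T D) \<and>
        same_measure (C_slab {0..T}) P' (slab_density T P))"
proof -
  define curve where "curve h B t = meas4 (torus_density (\<lambda>x. h (t, x))) (torus_density (\<lambda>x. B (t, x)))"
    for h :: "real \<times> (real^3) \<Rightarrow> real" and B :: "real \<times> (real^3) \<Rightarrow> real^3" and t
  define good where "good T \<mu> \<nu> C \<longleftrightarrow> (\<exists>h B D P. classical_DMHD T h B D P \<and> \<mu> = torus_density (\<lambda>x. h (0, x)) \<and>
      \<nu> = torus_density (\<lambda>x. B (0, x)) \<and> holder_half_bounded \<phi> C T (curve h B))" for T \<mu> \<nu> C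
  \<comment> \<open>by uniqueness a bound for one classical solution with given data is a bound for all of them\<close>
  define K where "K T \<mu> \<nu> = (SOME C. good T \<mu> \<nu> C)" for T \<mu> \<nu>
  have "Ck_torus 0 (\<phi> n)" for n using assms unfolding test_family_def by blast
  then have \<phi>C: "\<phi> n \<in> C_torus" for n by simp
  have holder: "holder_half_bounded \<phi> (K T (torus_density (\<lambda>x. h (0, x))) (torus_density (\<lambda>x. B (0, x)))) T (curve h B)"
    if T: "0 < T" and cl: "classical_DMHD T h B D P" for T h B D P
  proof -
    define \<mu> where "\<mu> = torus_density (\<lambda>x. h (0, x))"
    define \<nu> where "\<nu> = torus_density (\<lambda>x. B (0, x))"
    have "\<exists>C. good T \<mu> \<nu> C"
      using classical_holder[OF assms cl T] cl unfolding good_def \<mu>_def \<nu>_def curve_def by blast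
    then have "good T \<mu> \<nu> (K T \<mu> \<nu>)" unfolding K_def by (rule someI_ex)
    then obtain h1 B1 D1 P1 where 1: "classical_DMHD T h1 B1 D1 P1" "\<mu> = torus_density (\<lambda>x. h1 (0, x))"
      "\<nu> = torus_density (\<lambda>x. B1 (0, x))" "holder_half_bounded \<phi> (K T \<mu> \<nu>) T (curve h1 B1)"
      unfolding good_def by blast
    have "dissipative_solution \<phi> K T \<mu> \<nu> (\<lambda>t. torus_density (\<lambda>x. h1 (t, x))) (\<lambda>t. torus_density (\<lambda>x. B1 (t, x)))
        (slab_density T D1) (slab_density T P1)"
      using classical_dissipative[OF 1(1) T, of \<phi> K] 1(4) unfolding 1(2,3)[symmetric] curve_def by blast
    note u = dissipative_unique(1,2)[OF cl T this[unfolded \<mu>_def \<nu>_def]]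
    have "curve h1 B1 t (\<phi> n) = curve h B t (\<phi> n)" if t: "t \<in> {0..T}" for t n
    proof -
      have "(\<lambda>x. \<phi> n x $ Inl 1) \<in> C_torus" "(\<lambda>x. \<chi> j. \<phi> n x $ Inr j) \<in> C_torus"
        by (rule C_torus_compose[OF _ \<phi>C[of n]], intro continuous_intros)+
      then show ?thesis using u[OF t] by (simp add: curve_def meas4_def same_measure_def)
    qed
    from holder_half_bounded_cong[OF this 1(4)] show ?thesis unfolding \<mu>_def \<nu>_def .
  qed
  show ?thesis
  proof (rule exI[of _ K], intro allI impI conjI ballI)
    fix T h B D P h0 B0
    assume T: "T > 0" and cl: "classical_DMHD T h B D P" and "\<forall>x. h (0, x) = h0 x" "\<forall>x. B (0, x) = B0 x"
    then have eq: "h0 = (\<lambda>x. h (0, x))" "B0 = (\<lambda>x. B (0, x))" by auto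
    show "dissipative_solution \<phi> K T (torus_density h0) (torus_density B0)
        (\<lambda>t. torus_density (\<lambda>x. h (t, x))) (\<lambda>t. torus_density (\<lambda>x. B (t, x)))
        (slab_density T D) (slab_density T P)"
      unfolding eq by (rule classical_dissipative[where \<phi> = \<phi> and K = K, OF cl T holder[OF T cl, unfolded curve_def]])
    fix K' h' B' D' P'
    assume ds: "dissipative_solution \<phi> K' T (torus_density h0) (torus_density B0) h' B' D' P'"
    note u = dissipative_unique[OF cl T ds[unfolded eq]]
    show "same_measure (C_slab {0..T}) D' (slab_density T D)" by (rule u(3))
    show "same_measure (C_slab {0..T}) P' (slab_density T P)" by (rule u(4))
    fix t assume t: "t \<in> {0..T}"
    show "same_measure C_torus (h' t) (torus_density (\<lambda>x. h (t, x)))" by (rule u(1)[OF t])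
    show "same_measure C_torus (B' t) (torus_density (\<lambda>x. B (t, x)))" by (rule u(2)[OF t])
  qed
qed

end
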